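(* Let $\mathscr{C}$ be a $2d$-Calabi-Yau $(d+2)$-angulated category that is $K$-linear, Hom-finite and Krull-Schmidt. Let $T$ and $U$ be two basic Oppermann-Thomas cluster tilting objects of $\mathscr{C}$, with $\mathscr{T}=\mathrm{add}(T)$ and $\mathscr{U}=\mathrm{add}(U)$. Then $\mathscr{T}$ and $\mathscr{U}$ have the same number of indecomposable objects (up to isomorphism).
   Context: Throughout, $K$ is an algebraically closed field and $d$ is a positive integer. **$(d+2)$-angulated categories (Geiss-Keller-Oppermann).** Let $\mathscr{C}$ be an additive category with an automorphism $\Sigma^d$ (not assumed to be the $d$-th power of another functor). A $\Sigma^d$-sequence is a diagram $c^0\xrightarrow{\gamma^0}c^1\xrightarrow{\gamma^1}\cdots\to c^{d+1}\xrightarrow{\gamma^{d+1}}\Sigma^d(c^0)$. A $(d+2)$-angulated category is such a $\mathscr{C}$ together with a class of $\Sigma^d$-sequences, called $(d+2)$-angles, such that: (N1) the class is closed under sums and summands, contains $c\xrightarrow{\mathrm{id}}c\to0\to\cdots\to0\to\Sigma^d(c)$ for each $c$, and each morphism $c^0\to c^1$ is the first morphism of some $(d+2)$-angle; (N2) a $\Sigma^d$-sequence $c^0\xrightarrow{\gamma^0}c^1\xrightarrow{\gamma^1}\cdots\to c^{d+1}\xrightarrow{\gamma^{d+1}}\Sigma^d(c^0)$ is a $(d+2)$-angle if and only if its left rotation $c^1\xrightarrow{\gamma^1}c^2\to\cdots\to c^{d+1}\xrightarrow{\gamma^{d+1}}\Sigma^d(c^0)\xrightarrow{(-1)^d\Sigma^d(\gamma^0)}\Sigma^d(c^1)$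 is; (N3) given $(d+2)$-angles $b^\bullet$ and $c^\bullet$ with morphisms $\beta^i,\gamma^i$, and $\varphi^0:b^0\to c^0$, $\varphi^1:b^1\to c^1$ with $\varphi^1\beta^0=\gamma^0\varphi^0$, there are $\varphi^i:b^i\to c^i$ ($2\le i\le d+1$) completing $\varphi^0,\varphi^1,\Sigma^d(\varphi^0)$ to a morphism of $\Sigma^d$-sequences; (N4) (octahedral axiom) in (N3) the $\varphi^i$ can be chosen so that the mapping cone $b^1\oplus c^0\to b^2\oplus c^1\to\cdots\to\Sigma^d b^0\oplus c^{d+1}\to\Sigma^d b^1\oplus\Sigma^d c^0$, with morphisms $\begin{pmatrix}-\beta^{i+1}&0\\ \varphi^{i+1}&\gamma^i\end{pmatrix}$ for $0\le i\le d$ and last morphism $\begin{pmatrix}-\Sigma^d\beta^0&0\\ \Sigma^d\varphi^0&\gamma^{d+1}\end{pmatrix}$, is a $(d+2)$-angle. $\mathscr{C}$ is $2d$-Calabi-Yau if it has a Serre functor (an auto-equivalence $S$ with isomorphisms $\mathrm{Hom}_{\mathscr{C}}(Y,SX)\cong D\,\mathrm{Hom}_{\mathscr{C}}(X,Y)$ natural in $X,Y$, where $D=\mathrm{Hom}_K(-,K)$) isomorphic to $\Sigma^{2d}:=(\Sigma^d)^2$. **Oppermann-Thomas cluster tilting.** An object $T$ is an Oppermann-Thomas cluster tilting object if, with $\mathscr{T}=\mathrm{add}(T)$: (i) $\mathrm{Hom}_{\mathscr{C}}(\mathscr{T},\Sigma^d\mathscr{T})=0$; (ii) for every $c\in\mathscr{C}$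 there is a $(d+2)$-angle $t_d\to t_{d-1}\to\cdots\to t_0\to c\to\Sigma^d(t_d)$ with all $t_i\in\mathscr{T}$. It is basic if its indecomposable summands are pairwise non-isomorphic. *)

theory Defs
  imports "HOL-Algebra.Algebra"
begin

section \<open>Linear and additive categories\<close>

text \<open>
  Each Hom-set carries the structure of a module over the base ring (the unused
  multiplicative fields of the library's module record are irrelevant).
  Composition is written in the usual order, \<open>g \<cdot> f\<close> being ``first \<open>f\<close>, then \<open>g\<close>''.  Neither
  composition nor the action of functors on morphisms is indexed by objects; Hom-sets are not
  required to be disjoint, but they may be, and every category can be brought into that form by
  tagging morphisms with their source and target.
\<close>

record ('k, 'o, 'm) lincat =
  Ob :: "'o set"
  Hom :: "'o \<Rightarrow> 'o \<Rightarrow> ('k, 'm) module"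
  cmp :: "'m \<Rightarrow> 'm \<Rightarrow> 'm"  (infixl \<open>\<cdot>\<index>\<close> 75)
  ident :: "'o \<Rightarrow> 'm"

abbreviation mor :: "('k, 'o, 'm) lincat \<Rightarrow> 'o \<Rightarrow> 'o \<Rightarrow> 'm set"
  where "mor C M N \<equiv> carrier (Hom C M N)"

locale linear_category =
  fixes K :: "'k ring" and C :: "('k, 'o, 'm) lincat" (structure)
  assumes field: "field K"
    and Hom_module: "\<lbrakk>M \<in> Ob C; N \<in> Ob C\<rbrakk> \<Longrightarrow> module K (Hom C M N)"
    and ident_closed: "M \<in> Ob C \<Longrightarrow> ident C M \<in> mor C M M"
    and cmp_closed:
      "\<lbrakk>M \<in> Ob C; N \<in> Ob C; P \<in> Ob C; f \<in> mor C M N; g \<in> mor C N P\<rbrakk> \<Longrightarrow> g \<cdot> f \<in> mor C M P"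
    and cmp_assoc:
      "\<lbrakk>L \<in> Ob C; M \<in> Ob C; N \<in> Ob C; P \<in> Ob C; f \<in> mor C L M; g \<in> mor C M N; h \<in> mor C N P\<rbrakk>
        \<Longrightarrow> (h \<cdot> g) \<cdot> f = h \<cdot> (g \<cdot> f)"
    and cmp_ident_left: "\<lbrakk>M \<in> Ob C; N \<in> Ob C; f \<in> mor C M N\<rbrakk> \<Longrightarrow> ident C N \<cdot> f = f"
    and cmp_ident_right: "\<lbrakk>M \<in> Ob C; N \<in> Ob C; f \<in> mor C M N\<rbrakk> \<Longrightarrow> f \<cdot> ident C M = f"
    and cmp_add_left:
      "\<lbrakk>M \<in> Ob C; N \<in> Ob C; P \<in> Ob C; f \<in> mor C M N; g \<in> mor C N P; g' \<in> mor C N P\<rbrakk>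
        \<Longrightarrow> (g \<oplus>\<^bsub>Hom C N P\<^esub> g') \<cdot> f = (g \<cdot> f) \<oplus>\<^bsub>Hom C M P\<^esub> (g' \<cdot> f)"
    and cmp_add_right:
      "\<lbrakk>M \<in> Ob C; N \<in> Ob C; P \<in> Ob C; f \<in> mor C M N; f' \<in> mor C M N; g \<in> mor C N P\<rbrakk>
        \<Longrightarrow> g \<cdot> (f \<oplus>\<^bsub>Hom C M N\<^esub> f') = (g \<cdot> f) \<oplus>\<^bsub>Hom C M P\<^esub> (g \<cdot> f')"
    and cmp_smult_left:
      "\<lbrakk>M \<in> Ob C; N \<in> Ob C; P \<in> Ob C; a \<in> carrier K; f \<in> mor C M N; g \<in> mor C N P\<rbrakk>
        \<Longrightarrow> (a \<odot>\<^bsub>Hom C N P\<^esub> g) \<cdot> f = a \<odot>\<^bsub>Hom C M P\<^esub> (g \<cdot> f)"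
    and cmp_smult_right:
      "\<lbrakk>M \<in> Ob C; N \<in> Ob C; P \<in> Ob C; a \<in> carrier K; f \<in> mor C M N; g \<in> mor C N P\<rbrakk>
        \<Longrightarrow> g \<cdot> (a \<odot>\<^bsub>Hom C M N\<^esub> f) = a \<odot>\<^bsub>Hom C M P\<^esub> (g \<cdot> f)"

definition is_iso :: "('k, 'o, 'm) lincat \<Rightarrow> 'o \<Rightarrow> 'o \<Rightarrow> 'm \<Rightarrow> bool"
  where "is_iso C M N f \<longleftrightarrow> f \<in> mor C M N \<and>
    (\<exists>g \<in> mor C N M. g \<cdot>\<^bsub>C\<^esub> f = ident C M \<and> f \<cdot>\<^bsub>C\<^esub> g = ident C N)"

definition isomorphic :: "('k, 'o, 'm) lincat \<Rightarrow> 'o \<Rightarrow> 'o \<Rightarrow> bool"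
  where "isomorphic C M N \<longleftrightarrow> (\<exists>f. is_iso C M N f)"

definition is_zero_object :: "('k, 'o, 'm) lincat \<Rightarrow> 'o \<Rightarrow> bool"
  where "is_zero_object C Z \<longleftrightarrow> Z \<in> Ob C \<and>
    (\<forall>M \<in> Ob C. mor C M Z = {\<zero>\<^bsub>Hom C M Z\<^esub>} \<and> mor C Z M = {\<zero>\<^bsub>Hom C Z M\<^esub>})"

definition is_biproduct ::
    "('k, 'o, 'm) lincat \<Rightarrow> 'o \<Rightarrow> 'o \<Rightarrow> 'o \<Rightarrow> 'm \<Rightarrow> 'm \<Rightarrow> 'm \<Rightarrow> 'm \<Rightarrow> bool"
  where "is_biproduct C M N B i1 i2 p1 p2 \<longleftrightarrow>
    M \<in> Ob C \<and> N \<in> Ob C \<and> B \<in> Ob C \<and>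
    i1 \<in> mor C M B \<and> i2 \<in> mor C N B \<and> p1 \<in> mor C B M \<and> p2 \<in> mor C B N \<and>
    p1 \<cdot>\<^bsub>C\<^esub> i1 = ident C M \<and> p2 \<cdot>\<^bsub>C\<^esub> i2 = ident C N \<and>
    p1 \<cdot>\<^bsub>C\<^esub> i2 = \<zero>\<^bsub>Hom C N M\<^esub> \<and> p2 \<cdot>\<^bsub>C\<^esub> i1 = \<zero>\<^bsub>Hom C M N\<^esub> \<and>
    (i1 \<cdot>\<^bsub>C\<^esub> p1) \<oplus>\<^bsub>Hom C B B\<^esub> (i2 \<cdot>\<^bsub>C\<^esub> p2) = ident C B"

definition is_direct_sum ::
    "('k, 'o, 'm) lincat \<Rightarrow> 'o list \<Rightarrow> 'o \<Rightarrow> bool"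
  where "is_direct_sum C Ms B \<longleftrightarrow> set Ms \<subseteq> Ob C \<and> B \<in> Ob C \<and>
    (\<exists>\<iota> \<pi>.
      (\<forall>i < length Ms. \<iota> i \<in> mor C (Ms ! i) B \<and> \<pi> i \<in> mor C B (Ms ! i)) \<and>
      (\<forall>i < length Ms. \<forall>j < length Ms.
        \<pi> j \<cdot>\<^bsub>C\<^esub> \<iota> i =
          (if i = j then ident C (Ms ! i) else \<zero>\<^bsub>Hom C (Ms ! i) (Ms ! j)\<^esub>)) \<and>
      finsum (Hom C B B) (\<lambda>i. \<iota> i \<cdot>\<^bsub>C\<^esub> \<pi> i) {..<length Ms} = ident C B)"

definition is_summand :: "('k, 'o, 'm) lincat \<Rightarrow> 'o \<Rightarrow> 'o \<Rightarrow> bool"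
  where "is_summand C M B \<longleftrightarrow> (\<exists>N i1 i2 p1 p2. is_biproduct C M N B i1 i2 p1 p2)"

locale additive_linear_category = linear_category +
  assumes zero_object: "\<exists>Z. is_zero_object C Z"
    and biproducts: "\<lbrakk>M \<in> Ob C; N \<in> Ob C\<rbrakk> \<Longrightarrow> \<exists>B i1 i2 p1 p2. is_biproduct C M N B i1 i2 p1 p2"

definition finite_dimensional :: "'k ring \<Rightarrow> ('k, 'm) module \<Rightarrow> bool"
  where "finite_dimensional K V \<longleftrightarrow> (\<exists>B. finite B \<and> B \<subseteq> carrier V \<and>
    (\<forall>v \<in> carrier V. \<exists>a \<in> B \<rightarrow> carrier K. v = finsum V (\<lambda>b. a b \<odot>\<^bsub>V\<^esub> b) B))"

definition hom_finite :: "'k ring \<Rightarrow> ('k, 'o, 'm) lincat \<Rightarrow> bool"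
  where "hom_finite K C \<longleftrightarrow> (\<forall>M \<in> Ob C. \<forall>N \<in> Ob C. finite_dimensional K (Hom C M N))"

definition indecomposable :: "('k, 'o, 'm) lincat \<Rightarrow> 'o \<Rightarrow> bool"
  where "indecomposable C M \<longleftrightarrow> M \<in> Ob C \<and> \<not> is_zero_object C M \<and>
    (\<forall>N P i1 i2 p1 p2. is_biproduct C N P M i1 i2 p1 p2 \<longrightarrow>
      is_zero_object C N \<or> is_zero_object C P)"

definition End_ring :: "('k, 'o, 'm) lincat \<Rightarrow> 'o \<Rightarrow> 'm ring"
  where "End_ring C M = \<lparr>carrier = mor C M M, monoid.mult = cmp C, one = ident C M,
    ring.zero = \<zero>\<^bsub>Hom C M M\<^esub>, add = add (Hom C M M)\<rparr>"

text \<open>Not necessarily commutative local rings.\<close>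

definition local_ring :: "'a ring \<Rightarrow> bool"
  where "local_ring R \<longleftrightarrow> ring R \<and> \<one>\<^bsub>R\<^esub> \<noteq> \<zero>\<^bsub>R\<^esub> \<and>
    (\<forall>a \<in> carrier R - Units R. \<forall>b \<in> carrier R - Units R. a \<oplus>\<^bsub>R\<^esub> b \<in> carrier R - Units R)"

definition krull_schmidt :: "('k, 'o, 'm) lincat \<Rightarrow> bool"
  where "krull_schmidt C \<longleftrightarrow> (\<forall>M \<in> Ob C. \<exists>Ms. is_direct_sum C Ms M \<and>
    (\<forall>N \<in> set Ms. local_ring (End_ring C N)))"


section \<open>Functors and Serre duality\<close>

record ('o, 'm) endo =
  fob :: "'o \<Rightarrow> 'o"
  fmor :: "'m \<Rightarrow> 'm"

definition is_functor :: "('k, 'o, 'm) lincat \<Rightarrow> ('o, 'm) endo \<Rightarrow> bool"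
  where "is_functor C F \<longleftrightarrow>
    (\<forall>M \<in> Ob C. fob F M \<in> Ob C \<and> fmor F (ident C M) = ident C (fob F M)) \<and>
    (\<forall>M \<in> Ob C. \<forall>N \<in> Ob C. \<forall>f \<in> mor C M N. fmor F f \<in> mor C (fob F M) (fob F N)) \<and>
    (\<forall>M \<in> Ob C. \<forall>N \<in> Ob C. \<forall>P \<in> Ob C. \<forall>f \<in> mor C M N. \<forall>g \<in> mor C N P.
      fmor F (g \<cdot>\<^bsub>C\<^esub> f) = fmor F g \<cdot>\<^bsub>C\<^esub> fmor F f)"

definition id_functor :: "('o, 'm) endo"
  where "id_functor = \<lparr>fob = id, fmor = id\<rparr>"

definition functor_comp :: "('o, 'm) endo \<Rightarrow> ('o, 'm) endo \<Rightarrow> ('o, 'm) endo"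
  where "functor_comp G F = \<lparr>fob = fob G \<circ> fob F, fmor = fmor G \<circ> fmor F\<rparr>"

definition nat_isomorphic ::
    "('k, 'o, 'm) lincat \<Rightarrow> ('o, 'm) endo \<Rightarrow> ('o, 'm) endo \<Rightarrow> bool"
  where "nat_isomorphic C F G \<longleftrightarrow> (\<exists>\<eta>.
    (\<forall>M \<in> Ob C. is_iso C (fob F M) (fob G M) (\<eta> M)) \<and>
    (\<forall>M \<in> Ob C. \<forall>N \<in> Ob C. \<forall>f \<in> mor C M N.
      \<eta> N \<cdot>\<^bsub>C\<^esub> fmor F f = fmor G f \<cdot>\<^bsub>C\<^esub> \<eta> M))"

definition is_autoequivalence :: "('k, 'o, 'm) lincat \<Rightarrow> ('o, 'm) endo \<Rightarrow> bool"
  where "is_autoequivalence C F \<longleftrightarrow> is_functor C F \<and>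
    (\<exists>G. is_functor C G \<and>
      nat_isomorphic C (functor_comp G F) id_functor \<and>
      nat_isomorphic C (functor_comp F G) id_functor)"

definition is_additive_automorphism :: "('k, 'o, 'm) lincat \<Rightarrow> ('o, 'm) endo \<Rightarrow> bool"
  where "is_additive_automorphism C F \<longleftrightarrow> is_functor C F \<and>
    bij_betw (fob F) (Ob C) (Ob C) \<and>
    (\<forall>M \<in> Ob C. \<forall>N \<in> Ob C. bij_betw (fmor F) (mor C M N) (mor C (fob F M) (fob F N))) \<and>
    (\<forall>M \<in> Ob C. \<forall>N \<in> Ob C. \<forall>f \<in> mor C M N. \<forall>g \<in> mor C M N.
      fmor F (f \<oplus>\<^bsub>Hom C M N\<^esub> g) = fmor F f \<oplus>\<^bsub>Hom C (fob F M) (fob F N)\<^esub> fmor F g)"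

text \<open>The dual space; functionals are extensional so that equality is equality on \<open>V\<close>.\<close>

definition dual :: "'k ring \<Rightarrow> ('k, 'm) module \<Rightarrow> ('k, 'm \<Rightarrow> 'k) module"
  where "dual K V = \<lparr>
    carrier = {\<phi> \<in> carrier V \<rightarrow>\<^sub>E carrier K.
      (\<forall>v \<in> carrier V. \<forall>w \<in> carrier V. \<phi> (v \<oplus>\<^bsub>V\<^esub> w) = \<phi> v \<oplus>\<^bsub>K\<^esub> \<phi> w) \<and>
      (\<forall>a \<in> carrier K. \<forall>v \<in> carrier V. \<phi> (a \<odot>\<^bsub>V\<^esub> v) = a \<otimes>\<^bsub>K\<^esub> \<phi> v)},
    monoid.mult = undefined,
    one = undefined,
    ring.zero = (\<lambda>v \<in> carrier V. \<zero>\<^bsub>K\<^esub>),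
    add = (\<lambda>\<phi> \<psi>. \<lambda>v \<in> carrier V. \<phi> v \<oplus>\<^bsub>K\<^esub> \<psi> v),
    smult = (\<lambda>a \<phi>. \<lambda>v \<in> carrier V. a \<otimes>\<^bsub>K\<^esub> \<phi> v)\<rparr>"

definition linear_iso :: "'k ring \<Rightarrow> ('k, 'a) module \<Rightarrow> ('k, 'b) module \<Rightarrow> ('a \<Rightarrow> 'b) \<Rightarrow> bool"
  where "linear_iso K V W h \<longleftrightarrow> bij_betw h (carrier V) (carrier W) \<and>
    (\<forall>v \<in> carrier V. \<forall>w \<in> carrier V. h (v \<oplus>\<^bsub>V\<^esub> w) = h v \<oplus>\<^bsub>W\<^esub> h w) \<and>
    (\<forall>a \<in> carrier K. \<forall>v \<in> carrier V. h (a \<odot>\<^bsub>V\<^esub> v) = a \<odot>\<^bsub>W\<^esub> h v)"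

text \<open>The last two conjuncts are naturality of \<open>\<theta> M N : Hom(N, F M) \<rightarrow> D Hom(M, N)\<close> in \<open>M\<close>
  and in \<open>N\<close>, evaluated at a morphism \<open>h\<close>.\<close>

definition is_serre_functor :: "'k ring \<Rightarrow> ('k, 'o, 'm) lincat \<Rightarrow> ('o, 'm) endo \<Rightarrow> bool"
  where "is_serre_functor K C F \<longleftrightarrow> is_autoequivalence C F \<and> (\<exists>\<theta>.
    (\<forall>M \<in> Ob C. \<forall>N \<in> Ob C.
      linear_iso K (Hom C N (fob F M)) (dual K (Hom C M N)) (\<theta> M N)) \<and>
    (\<forall>M \<in> Ob C. \<forall>M' \<in> Ob C. \<forall>N \<in> Ob C.
      \<forall>f \<in> mor C M M'. \<forall>g \<in> mor C N (fob F M). \<forall>h \<in> mor C M' N.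
        \<theta> M' N (fmor F f \<cdot>\<^bsub>C\<^esub> g) h = \<theta> M N g (h \<cdot>\<^bsub>C\<^esub> f)) \<and>
    (\<forall>M \<in> Ob C. \<forall>N \<in> Ob C. \<forall>N' \<in> Ob C.
      \<forall>k \<in> mor C N' N. \<forall>g \<in> mor C N (fob F M). \<forall>h \<in> mor C M N'.
        \<theta> M N' (g \<cdot>\<^bsub>C\<^esub> k) h = \<theta> M N g (k \<cdot>\<^bsub>C\<^esub> h)))"

text \<open>\<open>S\<close> plays the role of \<open>\<Sigma>\<^sup>d\<close>, so that its square is \<open>\<Sigma>\<^sup>2\<^sup>d\<close>.\<close>

definition calabi_yau_2d :: "'k ring \<Rightarrow> ('k, 'o, 'm) lincat \<Rightarrow> ('o, 'm) endo \<Rightarrow> bool"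
  where "calabi_yau_2d K C S \<longleftrightarrow>
    (\<exists>F. is_serre_functor K C F \<and> nat_isomorphic C F (functor_comp S S))"


section \<open>Higher angulated categories\<close>

text \<open>
  A sequence \<open>c\<^sup>0 \<rightarrow> \<dots> \<rightarrow> c\<^bsup>d+1\<^esup> \<rightarrow> S c\<^sup>0\<close> is the pair of the list of its \<open>d + 2\<close> objects and the
  list of its \<open>d + 2\<close> morphisms.  \<open>wrap F\<close> appends the entry in degree \<open>d + 2\<close>, which is the
  image of the entry in degree \<open>0\<close>.
\<close>

type_synonym ('o, 'm) sequence = "'o list \<times> 'm list"

definition wrap :: "('a \<Rightarrow> 'a) \<Rightarrow> 'a list \<Rightarrow> 'a list"
  where "wrap F xs = xs @ [F (hd xs)]"

definition is_sequence ::
    "('k, 'o, 'm) lincat \<Rightarrow> ('o, 'm) endo \<Rightarrow> nat \<Rightarrow> ('o, 'm) sequence \<Rightarrow> bool"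
  where "is_sequence C S d = (\<lambda>(cs, \<gamma>).
    length cs = d + 2 \<and> length \<gamma> = d + 2 \<and> set cs \<subseteq> Ob C \<and>
    (\<forall>i \<le> d + 1. \<gamma> ! i \<in> mor C (wrap (fob S) cs ! i) (wrap (fob S) cs ! Suc i)))"

definition is_sequence_mor ::
    "('k, 'o, 'm) lincat \<Rightarrow> ('o, 'm) endo \<Rightarrow> nat \<Rightarrow>
      ('o, 'm) sequence \<Rightarrow> ('o, 'm) sequence \<Rightarrow> 'm list \<Rightarrow> bool"
  where "is_sequence_mor C S d = (\<lambda>(bs, \<beta>) (cs, \<gamma>) \<phi>.
    length \<phi> = d + 2 \<and>
    (\<forall>i \<le> d + 1. \<phi> ! i \<in> mor C (bs ! i) (cs ! i)) \<and>
    (\<forall>i \<le> d + 1. wrap (fmor S) \<phi> ! Suc i \<cdot>\<^bsub>C\<^esub> \<beta> ! i = \<gamma> ! i \<cdot>\<^bsub>C\<^esub> \<phi> ! i))"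

definition is_sequence_sum ::
    "('k, 'o, 'm) lincat \<Rightarrow> ('o, 'm) endo \<Rightarrow> nat \<Rightarrow>
      ('o, 'm) sequence \<Rightarrow> ('o, 'm) sequence \<Rightarrow> ('o, 'm) sequence \<Rightarrow> bool"
  where "is_sequence_sum C S d x y z \<longleftrightarrow> (\<exists>i1 i2 p1 p2.
    is_sequence_mor C S d x z i1 \<and> is_sequence_mor C S d y z i2 \<and>
    is_sequence_mor C S d z x p1 \<and> is_sequence_mor C S d z y p2 \<and>
    (\<forall>j \<le> d + 1. is_biproduct C (fst x ! j) (fst y ! j) (fst z ! j)
      (i1 ! j) (i2 ! j) (p1 ! j) (p2 ! j)))"

definition trivial_sequence ::
    "('k, 'o, 'm) lincat \<Rightarrow> ('o, 'm) endo \<Rightarrow> nat \<Rightarrow> 'o \<Rightarrow> 'o \<Rightarrow> ('o, 'm) sequence"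
  where "trivial_sequence C S d Z M =
    (M # M # replicate d Z,
     ident C M # \<zero>\<^bsub>Hom C M Z\<^esub> # replicate (d - 1) \<zero>\<^bsub>Hom C Z Z\<^esub> @ [\<zero>\<^bsub>Hom C Z (fob S M)\<^esub>])"

definition left_rotation ::
    "('k, 'o, 'm) lincat \<Rightarrow> ('o, 'm) endo \<Rightarrow> nat \<Rightarrow> ('o, 'm) sequence \<Rightarrow> ('o, 'm) sequence"
  where "left_rotation C S d = (\<lambda>(cs, \<gamma>).
    (tl (wrap (fob S) cs),
     tl \<gamma> @ [if even d then fmor S (\<gamma> ! 0)
       else \<ominus>\<^bsub>Hom C (fob S (cs ! 0)) (fob S (cs ! 1))\<^esub> fmor S (\<gamma> ! 0)]))"

text \<open>
  The terms of \<open>z\<close> are biproducts of \<open>b\<^bsup>i+1\<^esup>\<close> and \<open>c\<^sup>i\<close>, the last one, in degree \<open>d + 2\<close>,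
  with the biproduct structure obtained by applying \<open>S\<close> to that in degree \<open>0\<close>.  The last four
  equations say that the morphism in degree \<open>i\<close> has matrix
  \<open>((- \<beta>\<^bsup>i+1\<^esup>, 0), (\<phi>\<^bsup>i+1\<^esup>, \<gamma>\<^sup>i))\<close>, where for \<open>i = d + 1\<close> the entries of the first column are
  \<open>- S \<beta>\<^sup>0\<close> and \<open>S \<phi>\<^sup>0\<close>.
\<close>

definition is_mapping_cone ::
    "('k, 'o, 'm) lincat \<Rightarrow> ('o, 'm) endo \<Rightarrow> nat \<Rightarrow>
      ('o, 'm) sequence \<Rightarrow> ('o, 'm) sequence \<Rightarrow> 'm list \<Rightarrow> ('o, 'm) sequence \<Rightarrow> bool"
  where "is_mapping_cone C S d = (\<lambda>(bs, \<beta>) (cs, \<gamma>) \<phi> (es, \<epsilon>).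
    is_sequence C S d (es, \<epsilon>) \<and>
    (\<exists>i1 i2 p1 p2.
      length i1 = d + 2 \<and> length i2 = d + 2 \<and> length p1 = d + 2 \<and> length p2 = d + 2 \<and>
      (\<forall>i \<le> d + 1. is_biproduct C (wrap (fob S) bs ! Suc i) (cs ! i) (es ! i)
        (i1 ! i) (i2 ! i) (p1 ! i) (p2 ! i)) \<and>
      (\<forall>i \<le> d + 1.
        wrap (fmor S) p1 ! Suc i \<cdot>\<^bsub>C\<^esub> \<epsilon> ! i \<cdot>\<^bsub>C\<^esub> i1 ! i =
          \<ominus>\<^bsub>Hom C (wrap (fob S) bs ! Suc i) (if i = d + 1 then fob S (bs ! 1)
            else wrap (fob S) bs ! Suc (Suc i))\<^esub> (wrap (fmor S) \<beta> ! Suc i) \<and>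
        wrap (fmor S) p1 ! Suc i \<cdot>\<^bsub>C\<^esub> \<epsilon> ! i \<cdot>\<^bsub>C\<^esub> i2 ! i =
          \<zero>\<^bsub>Hom C (cs ! i) (if i = d + 1 then fob S (bs ! 1)
            else wrap (fob S) bs ! Suc (Suc i))\<^esub> \<and>
        wrap (fmor S) p2 ! Suc i \<cdot>\<^bsub>C\<^esub> \<epsilon> ! i \<cdot>\<^bsub>C\<^esub> i1 ! i = wrap (fmor S) \<phi> ! Suc i \<and>
        wrap (fmor S) p2 ! Suc i \<cdot>\<^bsub>C\<^esub> \<epsilon> ! i \<cdot>\<^bsub>C\<^esub> i2 ! i = \<gamma> ! i)))"

text \<open>
  \<open>A\<close> is the class of \<open>(d+2)\<close>-angles and \<open>S\<close> the automorphism.  Closure under isomorphism is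
  part of \<open>sums_summands\<close>, since a sequence is the direct sum of any isomorphic sequence and a
  sequence of zero objects; hence it does not matter that direct sums and mapping cones are only
  determined up to isomorphism.
\<close>

locale angulated_category = additive_linear_category +
  fixes S :: "('o, 'm) endo" and d :: nat and A :: "('o, 'm) sequence set"
  assumes d_pos: "d > 0"
    and automorphism: "is_additive_automorphism C S"
    and angles: "x \<in> A \<Longrightarrow> is_sequence C S d x"
    and sums_summands:
      "\<lbrakk>is_sequence C S d x; is_sequence C S d y; is_sequence C S d z; is_sequence_sum C S d x y z\<rbrakk>
        \<Longrightarrow> x \<in> A \<and> y \<in> A \<longleftrightarrow> z \<in> A"
    and trivial_angle: "\<lbrakk>M \<in> Ob C; is_zero_object C Z\<rbrakk> \<Longrightarrow> trivial_sequence C S d Z M \<in> A"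
    and angle_exists:
      "\<lbrakk>M \<in> Ob C; N \<in> Ob C; f \<in> mor C M N\<rbrakk>
        \<Longrightarrow> \<exists>cs \<gamma>. (cs, \<gamma>) \<in> A \<and> cs ! 0 = M \<and> cs ! 1 = N \<and> \<gamma> ! 0 = f"
    and rotation: "is_sequence C S d x \<Longrightarrow> x \<in> A \<longleftrightarrow> left_rotation C S d x \<in> A"
    and completion:
      "\<lbrakk>(bs, \<beta>) \<in> A; (cs, \<gamma>) \<in> A; \<phi>0 \<in> mor C (bs ! 0) (cs ! 0); \<phi>1 \<in> mor C (bs ! 1) (cs ! 1);
        \<phi>1 \<cdot> \<beta> ! 0 = \<gamma> ! 0 \<cdot> \<phi>0\<rbrakk>
        \<Longrightarrow> \<exists>\<phi>. \<phi> ! 0 = \<phi>0 \<and> \<phi> ! 1 = \<phi>1 \<and> is_sequence_mor C S d (bs, \<beta>) (cs, \<gamma>) \<phi>"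
    and octahedral:
      "\<lbrakk>(bs, \<beta>) \<in> A; (cs, \<gamma>) \<in> A; \<phi>0 \<in> mor C (bs ! 0) (cs ! 0); \<phi>1 \<in> mor C (bs ! 1) (cs ! 1);
        \<phi>1 \<cdot> \<beta> ! 0 = \<gamma> ! 0 \<cdot> \<phi>0\<rbrakk>
        \<Longrightarrow> \<exists>\<phi>. \<phi> ! 0 = \<phi>0 \<and> \<phi> ! 1 = \<phi>1 \<and> is_sequence_mor C S d (bs, \<beta>) (cs, \<gamma>) \<phi> \<and>
              (\<forall>z. is_mapping_cone C S d (bs, \<beta>) (cs, \<gamma>) \<phi> z \<longrightarrow> z \<in> A)"


section \<open>Oppermann-Thomas cluster tilting objects\<close>

text \<open>Summands of finite direct sums of copies of \<open>T\<close>.\<close>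

definition add_closure :: "('k, 'o, 'm) lincat \<Rightarrow> 'o \<Rightarrow> 'o set"
  where "add_closure C T = {M. \<exists>n B. is_direct_sum C (replicate n T) B \<and> is_summand C M B}"

text \<open>In \<open>(ts @ [M], \<gamma>)\<close> the list \<open>ts\<close> is \<open>t\<^sub>d, \<dots>, t\<^sub>0\<close>.\<close>

definition OT_cluster_tilting ::
    "('k, 'o, 'm) lincat \<Rightarrow> ('o, 'm) endo \<Rightarrow> ('o, 'm) sequence set \<Rightarrow> 'o \<Rightarrow> bool"
  where "OT_cluster_tilting C S A T \<longleftrightarrow> T \<in> Ob C \<and>
    (\<forall>M \<in> add_closure C T. \<forall>N \<in> add_closure C T.
      mor C M (fob S N) = {\<zero>\<^bsub>Hom C M (fob S N)\<^esub>}) \<and>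
    (\<forall>M \<in> Ob C. \<exists>ts \<gamma>. set ts \<subseteq> add_closure C T \<and> (ts @ [M], \<gamma>) \<in> A)"

definition basic_object :: "('k, 'o, 'm) lincat \<Rightarrow> 'o \<Rightarrow> bool"
  where "basic_object C T \<longleftrightarrow> (\<forall>Ms. is_direct_sum C Ms T \<and> (\<forall>M \<in> set Ms. indecomposable C M) \<longrightarrow>
    (\<forall>i < length Ms. \<forall>j < length Ms. i \<noteq> j \<longrightarrow> \<not> isomorphic C (Ms ! i) (Ms ! j)))"

definition indec_classes :: "('k, 'o, 'm) lincat \<Rightarrow> 'o set \<Rightarrow> 'o set set"
  where "indec_classes C \<T> =
    {M \<in> \<T>. indecomposable C M} //
      {(M, N). M \<in> \<T> \<and> indecomposable C M \<and> N \<in> \<T> \<and> indecomposable C N \<and> isomorphic C M N}"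

end

theory Submission
  imports Defs
begin

text \<open>
  Write \<open>\<T>\<close> and \<open>\<U>\<close> for the additive closures.  Rotating the angle that resolves \<open>S M\<close> by objects
  of \<open>\<U>\<close> gives an angle \<open>M \<rightarrow> u\<^sup>0 \<rightarrow> \<dots> \<rightarrow> u\<^sup>d \<rightarrow> S M\<close>; call the alternating sum of the \<open>u\<^sup>i\<close> in the split
  Grothendieck group a coindex of \<open>M\<close>.  In an angle \<open>c\<^sup>0 \<rightarrow> \<dots> \<rightarrow> c\<^bsup>d+1\<^esup> \<rightarrow> S c\<^sup>0\<close> with \<open>c\<^bsup>d+1\<^esup> \<in> \<U>\<close> the
  identity of \<open>c\<^sup>0\<close> lifts to a morphism to the coresolution of \<open>c\<^sup>0\<close>, because
  \<open>Hom(\<U>, S \<U>) = 0\<close>; cancelling \<open>c\<^sup>0\<close> from the mapping cone leaves an angle starting at \<open>c\<^sup>1\<close> whose new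
  summands lie in \<open>\<U>\<close>.  After \<open>d + 1\<close> such steps the angle lies in \<open>\<U>\<close>, so its connecting morphism
  vanishes, the complex is contractible, and its alternating sum is zero.  Hence coindices are
  additive on such angles.  For a \<open>\<T>\<close>-resolution of \<open>u \<in> \<U>\<close> this says that \<open>[u]\<close> is an integral combination of
  the coindices of the indecomposables of \<open>\<T>\<close>, so \<open>\<U>\<close> has at most as many indecomposables as \<open>\<T>\<close>.

  Classes in the split Grothendieck group are detected by \<open>K\<close>-valued traces: for \<open>V\<close> with local
  endomorphism ring, \<open>chi V M\<close> is the multiplicity of \<open>V\<close> in \<open>M\<close>, read in \<open>K\<close>.  That it is only known
  modulo the characteristic does no harm, since linear independence over \<open>K\<close> is all that is needed.
\<close>

section \<open>Arrows\<close>

text \<open>Krull-Schmidt, as assumed, provides some decomposition into objects with local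
  endomorphism ring, so multiplicities must be defined before anything can be counted. For such a
  \<open>V\<close> the residue field of the endomorphism ring is \<open>K\<close>, because
  \<open>K\<close> is algebraically closed and Hom-spaces are finite-dimensional. Composition
  followed by the residue map pairs Hom(Y, V) with Hom(V, Y), and \<open>chi V Y\<close> is the rank
  of this pairing, read in \<open>K\<close>. Its additivity and invariance come from linearity and
  cyclicity of a trace; no two decompositions are ever compared. On the side of angles the obstacle
  is that coindices are not additive on arbitrary angles: extending the identity of c^0 along c^0 ->
  c^1 needs Hom(c^{d+1}, S \<U>) = 0. An exchange preserves this condition, since the new last term
  is the last term of a coresolution. Uniqueness of coindices is avoided as well: one is fixed for
  each indecomposable of \<T>, those of the other objects of \<T> are assembled from these, and
  additivity holds for every choice.\<close>

text \<open>Morphisms are tagged with source and target, so that all typing conditions in computations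
  with composites and sums can be discharged by rewriting.\<close>

datatype ('o, 'm) arrow = ar (dm: 'o) (mp: 'm) (cd: 'o)

lemma arrow_eqI: "dm F = dm G \<Longrightarrow> cd F = cd G \<Longrightarrow> mp F = mp G \<Longrightarrow> F = G"
  by (cases F; cases G) simp

context linear_category
begin

definition arr :: "('o, 'm) arrow \<Rightarrow> bool"
  where "arr F \<longleftrightarrow> dm F \<in> Ob C \<and> cd F \<in> Ob C \<and> mp F \<in> mor C (dm F) (cd F)"

text \<open>The operations are total and read their endpoints off the arguments without comparing
  them. Thus \<open>dm\<close> and \<open>cd\<close> of a compound term simplify unconditionally,
  and only \<open>arr\<close> carries typing conditions.\<close>

definition cp :: "('o, 'm) arrow \<Rightarrow> ('o, 'm) arrow \<Rightarrow> ('o, 'm) arrow"  (infixr \<open>\<star>\<close> 75)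
  where "G \<star> F = ar (dm F) (mp G \<cdot> mp F) (cd G)"

definition pl :: "('o, 'm) arrow \<Rightarrow> ('o, 'm) arrow \<Rightarrow> ('o, 'm) arrow"  (infixl \<open>+\<^sub>a\<close> 65)
  where "F +\<^sub>a G = ar (dm F) (mp F \<oplus>\<^bsub>Hom C (dm F) (cd F)\<^esub> mp G) (cd F)"

definition ng :: "('o, 'm) arrow \<Rightarrow> ('o, 'm) arrow"
  where "ng F = ar (dm F) (\<ominus>\<^bsub>Hom C (dm F) (cd F)\<^esub> mp F) (cd F)"

definition zr :: "'o \<Rightarrow> 'o \<Rightarrow> ('o, 'm) arrow"
  where "zr M N = ar M \<zero>\<^bsub>Hom C M N\<^esub> N"

definition idn :: "'o \<Rightarrow> ('o, 'm) arrow"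
  where "idn M = ar M (ident C M) M"

definition sc :: "'k \<Rightarrow> ('o, 'm) arrow \<Rightarrow> ('o, 'm) arrow"
  where "sc a F = ar (dm F) (a \<odot>\<^bsub>Hom C (dm F) (cd F)\<^esub> mp F) (cd F)"

lemma Hom_group: "M \<in> Ob C \<Longrightarrow> N \<in> Ob C \<Longrightarrow> abelian_group (Hom C M N)"
  using Hom_module unfolding module_def by blast

lemma dm_cd [simp]:
  "dm (G \<star> F) = dm F" "cd (G \<star> F) = cd G"
  "dm (F +\<^sub>a G) = dm F" "cd (F +\<^sub>a G) = cd F"
  "dm (ng F) = dm F" "cd (ng F) = cd F"
  "dm (zr M N) = M" "cd (zr M N) = N"
  "dm (idn M) = M" "cd (idn M) = M"
  "dm (sc a F) = dm F" "cd (sc a F) = cd F"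
  by (simp_all add: cp_def pl_def ng_def zr_def idn_def sc_def)

lemma arr_Ob: "arr F \<Longrightarrow> dm F \<in> Ob C" "arr F \<Longrightarrow> cd F \<in> Ob C"
  by (simp_all add: arr_def)

lemma arr_ar: "M \<in> Ob C \<Longrightarrow> N \<in> Ob C \<Longrightarrow> arr (ar M f N) \<longleftrightarrow> f \<in> mor C M N"
  by (simp add: arr_def)

lemma arr_cp [simp]: "arr F \<Longrightarrow> arr G \<Longrightarrow> cd F = dm G \<Longrightarrow> arr (G \<star> F)"
  by (auto simp: arr_def cp_def intro: cmp_closed)

lemma arr_pl [simp]: "arr F \<Longrightarrow> arr G \<Longrightarrow> dm F = dm G \<Longrightarrow> cd F = cd G \<Longrightarrow> arr (F +\<^sub>a G)"
  using abelian_monoid.a_closed[OF abelian_group.axioms(1)[OF Hom_group], of "dm F" "cd F" "mp F" "mp G"]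
  by (simp add: arr_def pl_def)

lemma arr_ng [simp]: "arr F \<Longrightarrow> arr (ng F)"
  using abelian_group.a_inv_closed[OF Hom_group, of "dm F" "cd F" "mp F"]
  by (simp add: arr_def ng_def)

lemma arr_zr [simp]: "M \<in> Ob C \<Longrightarrow> N \<in> Ob C \<Longrightarrow> arr (zr M N)"
  using abelian_monoid.zero_closed[OF abelian_group.axioms(1)[OF Hom_group], of M N]
  by (simp add: arr_def zr_def)

lemma arr_idn [simp]: "M \<in> Ob C \<Longrightarrow> arr (idn M)"
  by (simp add: arr_def idn_def ident_closed)

lemma arr_sc [simp]: "a \<in> carrier K \<Longrightarrow> arr F \<Longrightarrow> arr (sc a F)"
  using module.smult_closed[OF Hom_module, of "dm F" "cd F" a "mp F"]
  by (simp add: arr_def sc_def)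

lemma cp_assoc [simp]:
  assumes "arr F" "arr G" "arr H" "cd F = dm G" "cd G = dm H"
  shows "(H \<star> G) \<star> F = H \<star> (G \<star> F)"
  using assms cmp_assoc[of "dm F" "dm G" "dm H" "cd H" "mp F" "mp G" "mp H"]
  by (simp add: arr_def cp_def)

lemma idn_cp [simp]: "arr F \<Longrightarrow> cd F = N \<Longrightarrow> idn N \<star> F = F"
  by (auto intro!: arrow_eqI simp: arr_def cp_def idn_def cmp_ident_left)

lemma cp_idn [simp]: "arr F \<Longrightarrow> dm F = M \<Longrightarrow> F \<star> idn M = F"
  by (auto intro!: arrow_eqI simp: arr_def cp_def idn_def cmp_ident_right)

lemma pl_cp [simp]:
  assumes "arr F" "arr G" "arr G'" "cd F = dm G" "dm G = dm G'" "cd G = cd G'"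
  shows "(G +\<^sub>a G') \<star> F = G \<star> F +\<^sub>a G' \<star> F"
  using assms cmp_add_left[of "dm F" "dm G" "cd G" "mp F" "mp G" "mp G'"]
  by (simp add: arr_def cp_def pl_def)

lemma cp_pl [simp]:
  assumes "arr F" "arr F'" "arr G" "cd F = dm G" "dm F = dm F'" "cd F = cd F'"
  shows "G \<star> (F +\<^sub>a F') = G \<star> F +\<^sub>a G \<star> F'"
  using assms cmp_add_right[of "dm F" "dm G" "cd G" "mp F" "mp F'" "mp G"]
  by (simp add: arr_def cp_def pl_def)

lemma pl_assoc:
  assumes "arr F" "arr G" "arr H" "dm F = dm G" "dm G = dm H" "cd F = cd G" "cd G = cd H"
  shows "F +\<^sub>a G +\<^sub>a H = F +\<^sub>a (G +\<^sub>a H)"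
  using assms abelian_monoid.a_assoc[OF abelian_group.axioms(1)[OF Hom_group], of "dm H" "cd H" "mp F" "mp G" "mp H"]
  by (simp add: arr_def pl_def)

lemma pl_comm:
  assumes "arr F" "arr G" "dm F = dm G" "cd F = cd G"
  shows "F +\<^sub>a G = G +\<^sub>a F"
  using assms abelian_monoid.a_comm[OF abelian_group.axioms(1)[OF Hom_group], of "dm G" "cd G" "mp F" "mp G"]
  by (simp add: arr_def pl_def)

lemma pl_lcomm:
  assumes "arr F" "arr G" "arr H" "dm F = dm G" "dm G = dm H" "cd F = cd G" "cd G = cd H"
  shows "F +\<^sub>a (G +\<^sub>a H) = G +\<^sub>a (F +\<^sub>a H)"
  using assms pl_assoc[of F G H] pl_assoc[of G F H] pl_comm[of F G] by simp

declare arr_Ob [simp]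

lemma zr_pl [simp]: "arr F \<Longrightarrow> dm F = M \<Longrightarrow> cd F = N \<Longrightarrow> zr M N +\<^sub>a F = F"
  using abelian_monoid.l_zero[OF abelian_group.axioms(1)[OF Hom_group], of M N "mp F"]
  by (auto intro!: arrow_eqI simp: arr_def pl_def zr_def simp del: arr_Ob)

lemma pl_zr [simp]: "arr F \<Longrightarrow> dm F = M \<Longrightarrow> cd F = N \<Longrightarrow> F +\<^sub>a zr M N = F"
  using pl_comm[of F "zr M N"] by (metis arr_Ob arr_zr dm_cd(7,8) zr_pl)

lemma pl_ng [simp]: "arr F \<Longrightarrow> F +\<^sub>a ng F = zr (dm F) (cd F)"
  using abelian_group.r_neg[OF Hom_group, of "dm F" "cd F" "mp F"]
  by (auto intro!: arrow_eqI simp: arr_def pl_def ng_def zr_def simp del: arr_Ob)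

lemma ng_pl [simp]: "arr F \<Longrightarrow> ng F +\<^sub>a F = zr (dm F) (cd F)"
  using pl_comm[of "ng F" F] by simp

text \<open>Zero composites and negatives are recognized through it: \<open>G \<star> zr M N\<close>
  equals its own double, and additive inverses are unique.\<close>

lemma pl_cancel:
  assumes "arr F" "arr G" "arr H" "dm F = dm G" "dm G = dm H" "cd F = cd G" "cd G = cd H"
    and "F +\<^sub>a G = F +\<^sub>a H"
  shows "G = H"
proof -
  have "ng F +\<^sub>a F +\<^sub>a G = ng F +\<^sub>a F +\<^sub>a H" using assms by (simp add: pl_assoc del: ng_pl)
  then show ?thesis using assms by simp
qed

lemma cp_zr [simp]:
  assumes "arr G" "dm G = N" "M \<in> Ob C" shows "G \<star> zr M N = zr M (cd G)"
proof (rule pl_cancel)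
  show "G \<star> zr M N +\<^sub>a G \<star> zr M N = G \<star> zr M N +\<^sub>a zr M (cd G)"
    using assms cp_pl[of "zr M N" "zr M N" G] by auto
qed (use assms in auto)

lemma zr_cp [simp]:
  assumes "arr F" "cd F = M" "N \<in> Ob C" shows "zr M N \<star> F = zr (dm F) N"
proof (rule pl_cancel)
  show "zr M N \<star> F +\<^sub>a zr M N \<star> F = zr M N \<star> F +\<^sub>a zr (dm F) N"
    using assms pl_cp[of F "zr M N" "zr M N"] by auto
qed (use assms in auto)

lemma ng_unique:
  assumes "arr F" "arr G" "dm F = dm G" "cd F = cd G" "F +\<^sub>a G = zr (dm F) (cd F)"
  shows "G = ng F"
  by (rule pl_cancel[of F]) (use assms in auto)

lemma cp_ng [simp]: "arr F \<Longrightarrow> arr G \<Longrightarrow> cd F = dm G \<Longrightarrow> G \<star> ng F = ng (G \<star> F)"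
  by (rule ng_unique) (auto simp flip: cp_pl)

lemma ng_cp [simp]: "arr F \<Longrightarrow> arr G \<Longrightarrow> cd F = dm G \<Longrightarrow> ng G \<star> F = ng (G \<star> F)"
  by (rule ng_unique) (auto simp flip: pl_cp)

lemma ng_ng [simp]: "arr F \<Longrightarrow> ng (ng F) = F"
  by (rule ng_unique[symmetric]) auto

lemma ng_zr [simp]: "M \<in> Ob C \<Longrightarrow> N \<in> Ob C \<Longrightarrow> ng (zr M N) = zr M N"
  by (rule ng_unique[symmetric]) auto

lemma ng_add [simp]:
  assumes "arr F" "arr G" "dm F = dm G" "cd F = cd G"
  shows "ng (F +\<^sub>a G) = ng F +\<^sub>a ng G"
proof (rule ng_unique[symmetric])
  have "F +\<^sub>a G +\<^sub>a (ng F +\<^sub>a ng G) = (F +\<^sub>a ng F) +\<^sub>a (G +\<^sub>a ng G)"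
    using assms by (simp add: pl_assoc pl_lcomm del: pl_ng)
  then show "F +\<^sub>a G +\<^sub>a (ng F +\<^sub>a ng G) = zr (dm (F +\<^sub>a G)) (cd (F +\<^sub>a G))"
    using assms by simp
qed (use assms in auto)

lemma pl_ng_cancel [simp]:
  assumes "arr F" "arr G" "dm F = dm G" "cd F = cd G"
  shows "F +\<^sub>a (ng F +\<^sub>a G) = G" "ng F +\<^sub>a (F +\<^sub>a G) = G"
  using assms pl_assoc[of F "ng F" G] pl_assoc[of "ng F" F G] by auto

lemma sc_cp [simp]:
  assumes "a \<in> carrier K" "arr F" "arr G" "cd F = dm G"
  shows "sc a G \<star> F = sc a (G \<star> F)"
  using assms cmp_smult_left[of "dm F" "dm G" "cd G" a "mp F" "mp G"]
  by (simp add: arr_def cp_def sc_def del: arr_Ob)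

lemma cp_sc [simp]:
  assumes "a \<in> carrier K" "arr F" "arr G" "cd F = dm G"
  shows "G \<star> sc a F = sc a (G \<star> F)"
  using assms cmp_smult_right[of "dm F" "dm G" "cd G" a "mp F" "mp G"]
  by (simp add: arr_def cp_def sc_def del: arr_Ob)

lemma sc_pl: 
  assumes "a \<in> carrier K" "arr F" "arr G" "dm F = dm G" "cd F = cd G"
  shows "sc a (F +\<^sub>a G) = sc a F +\<^sub>a sc a G"
  using assms module.smult_r_distr[OF Hom_module, of "dm F" "cd F" a "mp F" "mp G"]
  by (simp add: arr_def pl_def sc_def del: arr_Ob)

lemma add_sc: 
  assumes "a \<in> carrier K" "b \<in> carrier K" "arr F"
  shows "sc (a \<oplus>\<^bsub>K\<^esub> b) F = sc a F +\<^sub>a sc b F"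
  using assms module.smult_l_distr[OF Hom_module, of "dm F" "cd F" a b "mp F"]
  by (simp add: arr_def pl_def sc_def del: arr_Ob)

lemma mult_sc: 
  assumes "a \<in> carrier K" "b \<in> carrier K" "arr F"
  shows "sc (a \<otimes>\<^bsub>K\<^esub> b) F = sc a (sc b F)"
  using assms module.smult_assoc1[OF Hom_module, of "dm F" "cd F" a b "mp F"]
  by (simp add: arr_def sc_def del: arr_Ob)

lemma one_sc [simp]: "arr F \<Longrightarrow> sc \<one>\<^bsub>K\<^esub> F = F"
  using module.smult_one[OF Hom_module, of "dm F" "cd F" "mp F"]
  by (auto intro!: arrow_eqI simp: arr_def sc_def simp del: arr_Ob)

lemma zero_sc [simp]: "arr F \<Longrightarrow> sc \<zero>\<^bsub>K\<^esub> F = zr (dm F) (cd F)"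
  using module.smult_l_null[OF Hom_module, of "dm F" "cd F" "mp F"]
  by (auto simp: arr_def sc_def zr_def simp del: arr_Ob)

text \<open>\<open>cp_assoc\<close> normalizes composites to the right, which hides the redex
  \<open>G \<star> F\<close> as soon as something is composed on its right. This form makes an
  equation for \<open>G \<star> F\<close> applicable again.\<close>

lemma cp_reassoc:
  assumes "G \<star> F = H" "arr F" "arr G" "cd F = dm G" "arr Y" "cd Y = dm F"
  shows "G \<star> (F \<star> Y) = H \<star> Y"
  using assms by (simp flip: cp_assoc)

section \<open>Biproducts, isomorphisms and zero objects\<close>

definition biprod :: "'o \<Rightarrow> 'o \<Rightarrow> 'o \<Rightarrow> ('o, 'm) arrow \<Rightarrow> ('o, 'm) arrow \<Rightarrow> ('o, 'm) arrow \<Rightarrow> ('o, 'm) arrow \<Rightarrow> bool"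
  where "biprod M N B I J P Q \<longleftrightarrow> M \<in> Ob C \<and> N \<in> Ob C \<and> B \<in> Ob C \<and>
    arr I \<and> arr J \<and> arr P \<and> arr Q \<and> dm I = M \<and> cd I = B \<and> dm J = N \<and> cd J = B \<and>
    dm P = B \<and> cd P = M \<and> dm Q = B \<and> cd Q = N \<and>
    P \<star> I = idn M \<and> Q \<star> J = idn N \<and> P \<star> J = zr N M \<and> Q \<star> I = zr M N \<and>
    I \<star> P +\<^sub>a J \<star> Q = idn B"

lemma biprod_ar: "is_biproduct C M N B i j p q \<longleftrightarrow> biprod M N B (ar M i B) (ar N j B) (ar B p M) (ar B q N)"
  unfolding is_biproduct_def biprod_def by (auto simp: arr_ar cp_def pl_def zr_def idn_def)

lemma biprod_mp:
  assumes "biprod M N B I J P Q"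
  shows "is_biproduct C M N B (mp I) (mp J) (mp P) (mp Q)"
proof -
  have "ar M (mp I) B = I" "ar N (mp J) B = J" "ar B (mp P) M = P" "ar B (mp Q) N = Q"
    using assms by (auto intro!: arrow_eqI simp: biprod_def)
  then show ?thesis using assms by (simp add: biprod_ar)
qed

lemma bipD:
  assumes "biprod M N B I J P Q"
  shows "M \<in> Ob C" "N \<in> Ob C" "B \<in> Ob C"
    "arr I" "arr J" "arr P" "arr Q" "dm I = M" "cd I = B" "dm J = N" "cd J = B"
    "dm P = B" "cd P = M" "dm Q = B" "cd Q = N"
    "P \<star> I = idn M" "Q \<star> J = idn N" "P \<star> J = zr N M" "Q \<star> I = zr M N"
    "I \<star> P +\<^sub>a J \<star> Q = idn B"
  using assms by (simp_all add: biprod_def)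

lemma biprod_reassoc:
  assumes "biprod M N B I J P Q" "arr Y"
  shows "cd Y = M \<Longrightarrow> P \<star> (I \<star> Y) = Y" "cd Y = N \<Longrightarrow> Q \<star> (J \<star> Y) = Y"
    "cd Y = N \<Longrightarrow> P \<star> (J \<star> Y) = zr (dm Y) M" "cd Y = M \<Longrightarrow> Q \<star> (I \<star> Y) = zr (dm Y) N"
  using bipD[OF assms(1)] assms(2)
  by (simp_all add: cp_reassoc[of P I] cp_reassoc[of Q J] cp_reassoc[of P J] cp_reassoc[of Q I])

lemma biprod_swap: "biprod M N B I J P Q \<Longrightarrow> biprod N M B J I Q P"
proof -
  assume b: "biprod M N B I J P Q"
  note [simp] = bipD[OF b]
  have jq: "J \<star> Q +\<^sub>a I \<star> P = idn B"
    by (subst pl_comm) simp_all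
  show ?thesis unfolding biprod_def by (intro conjI jq) simp_all
qed

text \<open>A unipotent change of the decomposition: the copy of \<open>N\<close> is replaced by the
  graph of the negative of \<open>H\<close>. It serves as a row or column operation on the
  connecting morphism of a mapping cone.\<close>

lemma biprod_shear:
  assumes b: "biprod M N B I J P Q" and H: "arr H" "dm H = N" "cd H = M"
  shows "biprod M N B I (J +\<^sub>a ng (I \<star> H)) (P +\<^sub>a H \<star> Q) Q"
proof -
  note [simp] = bipD[OF b] H
  have "I \<star> (P +\<^sub>a H \<star> Q) +\<^sub>a (J +\<^sub>a ng (I \<star> H)) \<star> Q = idn B"
    using bipD(20)[OF biprod_swap[OF b]]
    by (simp add: pl_assoc pl_lcomm[of _ "J \<star> Q"] pl_comm[of _ "J \<star> Q"])
  then show ?thesis using biprod_reassoc[OF b]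
    by (simp add: biprod_def)
qed

definition mutual_inv :: "'o \<Rightarrow> 'o \<Rightarrow> ('o, 'm) arrow \<Rightarrow> ('o, 'm) arrow \<Rightarrow> bool"
  where "mutual_inv M N F G \<longleftrightarrow> arr F \<and> arr G \<and> dm F = M \<and> cd F = N \<and> dm G = N \<and> cd G = M \<and>
    G \<star> F = idn M \<and> F \<star> G = idn N"

lemma isomorphic_iff:
  assumes "M \<in> Ob C" "N \<in> Ob C"
  shows "isomorphic C M N \<longleftrightarrow> (\<exists>F G. mutual_inv M N F G)"
proof
  assume "isomorphic C M N"
  then obtain f g where "f \<in> mor C M N" "g \<in> mor C N M" "g \<cdot> f = ident C M" "f \<cdot> g = ident C N"
    by (auto simp: isomorphic_def is_iso_def)
  then have "mutual_inv M N (ar M f N) (ar N g M)" using assms by (simp add: mutual_inv_def arr_ar cp_def idn_def)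
  then show "\<exists>F G. mutual_inv M N F G" by blast
next
  assume "\<exists>F G. mutual_inv M N F G"
  then obtain F G where FG: "mutual_inv M N F G" by blast
  then have "ar (dm F) (mp G \<cdot> mp F) (cd G) = idn M" "ar (dm G) (mp F \<cdot> mp G) (cd F) = idn N"
    by (auto simp: mutual_inv_def cp_def)
  then have "is_iso C M N (mp F)" using FG by (auto simp: mutual_inv_def is_iso_def arr_def idn_def simp del: arr_Ob)
  then show "isomorphic C M N" by (auto simp: isomorphic_def)
qed

lemma isoD:
  assumes "mutual_inv M N F G"
  shows "M \<in> Ob C" "N \<in> Ob C" "arr F" "arr G" "dm F = M" "cd F = N" "dm G = N" "cd G = M"
    "G \<star> F = idn M" "F \<star> G = idn N"
  using assms arr_Ob[of F] by (auto simp: mutual_inv_def)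

lemma mutual_inv_sym: "mutual_inv M N F G \<Longrightarrow> mutual_inv N M G F"
  by (auto simp: mutual_inv_def)

lemma mutual_inv_trans:
  assumes "mutual_inv M N F G" "mutual_inv N L F' G'"
  shows "mutual_inv M L (F' \<star> F) (G \<star> G')"
  using isoD[OF assms(1)] isoD[OF assms(2)]
  by (simp add: mutual_inv_def cp_reassoc[of G' F'] cp_reassoc[of F G])

lemma mutual_inv_refl: "M \<in> Ob C \<Longrightarrow> mutual_inv M M (idn M) (idn M)"
  by (simp add: mutual_inv_def)

lemma zero_objectD:
  assumes "is_zero_object C Z"
  shows "Z \<in> Ob C" "arr F \<Longrightarrow> dm F = Z \<Longrightarrow> F = zr Z (cd F)" "arr F \<Longrightarrow> cd F = Z \<Longrightarrow> F = zr (dm F) Z"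
proof -
  show "Z \<in> Ob C" using assms by (simp add: is_zero_object_def)
  show "F = zr Z (cd F)" if F: "arr F" "dm F = Z"
  proof (rule arrow_eqI)
    have "mp F \<in> {\<zero>\<^bsub>Hom C Z (cd F)\<^esub>}"
      using assms F arr_Ob(2)[OF F(1)] unfolding is_zero_object_def arr_def by metis
    then show "mp F = mp (zr Z (cd F))" by (simp add: zr_def)
  qed (use F in simp_all)
  show "F = zr (dm F) Z" if F: "arr F" "cd F = Z"
  proof (rule arrow_eqI)
    have "mp F \<in> {\<zero>\<^bsub>Hom C (dm F) Z\<^esub>}"
      using assms F arr_Ob(1)[OF F(1)] unfolding is_zero_object_def arr_def by metis
    then show "mp F = mp (zr (dm F) Z)" by (simp add: zr_def)
  qed (use F in simp_all)
qed

text \<open>Every morphism into or out of \<open>Z\<close> is unchanged by composition with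
  \<open>idn Z\<close>, so this one equation makes all of them zero.\<close>

lemma zero_object_idn:
  "is_zero_object C Z \<longleftrightarrow> Z \<in> Ob C \<and> idn Z = zr Z Z"
proof
  assume "is_zero_object C Z" then show "Z \<in> Ob C \<and> idn Z = zr Z Z"
    using zero_objectD(1)[of Z] zero_objectD(2)[of Z "idn Z"] by simp
next
  assume a: "Z \<in> Ob C \<and> idn Z = zr Z Z"
  have 1: "f = \<zero>\<^bsub>Hom C Z M\<^esub>" if "M \<in> Ob C" "f \<in> mor C Z M" for M f
  proof -
    have "ar Z f M \<star> idn Z = ar Z f M" by (rule cp_idn) (use a that in \<open>simp_all add: arr_ar\<close>)
    then have "ar Z f M = zr Z M" using a that by (simp add: arr_ar)
    then show ?thesis by (simp add: zr_def)
  qed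
  have 2: "f = \<zero>\<^bsub>Hom C M Z\<^esub>" if "M \<in> Ob C" "f \<in> mor C M Z" for M f
  proof -
    have "idn Z \<star> ar M f Z = ar M f Z" by (rule idn_cp) (use a that in \<open>simp_all add: arr_ar\<close>)
    then have "ar M f Z = zr M Z" using a that by (simp add: arr_ar)
    then show ?thesis by (simp add: zr_def)
  qed
  have 3: "\<zero>\<^bsub>Hom C M N\<^esub> \<in> mor C M N" if "M \<in> Ob C" "N \<in> Ob C" for M N
    using arr_zr[OF that] unfolding arr_def zr_def by simp
  show "is_zero_object C Z" unfolding is_zero_object_def
    using a 1 2 3 by blast
qed

text \<open>Turns an isomorphism into a biproduct with zero complement, so that facts about
  biproducts also transport along isomorphisms.\<close>

lemma zero_biprod:
  assumes z: "is_zero_object C Z" and i: "mutual_inv M N F G"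
  shows "biprod M Z N F (zr Z N) G (zr N Z)"
  using isoD[OF i] zero_objectD(1)[OF z] conjunct2[OF zero_object_idn[THEN iffD1, OF z]] by (simp add: biprod_def)


section \<open>Finite direct sums\<close>

text \<open>The endpoints are parameters because the empty sum has to know between which objects it
  is zero.\<close>

primrec arrow_sum :: "'o \<Rightarrow> 'o \<Rightarrow> (nat \<Rightarrow> ('o, 'm) arrow) \<Rightarrow> nat \<Rightarrow> ('o, 'm) arrow"
  where "arrow_sum M N f 0 = zr M N"
  | "arrow_sum M N f (Suc n) = arrow_sum M N f n +\<^sub>a f n"

definition parallel :: "'o \<Rightarrow> 'o \<Rightarrow> (nat \<Rightarrow> ('o, 'm) arrow) \<Rightarrow> nat \<Rightarrow> bool"
  where "parallel M N f n \<longleftrightarrow> M \<in> Ob C \<and> N \<in> Ob C \<and> (\<forall>i<n. arr (f i) \<and> dm (f i) = M \<and> cd (f i) = N)"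

lemma dm_arrow_sum [simp]: "dm (arrow_sum M N f n) = M" "cd (arrow_sum M N f n) = N"
  by (induction n) simp_all

lemma parallel_Suc: "parallel M N f (Suc n) \<longleftrightarrow> parallel M N f n \<and> arr (f n) \<and> dm (f n) = M \<and> cd (f n) = N"
  by (auto simp: parallel_def less_Suc_eq)

lemma arr_arrow_sum [simp]: "parallel M N f n \<Longrightarrow> arr (arrow_sum M N f n)"
  by (induction n) (simp_all add: parallel_Suc, simp add: parallel_def)

lemma parallel_Ob: "parallel M N f n \<Longrightarrow> M \<in> Ob C \<and> N \<in> Ob C"
  by (simp add: parallel_def)

lemma arrow_sum_cong: "(\<And>i. i < n \<Longrightarrow> f i = g i) \<Longrightarrow> arrow_sum M N f n = arrow_sum M N g n"
  by (induction n) auto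

lemma cp_arrow_sum: "parallel M N f n \<Longrightarrow> arr G \<Longrightarrow> dm G = N \<Longrightarrow> G \<star> arrow_sum M N f n = arrow_sum M (cd G) (\<lambda>i. G \<star> f i) n"
  by (induction n) (auto simp: parallel_Suc dest: parallel_Ob)

lemma arrow_sum_cp: "parallel M N f n \<Longrightarrow> arr G \<Longrightarrow> cd G = M \<Longrightarrow> arrow_sum M N f n \<star> G = arrow_sum (dm G) N (\<lambda>i. f i \<star> G) n"
  by (induction n) (auto simp: parallel_Suc dest: parallel_Ob)

lemma arrow_sum_zero: "M \<in> Ob C \<Longrightarrow> N \<in> Ob C \<Longrightarrow> (\<And>i. i < n \<Longrightarrow> f i = zr M N) \<Longrightarrow> arrow_sum M N f n = zr M N"
  by (induction n) auto

lemma arrow_sum_delta: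
  assumes "arr F" "dm F = M" "cd F = N" "k < n" "f k = F" "\<And>i. i < n \<Longrightarrow> i \<noteq> k \<Longrightarrow> f i = zr M N"
  shows "arrow_sum M N f n = F"
  using assms(4,6)
proof (induction n)
  case (Suc n)
  have Ob: "M \<in> Ob C" "N \<in> Ob C" using assms by auto
  show ?case
  proof (cases "k = n")
    case True
    then have "arrow_sum M N f n = zr M N"
      using Suc.prems Ob by (intro arrow_sum_zero) auto
    then show ?thesis using True assms by simp
  next
    case False
    then show ?thesis using Suc assms(1-3) by simp
  qed
qed simp

lemma arrow_sum_shift:
  assumes "parallel M N f (Suc n)"
  shows "arrow_sum M N f (Suc n) = f 0 +\<^sub>a arrow_sum M N (\<lambda>i. f (Suc i)) n"
  using assms
proof (induction n)
  case (Suc n)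
  have "parallel M N f (Suc n)" using Suc.prems by (simp add: parallel_Suc)
  note IH = Suc.IH[OF this]
  have p: "parallel M N (\<lambda>i. f (Suc i)) n" "arr (f 0)" "dm (f 0) = M" "cd (f 0) = N"
    "arr (f (Suc n))" "dm (f (Suc n)) = M" "cd (f (Suc n)) = N"
    using Suc.prems by (auto simp: parallel_def)
  have "arrow_sum M N f (Suc (Suc n)) = f 0 +\<^sub>a arrow_sum M N (\<lambda>i. f (Suc i)) n +\<^sub>a f (Suc n)"
    by (simp only: arrow_sum.simps(2)[of M N f "Suc n"] IH)
  then show ?case using p by (simp add: pl_assoc del: arrow_sum.simps(2)) simp
qed (auto simp: parallel_def)

lemma arrow_sum_finsum:
  assumes "M \<in> Ob C" "N \<in> Ob C" "\<And>i. i < n \<Longrightarrow> f i \<in> mor C M N"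
  shows "ar M (finsum (Hom C M N) f {..<n}) N = arrow_sum M N (\<lambda>i. ar M (f i) N) n"
proof -
  interpret H: abelian_group "Hom C M N" using Hom_group assms by simp
  show ?thesis using assms(3)
  proof (induction n)
    case 0 then show ?case by (simp add: zr_def)
  next
    case (Suc n)
    have "finsum (Hom C M N) f {..<Suc n} = f n \<oplus>\<^bsub>Hom C M N\<^esub> finsum (Hom C M N) f {..<n}"
      unfolding lessThan_Suc using Suc.prems by (intro H.finsum_insert) auto
    also have "\<dots> = finsum (Hom C M N) f {..<n} \<oplus>\<^bsub>Hom C M N\<^esub> f n"
      using Suc.prems by (intro H.a_comm H.finsum_closed) auto
    finally show ?case using Suc by (simp flip: Suc.IH add: pl_def)
  qed
qed

definition dsum :: "'o list \<Rightarrow> 'o \<Rightarrow> (nat \<Rightarrow> ('o, 'm) arrow) \<Rightarrow> (nat \<Rightarrow> ('o, 'm) arrow) \<Rightarrow> bool"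
  where "dsum Ms B I P \<longleftrightarrow> set Ms \<subseteq> Ob C \<and> B \<in> Ob C \<and>
    (\<forall>i < length Ms. arr (I i) \<and> dm (I i) = Ms ! i \<and> cd (I i) = B \<and>
      arr (P i) \<and> dm (P i) = B \<and> cd (P i) = Ms ! i) \<and>
    (\<forall>i < length Ms. \<forall>j < length Ms.
      P j \<star> I i = (if i = j then idn (Ms ! i) else zr (Ms ! i) (Ms ! j))) \<and>
    arrow_sum B B (\<lambda>i. I i \<star> P i) (length Ms) = idn B"

lemma direct_sum_dsum: 
  assumes "is_direct_sum C Ms B" shows "\<exists>I P. dsum Ms B I P"
proof -
  from assms obtain i p where
    o: "set Ms \<subseteq> Ob C" "B \<in> Ob C" and
    m: "\<And>k. k < length Ms \<Longrightarrow> i k \<in> mor C (Ms ! k) B" "\<And>k. k < length Ms \<Longrightarrow> p k \<in> mor C B (Ms ! k)" and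
    d: "\<And>k l. k < length Ms \<Longrightarrow> l < length Ms \<Longrightarrow>
      p l \<cdot> i k = (if k = l then ident C (Ms ! k) else \<zero>\<^bsub>Hom C (Ms ! k) (Ms ! l)\<^esub>)" and
    s: "finsum (Hom C B B) (\<lambda>k. i k \<cdot> p k) {..<length Ms} = ident C B"
    unfolding is_direct_sum_def by blast
  have Ob: "Ms ! k \<in> Ob C" if "k < length Ms" for k using o(1) that by auto
  have "dsum Ms B (\<lambda>k. ar (Ms ! k) (i k) B) (\<lambda>k. ar B (p k) (Ms ! k))"
    unfolding dsum_def
  proof (intro conjI allI impI)
    have "arrow_sum B B (\<lambda>k. ar B (i k \<cdot> p k) B) (length Ms) = idn B"
      using o m s cmp_closed[OF o(2) Ob o(2)] by (subst arrow_sum_finsum[symmetric]) (auto simp: idn_def)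
    then show "arrow_sum B B (\<lambda>k. ar (Ms ! k) (i k) B \<star> ar B (p k) (Ms ! k)) (length Ms) = idn B"
      by (simp add: cp_def)
  qed (use o m Ob d in \<open>auto simp: arr_ar cp_def idn_def zr_def\<close>)
  then show ?thesis by blast
qed

lemma dsum_direct_sum: 
  assumes "dsum Ms B I P" shows "is_direct_sum C Ms B"
proof -
  let ?n = "length Ms"
  have I: "arr (I k)" "dm (I k) = Ms ! k" "cd (I k) = B" "arr (P k)" "dm (P k) = B" "cd (P k) = Ms ! k"
    if "k < ?n" for k using assms that unfolding dsum_def by blast+
  have B: "B \<in> Ob C" using assms unfolding dsum_def by blast
  have mI: "mp (I k) \<in> mor C (Ms ! k) B" "mp (P k) \<in> mor C B (Ms ! k)" if "k < ?n" for k
    using I[OF that] unfolding arr_def by auto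
  have Ob: "Ms ! k \<in> Ob C" if "k < ?n" for k using assms that unfolding dsum_def by auto
  have "ar B (finsum (Hom C B B) (\<lambda>k. mp (I k) \<cdot> mp (P k)) {..<?n}) B = idn B"
  proof -
    have "arrow_sum B B (\<lambda>k. ar B (mp (I k) \<cdot> mp (P k)) B) ?n = arrow_sum B B (\<lambda>i. I i \<star> P i) ?n"
      using I by (intro arrow_sum_cong) (simp add: cp_def)
    then show ?thesis using B mI assms cmp_closed[OF B Ob B]
      by (subst arrow_sum_finsum) (auto simp: dsum_def)
  qed
  moreover have "mp (P l) \<cdot> mp (I k) = (if k = l then ident C (Ms ! k) else \<zero>\<^bsub>Hom C (Ms ! k) (Ms ! l)\<^esub>)"
    if "k < ?n" "l < ?n" for k l
  proof -
    have "P l \<star> I k = (if k = l then idn (Ms ! k) else zr (Ms ! k) (Ms ! l))"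
      using assms that unfolding dsum_def by blast
    then show ?thesis using I that by (auto simp: cp_def idn_def zr_def split: if_splits)
  qed
  ultimately show ?thesis using assms mI unfolding is_direct_sum_def dsum_def idn_def
    by (intro conjI exI[of _ "\<lambda>k. mp (I k)"] exI[of _ "\<lambda>k. mp (P k)"]) auto
qed

text \<open>Direct sums are determined only up to isomorphism, so the complement of the first
  summand is compared with an arbitrary direct sum \<open>B'\<close> of the tail. \<open>J\<close>
  and \<open>Q\<close> are the canonical maps that match the summands of \<open>B'\<close> with
  their copies in \<open>B\<close>.\<close>

lemma dsum_cons_biprod:
  assumes B: "dsum (M # Ms) B I P" and B': "dsum Ms B' I' P'"
  shows "\<exists>J Q. biprod M B' B (I 0) J (P 0) Q"
proof -
  let ?n = "length Ms"
  have o: "M \<in> Ob C" "B \<in> Ob C" "B' \<in> Ob C" using assms unfolding dsum_def by auto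
  have I: "arr (I k)" "dm (I k) = (M # Ms) ! k" "cd (I k) = B" "arr (P k)" "dm (P k) = B" "cd (P k) = (M # Ms) ! k"
    if "k < Suc ?n" for k using B that unfolding dsum_def by auto
  have I': "arr (I' k)" "dm (I' k) = Ms ! k" "cd (I' k) = B'" "arr (P' k)" "dm (P' k) = B'" "cd (P' k) = Ms ! k"
    if "k < ?n" for k using B' that unfolding dsum_def by auto
  have d: "P l \<star> I k = (if k = l then idn ((M # Ms) ! k) else zr ((M # Ms) ! k) ((M # Ms) ! l))"
    if "k < Suc ?n" "l < Suc ?n" for k l using B that unfolding dsum_def by simp
  have d': "P' l \<star> I' k = (if k = l then idn (Ms ! k) else zr (Ms ! k) (Ms ! l))"
    if "k < ?n" "l < ?n" for k l using B' that unfolding dsum_def by simp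
  have Ob: "Ms ! k \<in> Ob C" if "k < ?n" for k using B that unfolding dsum_def by auto
  have s: "arrow_sum B B (\<lambda>i. I i \<star> P i) (Suc ?n) = idn B" using B unfolding dsum_def by simp
  have s': "arrow_sum B' B' (\<lambda>i. I' i \<star> P' i) ?n = idn B'" using B' unfolding dsum_def by simp
  define J where "J = arrow_sum B' B (\<lambda>i. I (Suc i) \<star> P' i) ?n"
  define Q where "Q = arrow_sum B B' (\<lambda>i. I' i \<star> P (Suc i)) ?n"
  have pJ: "parallel B' B (\<lambda>i. I (Suc i) \<star> P' i) ?n" and pQ: "parallel B B' (\<lambda>i. I' i \<star> P (Suc i)) ?n"
    using o I I' by (auto simp: parallel_def)
  note [simp] = o
  have PJ: "P (Suc k) \<star> J = P' k" if k: "k < ?n" for k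
  proof -
    have "P (Suc k) \<star> J = arrow_sum B' (Ms ! k) (\<lambda>i. P (Suc k) \<star> I (Suc i) \<star> P' i) ?n"
      unfolding J_def using pJ I[of "Suc k"] k by (subst cp_arrow_sum) auto
    also have "\<dots> = P' k"
      using I[of "Suc k"] I[of "Suc i" for i] I' Ob k
      by (intro arrow_sum_delta[where k = k]) (auto simp: cp_reassoc[OF d])
    finally show ?thesis .
  qed
  have "Q \<star> J = arrow_sum B' B' (\<lambda>i. (I' i \<star> P (Suc i)) \<star> J) ?n"
    unfolding Q_def using pJ pQ by (subst arrow_sum_cp) (auto simp: J_def)
  also have "\<dots> = arrow_sum B' B' (\<lambda>i. I' i \<star> P' i) ?n"
    using I[of "Suc i" for i] I' pJ by (intro arrow_sum_cong) (auto simp: J_def PJ[unfolded J_def])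
  finally have QJ: "Q \<star> J = idn B'" using s' by simp
  have JI: "J \<star> I' k = I (Suc k)" if k: "k < ?n" for k
  proof -
    have "J \<star> I' k = arrow_sum (Ms ! k) B (\<lambda>i. (I (Suc i) \<star> P' i) \<star> I' k) ?n"
      unfolding J_def using pJ I'[of k] k by (subst arrow_sum_cp) auto
    also have "\<dots> = I (Suc k)"
      using I[of "Suc k"] I[of "Suc i" for i] I' Ob k
      by (intro arrow_sum_delta[where k = k]) (auto simp: d')
    finally show ?thesis .
  qed
  have "J \<star> Q = arrow_sum B B (\<lambda>i. J \<star> I' i \<star> P (Suc i)) ?n"
    unfolding Q_def using pJ pQ by (subst cp_arrow_sum) (auto simp: J_def)
  also have "\<dots> = arrow_sum B B (\<lambda>i. I (Suc i) \<star> P (Suc i)) ?n"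
    using I[of "Suc i" for i] I' pJ by (intro arrow_sum_cong) (auto simp: J_def cp_reassoc[OF JI[unfolded J_def]])
  finally have "J \<star> Q = arrow_sum B B (\<lambda>i. I (Suc i) \<star> P (Suc i)) ?n" .
  moreover have "parallel B B (\<lambda>i. I i \<star> P i) (Suc ?n)" using I by (auto simp: parallel_def)
  ultimately have IJ: "I 0 \<star> P 0 +\<^sub>a J \<star> Q = idn B"
    using s arrow_sum_shift[of B B "\<lambda>i. I i \<star> P i" ?n] by simp
  have "P 0 \<star> J = arrow_sum B' M (\<lambda>i. P 0 \<star> I (Suc i) \<star> P' i) ?n"
    unfolding J_def using pJ I[of 0] by (subst cp_arrow_sum) auto
  also have "\<dots> = zr B' M"
    using I[of 0] I[of "Suc i" for i] I' by (intro arrow_sum_zero) (auto simp: cp_reassoc[OF d])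
  finally have PJ0: "P 0 \<star> J = zr B' M" .
  have "Q \<star> I 0 = arrow_sum M B' (\<lambda>i. (I' i \<star> P (Suc i)) \<star> I 0) ?n"
    unfolding Q_def using pQ I[of 0] by (subst arrow_sum_cp) auto
  also have "\<dots> = zr M B'"
    using I[of 0] I[of "Suc i" for i] I' by (intro arrow_sum_zero) (auto simp: d)
  finally have QI0: "Q \<star> I 0 = zr M B'" .
  have "biprod M B' B (I 0) J (P 0) Q"
    unfolding biprod_def using I[of 0] pJ pQ d[of 0 0] QJ IJ PJ0 QI0 o by (auto simp: J_def Q_def)
  then show ?thesis by blast
qed

lemma dsum_Nil: "dsum [] B I P \<longleftrightarrow> is_zero_object C B"
  by (auto simp: dsum_def zero_object_idn)

end

context additive_linear_category
begin

lemma ex_biprod: "M \<in> Ob C \<Longrightarrow> N \<in> Ob C \<Longrightarrow> \<exists>B I J P Q. biprod M N B I J P Q"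
  using biproducts[of M N] unfolding biprod_ar by blast

lemma biprod_dsum:
  assumes b: "biprod M B' B I0 J P0 Q" and s: "dsum Ms B' I P"
  shows "dsum (M # Ms) B (\<lambda>k. case k of 0 \<Rightarrow> I0 | Suc k \<Rightarrow> J \<star> I k) (\<lambda>k. case k of 0 \<Rightarrow> P0 | Suc k \<Rightarrow> P k \<star> Q)"
    (is "dsum _ _ ?I ?P")
proof -
  let ?n = "length Ms"
  note [simp] = bipD[OF b] biprod_reassoc[OF b]
  have I: "arr (I k)" "dm (I k) = Ms ! k" "cd (I k) = B'" "arr (P k)" "dm (P k) = B'" "cd (P k) = Ms ! k"
    "Ms ! k \<in> Ob C"
    if "k < ?n" for k using s that unfolding dsum_def by auto
  have d: "P l \<star> I k = (if k = l then idn (Ms ! k) else zr (Ms ! k) (Ms ! l))"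
    if "k < ?n" "l < ?n" for k l using s that unfolding dsum_def by simp
  have p: "parallel B B (\<lambda>i. ?I i \<star> ?P i) (Suc ?n)"
    unfolding parallel_def
  proof (intro conjI allI impI)
    fix i assume "i < Suc ?n"
    then show "arr (?I i \<star> ?P i)" "dm (?I i \<star> ?P i) = B" "cd (?I i \<star> ?P i) = B"
      using I by (cases i; simp)+
  qed simp_all
  have p': "parallel B' B' (\<lambda>i. I i \<star> P i) ?n" using I by (auto simp: parallel_def)
  have "arrow_sum B B (\<lambda>i. ?I i \<star> ?P i) (Suc ?n) = I0 \<star> P0 +\<^sub>a arrow_sum B B (\<lambda>i. ?I (Suc i) \<star> ?P (Suc i)) ?n"
    using arrow_sum_shift[OF p] by simp
  also have "arrow_sum B B (\<lambda>i. ?I (Suc i) \<star> ?P (Suc i)) ?n = arrow_sum B B (\<lambda>i. J \<star> (I i \<star> P i) \<star> Q) ?n"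
    using I by (intro arrow_sum_cong) simp
  also have "\<dots> = J \<star> arrow_sum B' B' (\<lambda>i. I i \<star> P i) ?n \<star> Q"
  proof -
    have "parallel B B' (\<lambda>i. (I i \<star> P i) \<star> Q) ?n" using I by (auto simp: parallel_def)
    then show ?thesis using p' by (subst arrow_sum_cp) (auto simp: cp_arrow_sum)
  qed
  also have "arrow_sum B' B' (\<lambda>i. I i \<star> P i) ?n = idn B'" using s by (simp add: dsum_def)
  finally have sum: "arrow_sum B B (\<lambda>i. ?I i \<star> ?P i) (Suc ?n) = idn B" by simp
  show ?thesis unfolding dsum_def
  proof (intro conjI allI impI)
    show "set (M # Ms) \<subseteq> Ob C" using s by (simp add: dsum_def)
    show "arrow_sum B B (\<lambda>i. ?I i \<star> ?P i) (length (M # Ms)) = idn B" using sum by simp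
    show "B \<in> Ob C" by simp
    fix i assume i: "i < length (M # Ms)"
    then show "arr (?I i)" "dm (?I i) = (M # Ms) ! i" "cd (?I i) = B" "arr (?P i)"
      "dm (?P i) = B" "cd (?P i) = (M # Ms) ! i"
      using I by (cases i; simp)+
    fix j assume j: "j < length (M # Ms)"
    show "?P j \<star> ?I i = (if i = j then idn ((M # Ms) ! i) else zr ((M # Ms) ! i) ((M # Ms) ! j))"
      using i j I d by (cases i; cases j; simp)
  qed
qed

lemma ex_dsum: "set Ms \<subseteq> Ob C \<Longrightarrow> \<exists>B I P. dsum Ms B I P"
proof (induction Ms)
  case Nil
  then show ?case using zero_object by (simp add: dsum_Nil)
next
  case (Cons M Ms)
  then obtain B' I P where s: "dsum Ms B' I P" by auto
  then obtain B I0 J P0 Q where "biprod M B' B I0 J P0 Q"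
    using ex_biprod[of M B'] Cons.prems by (auto simp: dsum_def)
  then show ?case using biprod_dsum[OF _ s] by blast
qed

lemma direct_sum_cons:
  assumes "is_direct_sum C (M # Ms) B"
  obtains B' I J P Q where "is_direct_sum C Ms B'" "biprod M B' B I J P Q"
proof -
  obtain I P where s: "dsum (M # Ms) B I P" using direct_sum_dsum[OF assms] by blast
  then obtain B' I' P' where s': "dsum Ms B' I' P'" using ex_dsum[of Ms] by (auto simp: dsum_def)
  then show ?thesis using dsum_cons_biprod[OF s s'] dsum_direct_sum that by blast
qed

lemma direct_sum_Nil: "is_direct_sum C [] B \<Longrightarrow> is_zero_object C B"
  using direct_sum_dsum dsum_Nil by blast

text \<open>Reduces statements about finite direct sums to zero objects and binary biproducts, the
  only two situations in which traces, retracts and coindices have to be analysed.\<close>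

lemma direct_sum_induct [consumes 1, case_names zero biprod]:
  assumes "is_direct_sum C Ms B"
    and "\<And>Z. is_zero_object C Z \<Longrightarrow> Q Z"
    and "\<And>M B' B I J P R. M \<in> set Ms \<Longrightarrow> Q B' \<Longrightarrow> biprod M B' B I J P R \<Longrightarrow> Q B"
  shows "Q B"
  using assms(1,3)
proof (induction Ms arbitrary: B)
  case Nil
  then show ?case using direct_sum_Nil assms(2) by blast
next
  case (Cons M Ms)
  then obtain B' I J P R where "is_direct_sum C Ms B'" "biprod M B' B I J P R"
    using direct_sum_cons[of M Ms B] by blast
  with Cons show ?case by (meson list.set_intros)
qed

text \<open>Regroups \<open>L\<close> + (\<open>M\<close> + \<open>N\<close>) as \<open>M\<close> +
  (\<open>L\<close> + \<open>N\<close>), so that a summand of the tail of a direct sum becomes a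
  summand of the whole.\<close>

lemma biprod_assoc:
  assumes b: "biprod L B' B I J P Q" and b': "biprod M N B' I' J' P' Q'" and e: "biprod L N E I'' J'' P'' Q''"
  shows "biprod M E B (J \<star> I') (I \<star> P'' +\<^sub>a J \<star> J' \<star> Q'') (P' \<star> Q) (I'' \<star> P +\<^sub>a J'' \<star> Q' \<star> Q)"
proof -
  note [simp] = bipD[OF b] biprod_reassoc[OF b] bipD[OF b'] biprod_reassoc[OF b'] bipD[OF e] biprod_reassoc[OF e]
  have "J \<star> I' \<star> P' \<star> Q +\<^sub>a J \<star> J' \<star> Q' \<star> Q = J \<star> (I' \<star> P' +\<^sub>a J' \<star> Q') \<star> Q"
    by (simp del: bipD(20)[OF b'])
  also have "\<dots> = J \<star> Q" by simp
  finally have JQ: "J \<star> I' \<star> P' \<star> Q +\<^sub>a J \<star> J' \<star> Q' \<star> Q = J \<star> Q" .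
  have "(J \<star> I') \<star> (P' \<star> Q) +\<^sub>a (I \<star> P'' +\<^sub>a J \<star> J' \<star> Q'') \<star> (I'' \<star> P +\<^sub>a J'' \<star> Q' \<star> Q)
    = I \<star> P +\<^sub>a (J \<star> I' \<star> P' \<star> Q +\<^sub>a J \<star> J' \<star> Q' \<star> Q)"
    by (simp add: pl_lcomm[of _ "I \<star> P"])
  then show ?thesis unfolding biprod_def by (simp add: JQ)
qed

lemma direct_sum_summand:
  assumes "is_direct_sum C Ms B" "M \<in> set Ms"
  shows "\<exists>N I J P Q. biprod M N B I J P Q"
  using assms
proof (induction Ms arbitrary: B)
  case (Cons L Ms)
  obtain B' I J P Q where B': "is_direct_sum C Ms B'" and b: "biprod L B' B I J P Q"
    using direct_sum_cons[OF Cons.prems(1)] by blast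
  show ?case
  proof (cases "M = L")
    case False
    then obtain N I' J' P' Q' where b': "biprod M N B' I' J' P' Q'"
      using Cons.IH[OF B'] Cons.prems(2) by auto
    obtain E I'' J'' P'' Q'' where "biprod L N E I'' J'' P'' Q''"
      using ex_biprod[of L N] bipD(1)[OF b] bipD(2)[OF b'] by blast
    then show ?thesis using biprod_assoc[OF b b'] by blast
  qed (use b in blast)
qed simp

end

section \<open>Linear algebra over the base field\<close>

text \<open>Gaussian elimination by induction on the set \<open>I\<close> of equations, with
  unknowns indexed by \<open>J\<close>. It is applied twice: to the powers of an endomorphism and to
  the final count of indecomposables.\<close>

lemma (in field) underdetermined_system:
  assumes "finite I" "finite J" "card I < card J" "\<And>j k. j \<in> J \<Longrightarrow> k \<in> I \<Longrightarrow> a j k \<in> carrier R"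
  shows "\<exists>l. (\<forall>j\<in>J. l j \<in> carrier R) \<and> (\<exists>j\<in>J. l j \<noteq> \<zero>) \<and> (\<forall>k\<in>I. (\<Oplus>j\<in>J. l j \<otimes> a j k) = \<zero>)"
  using assms
proof (induction I arbitrary: J a rule: finite_induct)
  case empty
  then have "J \<noteq> {}" by auto
  then show ?case by (intro exI[of _ "\<lambda>_. \<one>"]) auto
next
  case (insert k0 I)
  show ?case
  proof (cases "\<forall>j\<in>J. a j k0 = \<zero>")
    case True
    obtain l where l: "\<forall>j\<in>J. l j \<in> carrier R" "\<exists>j\<in>J. l j \<noteq> \<zero>" "\<forall>k\<in>I. (\<Oplus>j\<in>J. l j \<otimes> a j k) = \<zero>"
      using insert.IH[of J a] insert.prems insert.hyps by auto
    have "(\<Oplus>j\<in>J. l j \<otimes> a j k0) = (\<Oplus>j\<in>J. \<zero>)"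
      using True l by (intro finsum_cong') auto
    then show ?thesis using l by (intro exI[of _ l]) auto
  next
    case False
    then obtain j0 where j0: "j0 \<in> J" "a j0 k0 \<noteq> \<zero>" by blast
    define J' where "J' = J - {j0}"
    define c where "c j = a j k0 \<otimes> inv (a j0 k0)" for j
    \<comment> \<open>Subtracting a multiple of the pivot row \<open>j0\<close> clears the entry at
      \<open>k0\<close> in every other row, so the induction hypothesis applies to one equation and
      one unknown fewer.\<close>
    define a' where "a' j k = a j k \<ominus> c j \<otimes> a j0 k" for j k
    have J': "finite J'" "j0 \<notin> J'" "J = insert j0 J'" "card I < card J'"
      using j0 insert.prems insert.hyps by (auto simp: J'_def)
    have u: "inv (a j0 k0) \<in> carrier R" "inv (a j0 k0) \<otimes> a j0 k0 = \<one>"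
      using j0 insert.prems(3)[of j0 k0] field_Units by (auto intro: Units_inv_closed Units_l_inv)
    have cc: "c j \<in> carrier R" if "j \<in> J" for j using that insert.prems u by (simp add: c_def)
    have ac: "a j k \<in> carrier R" if "j \<in> J" "k \<in> insert k0 I" for j k using that insert.prems by simp
    have "a' j k \<in> carrier R" if "j \<in> J'" "k \<in> I" for j k
      using that insert.prems cc J'(3) by (simp add: a'_def)
    then obtain l where l: "\<forall>j\<in>J'. l j \<in> carrier R" "\<exists>j\<in>J'. l j \<noteq> \<zero>"
      "\<forall>k\<in>I. (\<Oplus>j\<in>J'. l j \<otimes> a' j k) = \<zero>"
      using insert.IH[of J' a'] J' by auto
    define s where "s = (\<Oplus>j\<in>J'. l j \<otimes> c j)"
    have s: "s \<in> carrier R" unfolding s_def using l cc J' by (intro finsum_closed) auto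
    \<comment> \<open>The coefficient of the pivot row collects, with opposite sign, the multiples
      that were subtracted from the other rows.\<close>
    define l' where "l' j = (if j = j0 then \<ominus> s else l j)" for j
    have eq: "(\<Oplus>j\<in>J. l' j \<otimes> a j k) = \<zero>" if k: "k \<in> insert k0 I" and z: "(\<Oplus>j\<in>J'. l j \<otimes> a' j k) = \<zero>" for k
    proof -
      have "(\<Oplus>j\<in>J'. l j \<otimes> a j k) = (\<Oplus>j\<in>J'. l j \<otimes> a' j k \<oplus> (l j \<otimes> c j) \<otimes> a j0 k)"
      proof (rule finsum_cong')
        fix j assume j: "j \<in> J'"
        have [simp]: "a j k \<in> carrier R" "c j \<in> carrier R" "l j \<in> carrier R" "a j0 k \<in> carrier R"
          using j J' k ac cc l by auto
        show "l j \<otimes> a j k = l j \<otimes> a' j k \<oplus> (l j \<otimes> c j) \<otimes> a j0 k" unfolding a'_def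
          by (simp add: minus_eq r_distr r_minus m_assoc a_assoc l_neg)
      qed (use J' k ac cc l in \<open>auto simp: a'_def\<close>)
      also have "\<dots> = (\<Oplus>j\<in>J'. l j \<otimes> a' j k) \<oplus> (\<Oplus>j\<in>J'. (l j \<otimes> c j) \<otimes> a j0 k)"
        using J' k ac cc l by (intro finsum_addf) (auto simp: a'_def)
      also have "(\<Oplus>j\<in>J'. (l j \<otimes> c j) \<otimes> a j0 k) = s \<otimes> a j0 k"
        unfolding s_def using J' k ac cc l by (intro finsum_ldistr[symmetric]) auto
      finally have 1: "(\<Oplus>j\<in>J'. l j \<otimes> a j k) = s \<otimes> a j0 k"
        using z s ac[of j0 k] j0 k by simp
      have "(\<Oplus>j\<in>J. l' j \<otimes> a j k) = l' j0 \<otimes> a j0 k \<oplus> (\<Oplus>j\<in>J'. l' j \<otimes> a j k)"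
        unfolding J'(3) using J' k ac l s by (intro finsum_insert) (auto simp: l'_def)
      also have "(\<Oplus>j\<in>J'. l' j \<otimes> a j k) = (\<Oplus>j\<in>J'. l j \<otimes> a j k)"
        using J' k ac l s by (intro finsum_cong') (auto simp: l'_def)
      also have "l' j0 \<otimes> a j0 k \<oplus> (\<Oplus>j\<in>J'. l j \<otimes> a j k) = \<zero>"
        using s ac[of j0 k] j0 k unfolding 1 by (simp add: l'_def l_minus l_neg)
      finally show ?thesis .
    qed
    have "(\<Oplus>j\<in>J'. l j \<otimes> a' j k0) = (\<Oplus>j\<in>J'. \<zero>)"
    proof (rule finsum_cong')
      fix j assume j: "j \<in> J'"
      then have "c j \<otimes> a j0 k0 = a j k0"
        using J' j0 insert.prems u by (simp add: c_def m_assoc)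
      then show "l j \<otimes> a' j k0 = \<zero>" using j J' l insert.prems by (simp add: a'_def r_neg minus_eq)
    qed auto
    then have "\<forall>k\<in>insert k0 I. (\<Oplus>j\<in>J. l' j \<otimes> a j k) = \<zero>"
      using eq l(3) by auto
    moreover have "\<forall>j\<in>J. l' j \<in> carrier R" "\<exists>j\<in>J. l' j \<noteq> \<zero>"
      using l s J' by (auto simp: l'_def)
    ultimately show ?thesis by blast
  qed
qed

section \<open>Sums over lists\<close>

context ring
begin

text \<open>Lists instead of finite sets: concatenating two dual bases then adds the sums without
  any disjointness condition.\<close>

primrec list_sum :: "('c \<Rightarrow> 'a) \<Rightarrow> 'c list \<Rightarrow> 'a"
  where "list_sum f [] = \<zero>" | "list_sum f (x # xs) = f x \<oplus> list_sum f xs"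

lemma list_sum_closed [simp]: "(\<And>x. x \<in> set xs \<Longrightarrow> f x \<in> carrier R) \<Longrightarrow> list_sum f xs \<in> carrier R"
  by (induction xs) auto

lemma list_sum_cong: "(\<And>x. x \<in> set xs \<Longrightarrow> f x = g x) \<Longrightarrow> list_sum f xs = list_sum g xs"
  by (induction xs) auto

lemma list_sum_append:
  assumes "\<And>x. x \<in> set xs \<union> set ys \<Longrightarrow> f x \<in> carrier R"
  shows "list_sum f (xs @ ys) = list_sum f xs \<oplus> list_sum f ys"
  using assms by (induction xs) (auto simp: a_assoc)

lemma list_sum_map: "list_sum f (map g xs) = list_sum (\<lambda>x. f (g x)) xs"
  by (induction xs) auto

lemma list_sum_add:
  assumes "\<And>x. x \<in> set xs \<Longrightarrow> f x \<in> carrier R" "\<And>x. x \<in> set xs \<Longrightarrow> g x \<in> carrier R"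
  shows "list_sum (\<lambda>x. f x \<oplus> g x) xs = list_sum f xs \<oplus> list_sum g xs"
  using assms
proof (induction xs)
  case (Cons x xs)
  have "f x \<in> carrier R" "g x \<in> carrier R" "list_sum f xs \<in> carrier R" "list_sum g xs \<in> carrier R"
    using Cons.prems by auto
  then show ?case using Cons by (simp add: a_ac)
qed simp

lemma list_sum_zero: "list_sum (\<lambda>x. \<zero>) xs = \<zero>"
  by (induction xs) auto

lemma list_sum_swap:
  assumes "\<And>x y. x \<in> set xs \<Longrightarrow> y \<in> set ys \<Longrightarrow> f x y \<in> carrier R"
  shows "list_sum (\<lambda>x. list_sum (f x) ys) xs = list_sum (\<lambda>y. list_sum (\<lambda>x. f x y) xs) ys"
  using assms
proof (induction xs)
  case (Cons x xs)
  then show ?case by (simp add: list_sum_add)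
qed (simp add: list_sum_zero)

end

context linear_category
begin

section \<open>Local endomorphism rings\<close>

lemma sc_zr [simp]: "a \<in> carrier K \<Longrightarrow> M \<in> Ob C \<Longrightarrow> N \<in> Ob C \<Longrightarrow> sc a (zr M N) = zr M N"
  using sc_cp[of a "zr M N" "idn N"] cp_zr[of "sc a (idn N)" N M] by simp

lemma sc_ng [simp]:
  assumes "a \<in> carrier K" "arr F" shows "sc a (ng F) = ng (sc a F)"
  using assms by (intro ng_unique) (simp_all flip: sc_pl)

lemma sc_comm:
  assumes "a \<in> carrier K" "b \<in> carrier K" "arr F" shows "sc a (sc b F) = sc b (sc a F)"
proof -
  interpret K: field K by (rule field)
  show ?thesis using assms by (simp add: K.m_comm flip: mult_sc)
qed

definition end_arr :: "'o \<Rightarrow> ('o, 'm) arrow \<Rightarrow> bool"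
  where "end_arr V F \<longleftrightarrow> arr F \<and> dm F = V \<and> cd F = V"

definition nonunit :: "'o \<Rightarrow> ('o, 'm) arrow \<Rightarrow> bool"
  where "nonunit V F \<longleftrightarrow> end_arr V F \<and> \<not> (\<exists>G. mutual_inv V V F G)"

definition local_ob :: "'o \<Rightarrow> bool"
  where "local_ob V \<longleftrightarrow> V \<in> Ob C \<and> local_ring (End_ring C V)"

lemma Units_End:
  assumes "V \<in> Ob C"
  shows "f \<in> Units (End_ring C V) \<longleftrightarrow> (\<exists>G. mutual_inv V V (ar V f V) G)"
proof
  assume "f \<in> Units (End_ring C V)"
  then obtain g where "f \<in> mor C V V" "g \<in> mor C V V" "g \<cdot> f = ident C V" "f \<cdot> g = ident C V"
    by (auto simp: Units_def End_ring_def)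
  then have "mutual_inv V V (ar V f V) (ar V g V)"
    using assms by (simp add: mutual_inv_def arr_ar cp_def idn_def)
  then show "\<exists>G. mutual_inv V V (ar V f V) G" by blast
next
  assume "\<exists>G. mutual_inv V V (ar V f V) G"
  then obtain G where "mutual_inv V V (ar V f V) G" by blast
  then have "f \<in> mor C V V" "mp G \<in> mor C V V" "mp G \<cdot> f = ident C V" "f \<cdot> mp G = ident C V"
    using assms by (auto simp: mutual_inv_def cp_def idn_def arr_def simp del: arr_Ob)
  then show "f \<in> Units (End_ring C V)" by (auto simp: Units_def End_ring_def)
qed

lemma locD:
  assumes "local_ob V"
  shows "V \<in> Ob C" "idn V \<noteq> zr V V" "nonunit V F \<Longrightarrow> nonunit V G \<Longrightarrow> nonunit V (F +\<^sub>a G)"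
proof -
  show V: "V \<in> Ob C" using assms by (simp add: local_ob_def)
  show "idn V \<noteq> zr V V"
    using assms by (auto simp: local_ob_def local_ring_def End_ring_def idn_def zr_def)
  assume FG: "nonunit V F" "nonunit V G"
  have e: "ar V (mp H) V = H" if "end_arr V H" for H
    using that by (intro arrow_eqI) (simp_all add: end_arr_def)
  have n: "mp H \<in> carrier (End_ring C V) - Units (End_ring C V)" if "nonunit V H" for H
    using that e[of H] Units_End[OF V, of "mp H"]
    by (auto simp: nonunit_def end_arr_def arr_def End_ring_def simp del: arr_Ob)
  have "mp F \<oplus>\<^bsub>End_ring C V\<^esub> mp G \<in> carrier (End_ring C V) - Units (End_ring C V)"
    using assms n FG by (auto simp: local_ob_def local_ring_def)
  then have "mp (F +\<^sub>a G) \<notin> Units (End_ring C V)"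
    using FG by (simp add: nonunit_def end_arr_def pl_def End_ring_def)
  moreover have "end_arr V (F +\<^sub>a G)" using FG by (auto simp: nonunit_def end_arr_def)
  ultimately show "nonunit V (F +\<^sub>a G)"
    using Units_End[OF V, of "mp (F +\<^sub>a G)"] e[of "F +\<^sub>a G"] by (simp add: nonunit_def)
qed

text \<open>\<open>P \<star> G \<star> Q\<close> is an idempotent \<open>e\<close> of
  \<open>W\<close> with \<open>e \<star> P = P\<close>. As \<open>W\<close> is local,
  \<open>e\<close> or its complement is invertible; the complement annihilates \<open>P\<close>,
  which is nonzero because \<open>Q \<star> P\<close> is invertible, so it is \<open>e\<close> that
  is invertible. For \<open>V = W\<close> this says that factors of units are units, without
  commutativity.\<close>

lemma local_factor_mutual_inv:
  assumes V: "local_ob V" and W: "local_ob W"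
    and P: "arr P" "dm P = V" "cd P = W" and Q: "arr Q" "dm Q = W" "cd Q = V"
    and u: "mutual_inv V V (Q \<star> P) G"
  shows "\<exists>H. mutual_inv V W P H" "\<exists>H. mutual_inv W V Q H"
proof -
  note [simp] = P Q isoD[OF u] locD(1)[OF V] locD(1)[OF W]
  have GQP: "G \<star> Q \<star> P = idn V" using isoD(9)[OF u] by simp
  define e where "e = P \<star> G \<star> Q"
  have [simp]: "arr e" "dm e = W" "cd e = W" by (simp_all add: e_def)
  have eP: "e \<star> P = P" by (simp add: e_def GQP)
  have "\<exists>H. mutual_inv W W e H"
  proof (rule ccontr)
    assume "\<nexists>H. mutual_inv W W e H"
    then have ne: "nonunit W e" by (simp add: nonunit_def end_arr_def)
    have "nonunit W (idn W +\<^sub>a ng e)"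
      unfolding nonunit_def
    proof (intro conjI notI)
      show "end_arr W (idn W +\<^sub>a ng e)" by (simp add: end_arr_def)
      assume "\<exists>H. mutual_inv W W (idn W +\<^sub>a ng e) H"
      then obtain H where H: "mutual_inv W W (idn W +\<^sub>a ng e) H" by blast
      note [simp] = isoD(3-8)[OF H]
      have "P = (H \<star> (idn W +\<^sub>a ng e)) \<star> P" using isoD(9)[OF H] by simp
      also have "\<dots> = H \<star> (P +\<^sub>a ng P)" by (simp add: eP del: pl_ng)
      also have "\<dots> = zr V W" by simp
      finally have P0: "P = zr V W" .
      have "G \<star> Q \<star> P = zr V V" by (subst P0) simp
      then show False using locD(2)[OF V] GQP by simp
    qed
    then have "nonunit W (e +\<^sub>a (idn W +\<^sub>a ng e))" using ne locD(3)[OF W] by blast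
    then have "nonunit W (idn W)" by (simp add: pl_comm[of "idn W"])
    then show False using mutual_inv_refl[of W] by (auto simp: nonunit_def)
  qed
  then obtain H where H: "mutual_inv W W e H" by blast
  note [simp] = isoD(3-8)[OF H]
  \<comment> \<open>\<open>G \<star> Q \<star> H\<close> is a right inverse of \<open>P\<close>,
    while \<open>G \<star> Q\<close> is a left inverse; the two must coincide.\<close>
  have r: "P \<star> G \<star> Q \<star> H = idn W" using isoD(10)[OF H] by (simp add: e_def)
  have "G \<star> Q = (G \<star> Q) \<star> (P \<star> G \<star> Q \<star> H)" by (simp add: r)
  also have "\<dots> = (G \<star> Q \<star> P) \<star> (G \<star> Q \<star> H)" by (simp del: isoD(9)[OF u])
  also have "\<dots> = idn V \<star> (G \<star> Q \<star> H)" by (simp only: GQP)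
  also have "\<dots> = G \<star> Q \<star> H" by simp
  finally have GQ: "G \<star> Q = G \<star> Q \<star> H" .
  have "P \<star> G \<star> Q = idn W" by (subst GQ) (rule r)
  then have i: "mutual_inv V W P (G \<star> Q)" by (simp add: mutual_inv_def)
  then show "\<exists>H. mutual_inv V W P H" by blast
  have "Q \<star> (P \<star> G) = idn V" by (subst cp_assoc[symmetric]) (simp_all del: cp_assoc)
  moreover have "(P \<star> G) \<star> Q = idn W" using isoD(10)[OF i] by simp
  ultimately have "mutual_inv W V Q (P \<star> G)" by (simp add: mutual_inv_def)
  then show "\<exists>H. mutual_inv W V Q H" by blast
qed

text \<open>If the composite were invertible, \<open>local_factor_mutual_inv\<close> with both
  objects equal to \<open>V\<close> would make each factor invertible.\<close>

lemma nonunit_cp: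
  assumes "local_ob V" "end_arr V F" "end_arr V G" "nonunit V F \<or> nonunit V G"
  shows "nonunit V (G \<star> F)"
proof -
  have "False" if "mutual_inv V V (G \<star> F) H" for H
    using local_factor_mutual_inv[OF assms(1,1) _ _ _ _ _ _ that] assms(2-4)
    by (auto simp: nonunit_def end_arr_def)
  then show ?thesis using assms(2,3) by (auto simp: nonunit_def end_arr_def)
qed

section \<open>Scalars, polynomials in an endomorphism and eigenvalues\<close>

lemma sc_unit:
  assumes "V \<in> Ob C" "a \<in> carrier K" "a \<noteq> \<zero>\<^bsub>K\<^esub>"
  shows "\<exists>G. mutual_inv V V (sc a (idn V)) G"
proof -
  interpret K: field K by (rule field)
  have a: "inv\<^bsub>K\<^esub> a \<in> carrier K" "inv\<^bsub>K\<^esub> a \<otimes>\<^bsub>K\<^esub> a = \<one>\<^bsub>K\<^esub>" "a \<otimes>\<^bsub>K\<^esub> inv\<^bsub>K\<^esub> a = \<one>\<^bsub>K\<^esub>"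
    using assms K.field_Units by auto
  have "mutual_inv V V (sc a (idn V)) (sc (inv\<^bsub>K\<^esub> a) (idn V))"
    using assms(1,2) a by (simp add: mutual_inv_def flip: mult_sc)
  then show ?thesis by blast
qed

lemma ng_sc:
  assumes "a \<in> carrier K" "arr F"
  shows "ng (sc a F) = sc (\<ominus>\<^bsub>K\<^esub> a) F"
proof -
  interpret K: field K by (rule field)
  show ?thesis using assms by (intro ng_unique[symmetric]) (simp_all add: K.r_neg flip: add_sc)
qed

lemma sc_nonunit:
  assumes "local_ob V" "a \<in> carrier K" "nonunit V F" 
  shows "nonunit V (sc a F)"
proof -
  have "sc a F = sc a (idn V) \<star> F" "end_arr V (sc a (idn V))" "end_arr V F"
    using assms locD(1)[OF assms(1)] by (auto simp: nonunit_def end_arr_def)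
  then show ?thesis using nonunit_cp[of V F "sc a (idn V)"] assms by simp
qed

lemma nonunit_ng: assumes "local_ob V" "nonunit V F" shows "nonunit V (ng F)"
proof -
  interpret K: field K by (rule field)
  have "arr F" using assms(2) by (simp add: nonunit_def end_arr_def)
  then have "ng F = sc (\<ominus>\<^bsub>K\<^esub> \<one>\<^bsub>K\<^esub>) F" using ng_sc[of "\<one>\<^bsub>K\<^esub>" F] by simp
  then show ?thesis using sc_nonunit[OF assms(1) _ assms(2)] by simp
qed

text \<open>Polynomials are lists of coefficients in increasing degree, evaluated by Horner's scheme;
  \<open>synth a p\<close> is the quotient of \<open>p - p(a)\<close> by \<open>X - a\<close>.\<close>

primrec horner :: "'k \<Rightarrow> 'k list \<Rightarrow> 'k"
  where "horner a [] = \<zero>\<^bsub>K\<^esub>"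
  | "horner a (c # p) = c \<oplus>\<^bsub>K\<^esub> a \<otimes>\<^bsub>K\<^esub> horner a p"

primrec synth :: "'k \<Rightarrow> 'k list \<Rightarrow> 'k list"
  where "synth a [] = []"
  | "synth a (c # p) = (if p = [] then [] else horner a p # synth a p)"

primrec horner_arr :: "'o \<Rightarrow> ('o, 'm) arrow \<Rightarrow> 'k list \<Rightarrow> ('o, 'm) arrow"
  where "horner_arr V F [] = zr V V"
  | "horner_arr V F (c # p) = sc c (idn V) +\<^sub>a F \<star> horner_arr V F p"

lemma horner_closed [simp]:
  assumes "a \<in> carrier K" "set p \<subseteq> carrier K" shows "horner a p \<in> carrier K"
proof -
  interpret K: field K by (rule field)
  show ?thesis using assms by (induction p) auto
qed

lemma synth_closed: "a \<in> carrier K \<Longrightarrow> set p \<subseteq> carrier K \<Longrightarrow> set (synth a p) \<subseteq> carrier K"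
  by (induction p) auto

lemma length_synth: "length (synth a p) = length p - 1"
  by (induction p) (auto simp: Suc_diff_le)

text \<open>The leading coefficient, stored last, survives the division; hence the quotient of a
  polynomial with nonzero leading coefficient is again nonzero.\<close>

lemma last_synth:
  assumes "a \<in> carrier K" "set p \<subseteq> carrier K" "length p \<ge> 2" shows "last (synth a p) = last p"
proof -
  interpret K: field K by (rule field)
  show ?thesis using assms
  proof (induction p)
    case (Cons c p)
    show ?case
    proof (cases "length p \<ge> 2")
      case True
      then have "synth a p \<noteq> []" "p \<noteq> []" using length_synth[of a p] by (auto dest: arg_cong[of _ _ length])
      then show ?thesis using Cons True by auto
    next
      case False
      then obtain x where "p = [x]" using Cons.prems by (cases p; cases "tl p") auto
      then show ?thesis using Cons.prems by simp
    qed
  qed simp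
qed

lemma horner_arr_arr [simp]:
  assumes "end_arr V F" "set p \<subseteq> carrier K"
  shows "arr (horner_arr V F p)" "dm (horner_arr V F p) = V" "cd (horner_arr V F p) = V"
proof -
  have "arr (horner_arr V F p) \<and> dm (horner_arr V F p) = V \<and> cd (horner_arr V F p) = V"
    using assms by (induction p) (auto simp: end_arr_def)
  then show "arr (horner_arr V F p)" "dm (horner_arr V F p) = V" "cd (horner_arr V F p) = V" by simp_all
qed

text \<open>Division with remainder by \<open>X - a\<close>, evaluated at \<open>F\<close>: if
  \<open>a\<close> is a root of \<open>p\<close>, then \<open>F\<close> minus the scalar
  \<open>a\<close> is a left factor of \<open>p\<close> evaluated at \<open>F\<close>.\<close>

lemma horner_synth:
  assumes F: "end_arr V F" and a: "a \<in> carrier K" and p: "set p \<subseteq> carrier K"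
  shows "horner_arr V F p =
    (F +\<^sub>a ng (sc a (idn V))) \<star> horner_arr V F (synth a p) +\<^sub>a sc (horner a p) (idn V)"
  using p
proof (induction p)
  case Nil
  then show ?case using F a by (auto simp: end_arr_def)
next
  interpret K: field K by (rule field)
  case (Cons c p)
  have [simp]: "V \<in> Ob C" "arr F" "dm F = V" "cd F = V" using F by (auto simp: end_arr_def)
  have [simp]: "c \<in> carrier K" "set p \<subseteq> carrier K" "set (synth a p) \<subseteq> carrier K"
    using Cons.prems synth_closed[OF a] by auto
  note [simp] = horner_arr_arr[OF F] a
  show ?case
  proof (cases "p = []")
    case False
    let ?q = "horner_arr V F (synth a p)" and ?b = "horner a p"
    have ab: "sc (c \<oplus>\<^bsub>K\<^esub> a \<otimes>\<^bsub>K\<^esub> ?b) (idn V) = sc c (idn V) +\<^sub>a sc a (sc ?b (idn V))"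
      by (simp add: add_sc mult_sc)
    have "F \<star> horner_arr V F p = F \<star> F \<star> ?q +\<^sub>a ng (sc a (F \<star> ?q)) +\<^sub>a sc ?b F"
      using Cons.IH by (simp add: pl_assoc)
    then have L: "horner_arr V F (c # p) = sc c (idn V) +\<^sub>a (F \<star> F \<star> ?q +\<^sub>a ng (sc a (F \<star> ?q)) +\<^sub>a sc ?b F)"
      by simp
    have "(F +\<^sub>a ng (sc a (idn V))) \<star> horner_arr V F (synth a (c # p))
      = sc ?b F +\<^sub>a F \<star> F \<star> ?q +\<^sub>a (ng (sc a (sc ?b (idn V))) +\<^sub>a ng (sc a (F \<star> ?q)))"
      using False sc_comm[of ?b a "idn V"]
      by (simp add: sc_pl pl_assoc pl_lcomm pl_comm)
    then have R: "(F +\<^sub>a ng (sc a (idn V))) \<star> horner_arr V F (synth a (c # p)) +\<^sub>a sc (horner a (c # p)) (idn V)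
      = sc ?b F +\<^sub>a F \<star> F \<star> ?q +\<^sub>a (ng (sc a (sc ?b (idn V))) +\<^sub>a ng (sc a (F \<star> ?q)))
        +\<^sub>a (sc c (idn V) +\<^sub>a sc a (sc ?b (idn V)))"
      unfolding horner.simps ab by simp
    let ?A = "sc ?b F" and ?B = "F \<star> F \<star> ?q" and ?X = "sc a (sc ?b (idn V))"
      and ?D = "ng (sc a (F \<star> ?q))" and ?E = "sc c (idn V)"
    have "?A +\<^sub>a ?B +\<^sub>a (ng ?X +\<^sub>a ?D) +\<^sub>a (?E +\<^sub>a ?X) = ng ?X +\<^sub>a (?X +\<^sub>a (?E +\<^sub>a (?B +\<^sub>a ?D +\<^sub>a ?A)))"
      by (simp add: pl_assoc pl_comm pl_lcomm del: pl_ng ng_pl pl_ng_cancel)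
    also have "\<dots> = ?E +\<^sub>a (?B +\<^sub>a ?D +\<^sub>a ?A)" by simp
    finally show ?thesis unfolding R L ..
  qed (auto)
qed

text \<open>Horner's scheme unfolds from the constant term; this exposes the leading term instead.
  It is used to read an evaluation as a combination of powers and to drop a vanishing leading
  coefficient.\<close>

lemma horner_append:
  assumes F: "end_arr V F" and p: "set p \<subseteq> carrier K" and c: "c \<in> carrier K"
  shows "horner_arr V F (p @ [c]) = horner_arr V F p +\<^sub>a sc c (((\<lambda>G. F \<star> G) ^^ length p) (idn V))"
  using p
proof (induction p)
  case Nil
  then show ?case using F c by (auto simp: end_arr_def)
next
  case (Cons b p)
  have [simp]: "V \<in> Ob C" "arr F" "dm F = V" "cd F = V" using F by (auto simp: end_arr_def)
  have pow: "end_arr V (((\<lambda>G. F \<star> G) ^^ n) (idn V))" for n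
    by (induction n) (auto simp: end_arr_def)
  show ?case using Cons c pow[of "length p"] horner_arr_arr[OF F, of p]
    by (simp add: pl_assoc end_arr_def)
qed


text \<open>Polynomials in \<open>poly_ring\<close> list the leading coefficient first, hence the
  \<open>rev\<close>. Over an algebraically closed field the multiset of roots has as many elements
  as the degree, which is positive here.\<close>

lemma horner_root:
  assumes ac: "algebraically_closed K" and p: "set p \<subseteq> carrier K" "length p \<ge> 2" "last p \<noteq> \<zero>\<^bsub>K\<^esub>"
  shows "\<exists>a\<in>carrier K. horner a p = \<zero>\<^bsub>K\<^esub>"
proof -
  interpret K: algebraically_closed K by (rule ac)
  have ev: "K.eval (rev q) a = horner a q" if "set q \<subseteq> carrier K" "a \<in> carrier K" for q a
    using that
  proof (induction q)
    case (Cons c q)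
    then show ?case using K.eval_append_aux[of "rev q" c a] by (simp add: K.m_comm K.a_comm)
  qed simp
  have "p \<noteq> []" using p by auto
  then have "rev p \<in> carrier (poly_ring K)"
    using p unfolding univ_poly_carrier[symmetric] polynomial_def by (simp add: hd_rev)
  moreover from this have "size (K.roots (rev p)) = length p - 1"
    using K.roots_over_carrier unfolding K.splitted_def by simp
  then have "K.roots (rev p) \<noteq> {#}" using p(2) by auto
  then obtain a where "a \<in># K.roots (rev p)" by blast
  ultimately have "K.is_root (rev p) a" using K.roots_mem_iff_is_root by blast
  then show ?thesis using ev[OF p(1)] by (auto simp: K.is_root_def)
qed

text \<open>A spanning set \<open>B\<close> is enough: the coordinate vectors with respect to
  \<open>B\<close> of the first \<open>card B + 1\<close> powers of \<open>F\<close> satisfy a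
  nontrivial relation, and the powers satisfy the same one.\<close>

lemma horner_arr_dependent:
  assumes fd: "finite_dimensional K (Hom C V V)" and F: "end_arr V F"
  shows "\<exists>p. set p \<subseteq> carrier K \<and> (\<exists>c\<in>set p. c \<noteq> \<zero>\<^bsub>K\<^esub>) \<and> horner_arr V F p = zr V V"
proof -
  have V: "V \<in> Ob C" "arr F" "dm F = V" "cd F = V" using F by (auto simp: end_arr_def)
  interpret K: field K by (rule field)
  interpret H: module K "Hom C V V" using V by (simp add: Hom_module)
  obtain B where B: "finite B" "B \<subseteq> mor C V V" and
    sp: "\<And>v. v \<in> mor C V V \<Longrightarrow> \<exists>a \<in> B \<rightarrow> carrier K. v = finsum (Hom C V V) (\<lambda>b. a b \<odot>\<^bsub>Hom C V V\<^esub> b) B"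
    using fd unfolding finite_dimensional_def by blast
  define pw where "pw n = ((\<lambda>G. F \<star> G) ^^ n) (idn V)" for n
  have pw: "arr (pw n)" "dm (pw n) = V" "cd (pw n) = V" for n
  proof -
    have "arr (pw n) \<and> dm (pw n) = V \<and> cd (pw n) = V" by (induction n) (simp_all add: pw_def V)
    then show "arr (pw n)" "dm (pw n) = V" "cd (pw n) = V" by auto
  qed
  have "mp (pw n) \<in> mor C V V" for n using pw[of n] by (simp add: arr_def del: arr_Ob)
  then have "\<forall>n. \<exists>a. a \<in> B \<rightarrow> carrier K \<and> mp (pw n) = finsum (Hom C V V) (\<lambda>b. a b \<odot>\<^bsub>Hom C V V\<^esub> b) B"
    using sp by blast
  from choice[OF this] obtain a where a: "\<And>n. a n \<in> B \<rightarrow> carrier K"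
    "\<And>n. mp (pw n) = finsum (Hom C V V) (\<lambda>b. a n b \<odot>\<^bsub>Hom C V V\<^esub> b) B"
    by blast
  define N where "N = Suc (card B)"
  obtain l where l: "\<forall>j\<in>{..<N}. l j \<in> carrier K" "\<exists>j\<in>{..<N}. l j \<noteq> \<zero>\<^bsub>K\<^esub>"
    "\<forall>b\<in>B. (\<Oplus>\<^bsub>K\<^esub>j\<in>{..<N}. l j \<otimes>\<^bsub>K\<^esub> a j b) = \<zero>\<^bsub>K\<^esub>"
    using K.underdetermined_system[of B "{..<N}" a] B(1) a(1) by (auto simp: N_def Pi_iff)
  have sum: "horner_arr V F (map l [0..<n]) =
      ar V (finsum (Hom C V V) (\<lambda>b. (\<Oplus>\<^bsub>K\<^esub>j\<in>{..<n}. l j \<otimes>\<^bsub>K\<^esub> a j b) \<odot>\<^bsub>Hom C V V\<^esub> b) B) V" if "n \<le> N" for n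
    using that
  proof (induction n)
    case 0
    have "finsum (Hom C V V) (\<lambda>b. \<zero>\<^bsub>K\<^esub> \<odot>\<^bsub>Hom C V V\<^esub> b) B = finsum (Hom C V V) (\<lambda>b. \<zero>\<^bsub>Hom C V V\<^esub>) B"
      using B by (intro H.M.finsum_cong') auto
    then show ?case by (simp add: zr_def H.M.finsum_zero)
  next
    case (Suc n)
    have lc: "l n \<in> carrier K" "\<And>j. j < n \<Longrightarrow> l j \<in> carrier K" using l(1) Suc.prems by auto
    have ac: "a j b \<in> carrier K" if "b \<in> B" for j b using a(1) that by auto
    have bc: "b \<in> mor C V V" if "b \<in> B" for b using B that by auto
    let ?s = "\<lambda>b. (\<Oplus>\<^bsub>K\<^esub>j\<in>{..<n}. l j \<otimes>\<^bsub>K\<^esub> a j b)"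
    have sc: "?s b \<in> carrier K" if "b \<in> B" for b using that ac lc by (intro K.finsum_closed) auto
    have "horner_arr V F (map l [0..<Suc n]) = horner_arr V F (map l [0..<n]) +\<^sub>a sc (l n) (pw n)"
    proof -
      have "set (map l [0..<n]) \<subseteq> carrier K" using lc by auto
      then show ?thesis using horner_append[OF F, of "map l [0..<n]" "l n"] lc by (simp add: pw_def)
    qed
    also have "\<dots> = ar V (finsum (Hom C V V) (\<lambda>b. ?s b \<odot>\<^bsub>Hom C V V\<^esub> b) B \<oplus>\<^bsub>Hom C V V\<^esub>
        l n \<odot>\<^bsub>Hom C V V\<^esub> finsum (Hom C V V) (\<lambda>b. a n b \<odot>\<^bsub>Hom C V V\<^esub> b) B) V"
      using Suc pw[of n] by (simp add: pl_def sc_def a(2))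
    also have "l n \<odot>\<^bsub>Hom C V V\<^esub> finsum (Hom C V V) (\<lambda>b. a n b \<odot>\<^bsub>Hom C V V\<^esub> b) B
        = finsum (Hom C V V) (\<lambda>b. l n \<odot>\<^bsub>Hom C V V\<^esub> (a n b \<odot>\<^bsub>Hom C V V\<^esub> b)) B"
      using B lc ac bc by (intro H.finsum_smult_ldistr) auto
    also have "finsum (Hom C V V) (\<lambda>b. ?s b \<odot>\<^bsub>Hom C V V\<^esub> b) B \<oplus>\<^bsub>Hom C V V\<^esub> \<dots>
        = finsum (Hom C V V) (\<lambda>b. ?s b \<odot>\<^bsub>Hom C V V\<^esub> b \<oplus>\<^bsub>Hom C V V\<^esub> l n \<odot>\<^bsub>Hom C V V\<^esub> (a n b \<odot>\<^bsub>Hom C V V\<^esub> b)) B"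
      using B lc ac bc sc by (intro H.M.finsum_addf[symmetric]) auto
    also have "\<dots> = finsum (Hom C V V) (\<lambda>b. (\<Oplus>\<^bsub>K\<^esub>j\<in>{..<Suc n}. l j \<otimes>\<^bsub>K\<^esub> a j b) \<odot>\<^bsub>Hom C V V\<^esub> b) B"
    proof (rule H.M.finsum_cong')
      fix b assume b: "b \<in> B"
      have "(\<Oplus>\<^bsub>K\<^esub>j\<in>{..<Suc n}. l j \<otimes>\<^bsub>K\<^esub> a j b) = l n \<otimes>\<^bsub>K\<^esub> a n b \<oplus>\<^bsub>K\<^esub> ?s b"
        unfolding lessThan_Suc using lc ac[OF b] by (intro K.finsum_insert) auto
      then show "?s b \<odot>\<^bsub>Hom C V V\<^esub> b \<oplus>\<^bsub>Hom C V V\<^esub> l n \<odot>\<^bsub>Hom C V V\<^esub> (a n b \<odot>\<^bsub>Hom C V V\<^esub> b)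
          = (\<Oplus>\<^bsub>K\<^esub>j\<in>{..<Suc n}. l j \<otimes>\<^bsub>K\<^esub> a j b) \<odot>\<^bsub>Hom C V V\<^esub> b"
        using lc ac[OF b] sc[OF b] bc[OF b] by (simp add: H.smult_l_distr H.smult_assoc1 H.M.a_comm)
    qed (use lc ac bc in \<open>auto simp: less_Suc_eq intro!: H.smult_closed K.finsum_closed\<close>)
    finally show ?case .
  qed
  have "finsum (Hom C V V) (\<lambda>b. (\<Oplus>\<^bsub>K\<^esub>j\<in>{..<N}. l j \<otimes>\<^bsub>K\<^esub> a j b) \<odot>\<^bsub>Hom C V V\<^esub> b) B
      = finsum (Hom C V V) (\<lambda>b. \<zero>\<^bsub>Hom C V V\<^esub>) B"
    using B l(3) by (intro H.M.finsum_cong') auto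
  then have "horner_arr V F (map l [0..<N]) = zr V V"
    using sum[of N] by (simp add: zr_def H.M.finsum_zero)
  then show ?thesis using l by (intro exI[of _ "map l [0..<N]"]) auto
qed

text \<open>Induction on the length of a nonzero annihilating polynomial. A zero leading coefficient
  is dropped; otherwise a root \<open>a\<close> is split off. If \<open>F\<close> minus the scalar
  \<open>a\<close> is invertible it can be cancelled, which leaves the shorter quotient as an
  annihilating polynomial.\<close>

lemma ex_eigenvalue:
  assumes ac: "algebraically_closed K" and fd: "finite_dimensional K (Hom C V V)"
    and V: "local_ob V" and F: "end_arr V F"
  shows "\<exists>a\<in>carrier K. nonunit V (F +\<^sub>a ng (sc a (idn V)))"
proof -
  interpret K: field K by (rule field)
  have [simp]: "V \<in> Ob C" "arr F" "dm F = V" "cd F = V" using F by (auto simp: end_arr_def)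
  have "\<exists>a\<in>carrier K. nonunit V (F +\<^sub>a ng (sc a (idn V)))"
    if "set p \<subseteq> carrier K" "\<exists>c\<in>set p. c \<noteq> \<zero>\<^bsub>K\<^esub>" "horner_arr V F p = zr V V" for p
    using that
  proof (induction p rule: length_induct)
    case (1 p)
    have ne: "p \<noteq> []" using "1.prems" by auto
    have sp: "p = butlast p @ [last p]" using ne by simp
    show ?case
    proof (cases "last p = \<zero>\<^bsub>K\<^esub>")
      case True
      let ?q = "butlast p"
      have q: "set ?q \<subseteq> carrier K" using "1.prems"(1) by (meson in_set_butlastD subset_iff)
      have pw: "end_arr V (((\<lambda>G. F \<star> G) ^^ n) (idn V))" for n
        by (induction n) (auto simp: end_arr_def)
      have "horner_arr V F p = horner_arr V F ?q"
        using horner_append[OF F q, of "last p"] pw[of "length ?q"] horner_arr_arr[OF F q] True sp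
        by (simp add: end_arr_def)
      moreover have "\<exists>c\<in>set ?q. c \<noteq> \<zero>\<^bsub>K\<^esub>" using "1.prems"(2) True sp
        by (metis Un_iff list.set(1) empty_iff set_ConsD set_append)
      ultimately show ?thesis using "1.IH" "1.prems"(3) q ne
        by (metis diff_less length_butlast length_greater_0_conv zero_less_one)
    next
      case False
      have lc: "last p \<in> carrier K" using ne "1.prems"(1) by auto
      show ?thesis
      proof (cases "length p \<ge> 2")
        case True
        obtain a where a: "a \<in> carrier K" "horner a p = \<zero>\<^bsub>K\<^esub>"
          using horner_root[OF ac "1.prems"(1) True False] by blast
        let ?q = "synth a p"
        have q: "set ?q \<subseteq> carrier K" using synth_closed[OF a(1) "1.prems"(1)] .
        note [simp] = horner_arr_arr[OF F q] a(1)
        have lq: "length ?q = length p - 1" "last ?q = last p"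
          using length_synth last_synth[OF a(1) "1.prems"(1) True] by auto
        have nq: "?q \<noteq> []" using lq True by (metis Suc_1 diff_is_0_eq list.size(3) not_less_eq_eq)
        show ?thesis
        proof (cases "nonunit V (F +\<^sub>a ng (sc a (idn V)))")
          case False
          then obtain G where G: "mutual_inv V V (F +\<^sub>a ng (sc a (idn V))) G"
            by (auto simp: nonunit_def end_arr_def)
          note [simp] = isoD(3-8)[OF G]
          have 0: "(F +\<^sub>a ng (sc a (idn V))) \<star> horner_arr V F ?q = zr V V"
            using horner_synth[OF F a(1) "1.prems"(1)] "1.prems"(3) a(2) by simp
          have "horner_arr V F ?q = (G \<star> (F +\<^sub>a ng (sc a (idn V)))) \<star> horner_arr V F ?q"
            unfolding isoD(9)[OF G] by simp
          also have "\<dots> = G \<star> ((F +\<^sub>a ng (sc a (idn V))) \<star> horner_arr V F ?q)"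
            by (rule cp_assoc) simp_all
          also have "\<dots> = zr V V" unfolding 0 by simp
          finally have "horner_arr V F ?q = zr V V" .
          then show ?thesis using "1.IH" q nq lq \<open>last p \<noteq> \<zero>\<^bsub>K\<^esub>\<close> ne
            by (metis diff_less last_in_set length_greater_0_conv zero_less_one)
        qed (use a in blast)
      next
        \<comment> \<open>A nonzero constant cannot annihilate: it is invertible as an endomorphism,
          and \<open>idn V\<close> is nonzero.\<close>
        case False2: False
        then obtain c where p: "p = [c]" using ne by (cases p; cases "tl p") auto
        then have "sc c (idn V) = zr V V" using "1.prems" by simp
        moreover obtain G where "mutual_inv V V (sc c (idn V)) G"
          using sc_unit[of V c] lc False p by auto
        ultimately have "idn V = G \<star> zr V V" "arr G" "dm G = V" "cd G = V" by (auto simp: mutual_inv_def)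
        then show ?thesis using locD(2)[OF V] by simp
      qed
    qed
  qed
  then show ?thesis using horner_arr_dependent[OF fd F] by blast
qed

section \<open>Traces at an object with local endomorphism ring\<close>

text \<open>The class of \<open>F\<close> in the residue field of the endomorphism ring of
  \<open>V\<close>, which is \<open>K\<close> by \<open>ex_eigenvalue\<close>.\<close>

definition eigval :: "'o \<Rightarrow> ('o, 'm) arrow \<Rightarrow> 'k"
  where "eigval V F = (SOME a. a \<in> carrier K \<and> nonunit V (F +\<^sub>a ng (sc a (idn V))))"

text \<open>Dual bases for the pairing of \<open>Hom(Y, V)\<close> with \<open>Hom(V, Y)\<close> by \<open>eigval V\<close>.  Computing traces from
  them makes invariance under cyclic permutation, and with it independence of the direct sum
  decomposition of \<open>Y\<close>, a matter of exchanging two sums.\<close>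

definition dual_basis :: "'o \<Rightarrow> 'o \<Rightarrow> (('o, 'm) arrow \<times> ('o, 'm) arrow) list \<Rightarrow> bool"
  where "dual_basis V Y xs \<longleftrightarrow>
    (\<forall>(a, b) \<in> set xs. arr a \<and> dm a = Y \<and> cd a = V \<and> arr b \<and> dm b = V \<and> cd b = Y) \<and>
    (\<forall>P Q. arr P \<longrightarrow> dm P = Y \<longrightarrow> cd P = V \<longrightarrow> arr Q \<longrightarrow> dm Q = V \<longrightarrow> cd Q = Y \<longrightarrow>
      eigval V (P \<star> Q) = ring.list_sum K (\<lambda>(a, b). eigval V (P \<star> b) \<otimes>\<^bsub>K\<^esub> eigval V (a \<star> Q)) xs)"

text \<open>The trace of the operator that composition with \<open>F\<close> induces on Hom(V, Y)
  modulo the radical of the pairing: the \<open>b\<close> span this quotient, and the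
  \<open>a\<close> give coordinates with respect to them.\<close>

definition trace_wrt :: "'o \<Rightarrow> (('o, 'm) arrow \<times> ('o, 'm) arrow) list \<Rightarrow> ('o, 'm) arrow \<Rightarrow> 'k"
  where "trace_wrt V xs F = ring.list_sum K (\<lambda>(a, b). eigval V (a \<star> F \<star> b)) xs"

definition trace :: "'o \<Rightarrow> ('o, 'm) arrow \<Rightarrow> 'k"
  where "trace V F = trace_wrt V (SOME xs. dual_basis V (dm F) xs) F"

definition chi :: "'o \<Rightarrow> 'o \<Rightarrow> 'k"
  where "chi V Y = trace V (idn Y)"

end

locale ks_category = additive_linear_category +
  assumes ac: "algebraically_closed K"
    and hf: "hom_finite K C"
    and ks: "krull_schmidt C"
begin

sublocale K: field K by (rule field)

section \<open>The residue map, traces and multiplicities\<close>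

lemma eigval:
  assumes "local_ob V" "end_arr V F"
  shows "eigval V F \<in> carrier K" "nonunit V (F +\<^sub>a ng (sc (eigval V F) (idn V)))"
proof -
  have "finite_dimensional K (Hom C V V)" using hf locD(1)[OF assms(1)] by (simp add: hom_finite_def)
  then have "\<exists>a. a \<in> carrier K \<and> nonunit V (F +\<^sub>a ng (sc a (idn V)))"
    using ex_eigenvalue[OF ac _ assms] by blast
  then show "eigval V F \<in> carrier K" "nonunit V (F +\<^sub>a ng (sc (eigval V F) (idn V)))"
    unfolding eigval_def by (metis (mono_tags, lifting) someI_ex)+
qed

text \<open>Two different values would present a nonzero scalar, which is invertible, as a
  difference of two nonunits.\<close>

lemma eigval_unique:
  assumes V: "local_ob V" and F: "end_arr V F" and a: "a \<in> carrier K" "nonunit V (F +\<^sub>a ng (sc a (idn V)))"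
  shows "eigval V F = a"
proof (rule ccontr)
  assume ne: "eigval V F \<noteq> a"
  let ?b = "eigval V F"
  note b = eigval[OF V F]
  have [simp]: "V \<in> Ob C" "arr F" "dm F = V" "cd F = V" using F by (auto simp: end_arr_def)
  note [simp] = a(1) b(1)
  have "nonunit V (F +\<^sub>a ng (sc a (idn V)) +\<^sub>a ng (F +\<^sub>a ng (sc ?b (idn V))))"
    using locD(3)[OF V a(2) nonunit_ng[OF V b(2)]] .
  also have "F +\<^sub>a ng (sc a (idn V)) +\<^sub>a ng (F +\<^sub>a ng (sc ?b (idn V)))
      = ng F +\<^sub>a (F +\<^sub>a (sc ?b (idn V) +\<^sub>a ng (sc a (idn V))))"
    by (simp add: pl_assoc pl_comm pl_lcomm del: pl_ng_cancel pl_ng ng_pl)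
  also have "\<dots> = sc (?b \<ominus>\<^bsub>K\<^esub> a) (idn V)"
    by (simp add: ng_sc add_sc K.minus_eq)
  finally have "nonunit V (sc (?b \<ominus>\<^bsub>K\<^esub> a) (idn V))" .
  moreover have "?b \<ominus>\<^bsub>K\<^esub> a \<noteq> \<zero>\<^bsub>K\<^esub>" using ne by (simp add: K.r_right_minus_eq)
  ultimately show False using sc_unit[of V "?b \<ominus>\<^bsub>K\<^esub> a"] by (auto simp: nonunit_def)
qed

lemma eigval_nonunit:
  assumes "local_ob V" "nonunit V F" shows "eigval V F = \<zero>\<^bsub>K\<^esub>"
  using assms locD(1)[OF assms(1)] by (intro eigval_unique) (auto simp: nonunit_def end_arr_def)

lemma eigval_idn:
  assumes "local_ob V" shows "eigval V (idn V) = \<one>\<^bsub>K\<^esub>"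
proof (rule eigval_unique[OF assms])
  have V: "V \<in> Ob C" using locD(1)[OF assms] .
  show "end_arr V (idn V)" using V by (simp add: end_arr_def)
  have "nonunit V (zr V V)" unfolding nonunit_def
  proof (intro conjI notI)
    show "end_arr V (zr V V)" using V by (simp add: end_arr_def)
    assume "\<exists>G. mutual_inv V V (zr V V) G"
    then have "idn V = zr V V" by (auto simp: mutual_inv_def)
    then show False using locD(2)[OF assms] by simp
  qed
  then show "nonunit V (idn V +\<^sub>a ng (sc \<one>\<^bsub>K\<^esub> (idn V)))" using V by simp
qed simp

lemma eigval_add:
  assumes V: "local_ob V" and F: "end_arr V F" and G: "end_arr V G"
  shows "eigval V (F +\<^sub>a G) = eigval V F \<oplus>\<^bsub>K\<^esub> eigval V G"
proof (rule eigval_unique[OF V])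
  have [simp]: "V \<in> Ob C" "arr F" "dm F = V" "cd F = V" "arr G" "dm G = V" "cd G = V"
    using F G by (auto simp: end_arr_def)
  note [simp] = eigval(1)[OF V F] eigval(1)[OF V G]
  show "end_arr V (F +\<^sub>a G)" by (simp add: end_arr_def)
  show "eigval V F \<oplus>\<^bsub>K\<^esub> eigval V G \<in> carrier K" by simp
  have "F +\<^sub>a G +\<^sub>a ng (sc (eigval V F \<oplus>\<^bsub>K\<^esub> eigval V G) (idn V))
    = F +\<^sub>a ng (sc (eigval V F) (idn V)) +\<^sub>a (G +\<^sub>a ng (sc (eigval V G) (idn V)))"
    by (simp add: add_sc pl_assoc pl_lcomm)
  then show "nonunit V (F +\<^sub>a G +\<^sub>a ng (sc (eigval V F \<oplus>\<^bsub>K\<^esub> eigval V G) (idn V)))"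
    using locD(3)[OF V eigval(2)[OF V F] eigval(2)[OF V G]] by simp
qed

lemma eigval_mult:
  assumes V: "local_ob V" and F: "end_arr V F" and G: "end_arr V G"
  shows "eigval V (G \<star> F) = eigval V G \<otimes>\<^bsub>K\<^esub> eigval V F"
proof (rule eigval_unique[OF V])
  have [simp]: "V \<in> Ob C" "arr F" "dm F = V" "cd F = V" "arr G" "dm G = V" "cd G = V"
    using F G by (auto simp: end_arr_def)
  note [simp] = eigval(1)[OF V F] eigval(1)[OF V G]
  show "end_arr V (G \<star> F)" by (simp add: end_arr_def)
  show "eigval V G \<otimes>\<^bsub>K\<^esub> eigval V F \<in> carrier K" by simp
  have n: "nonunit V (G \<star> (F +\<^sub>a ng (sc (eigval V F) (idn V))))"
    using nonunit_cp[OF V _ G, of "F +\<^sub>a ng (sc (eigval V F) (idn V))"] eigval(2)[OF V F] by (simp add: nonunit_def)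
  have n': "nonunit V (sc (eigval V F) (G +\<^sub>a ng (sc (eigval V G) (idn V))))"
    using sc_nonunit[OF V _ eigval(2)[OF V G]] by simp
  \<comment> \<open>With \<open>f\<close> and \<open>g\<close> the eigenvalues of \<open>F\<close>
    and \<open>G\<close>, this is the identity G(F - f) + f(G - g) = GF - gf; both summands on the
    left are nonunits.\<close>
  have "G \<star> (F +\<^sub>a ng (sc (eigval V F) (idn V))) +\<^sub>a sc (eigval V F) (G +\<^sub>a ng (sc (eigval V G) (idn V)))
    = G \<star> F +\<^sub>a ng (sc (eigval V G \<otimes>\<^bsub>K\<^esub> eigval V F) (idn V))"
    by (simp add: sc_pl mult_sc pl_assoc sc_comm[of "eigval V G"])
  then show "nonunit V (G \<star> F +\<^sub>a ng (sc (eigval V G \<otimes>\<^bsub>K\<^esub> eigval V F) (idn V)))"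
    using locD(3)[OF V n n'] by simp
qed

text \<open>Inserting \<open>I \<star> P +\<^sub>a J \<star> Q\<close> between the two factors
  splits the pairing on \<open>B\<close> into the pairings on \<open>M\<close> and
  \<open>N\<close>.\<close>

lemma dual_basis_biprod:
  assumes V: "local_ob V" and b: "biprod M N B I J P Q" and xs: "dual_basis V M xs" and ys: "dual_basis V N ys"
  shows "dual_basis V B (map (\<lambda>(a, b). (a \<star> P, I \<star> b)) xs @ map (\<lambda>(a, b). (a \<star> Q, J \<star> b)) ys)"
    (is "dual_basis V B (?xs @ ?ys)")
proof -
  note [simp] = bipD[OF b]
  have x: "arr (fst x)" "dm (fst x) = M" "cd (fst x) = V" "arr (snd x)" "dm (snd x) = V" "cd (snd x) = M"
    if "x \<in> set xs" for x using xs that unfolding dual_basis_def by (auto simp: case_prod_beta)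
  have y: "arr (fst x)" "dm (fst x) = N" "cd (fst x) = V" "arr (snd x)" "dm (snd x) = V" "cd (snd x) = N"
    if "x \<in> set ys" for x using ys that unfolding dual_basis_def by (auto simp: case_prod_beta)
  have t [simp]: "eigval V (F \<star> G) \<in> carrier K" if "arr F" "arr G" "cd G = dm F" "cd F = V" "dm G = V" for F G
    using eigval(1)[OF V, of "F \<star> G"] that by (simp add: end_arr_def)
  have "eigval V (R \<star> Z) = K.list_sum (\<lambda>(a, b). eigval V (R \<star> b) \<otimes>\<^bsub>K\<^esub> eigval V (a \<star> Z)) (?xs @ ?ys)"
    if [simp]: "arr R" "dm R = B" "cd R = V" "arr Z" "dm Z = V" "cd Z = B" for R Z
  proof -
    have "R \<star> Z = R \<star> (I \<star> P +\<^sub>a J \<star> Q) \<star> Z" by simp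
    also have "\<dots> = (R \<star> I) \<star> (P \<star> Z) +\<^sub>a (R \<star> J) \<star> (Q \<star> Z)" by (simp del: bipD(20)[OF b])
    finally have "eigval V (R \<star> Z) = eigval V ((R \<star> I) \<star> (P \<star> Z)) \<oplus>\<^bsub>K\<^esub> eigval V ((R \<star> J) \<star> (Q \<star> Z))"
      using eigval_add[OF V, of "(R \<star> I) \<star> (P \<star> Z)" "(R \<star> J) \<star> (Q \<star> Z)"] by (simp add: end_arr_def)
    also have "eigval V ((R \<star> I) \<star> (P \<star> Z)) = K.list_sum (\<lambda>(a, b). eigval V (R \<star> b) \<otimes>\<^bsub>K\<^esub> eigval V (a \<star> Z)) ?xs"
    proof -
      have "eigval V ((R \<star> I) \<star> (P \<star> Z)) = K.list_sum (\<lambda>(a, b). eigval V ((R \<star> I) \<star> b) \<otimes>\<^bsub>K\<^esub> eigval V (a \<star> (P \<star> Z))) xs"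
        using xs unfolding dual_basis_def by (auto simp del: cp_assoc)
      then show ?thesis unfolding K.list_sum_map using x by (auto simp: case_prod_beta intro!: K.list_sum_cong)
    qed
    also have "eigval V ((R \<star> J) \<star> (Q \<star> Z)) = K.list_sum (\<lambda>(a, b). eigval V (R \<star> b) \<otimes>\<^bsub>K\<^esub> eigval V (a \<star> Z)) ?ys"
    proof -
      have "eigval V ((R \<star> J) \<star> (Q \<star> Z)) = K.list_sum (\<lambda>(a, b). eigval V ((R \<star> J) \<star> b) \<otimes>\<^bsub>K\<^esub> eigval V (a \<star> (Q \<star> Z))) ys"
        using ys unfolding dual_basis_def by (auto simp del: cp_assoc)
      then show ?thesis unfolding K.list_sum_map using y by (auto simp: case_prod_beta intro!: K.list_sum_cong)
    qed
    also have "K.list_sum (\<lambda>(a, b). eigval V (R \<star> b) \<otimes>\<^bsub>K\<^esub> eigval V (a \<star> Z)) ?xs \<oplus>\<^bsub>K\<^esub>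
        K.list_sum (\<lambda>(a, b). eigval V (R \<star> b) \<otimes>\<^bsub>K\<^esub> eigval V (a \<star> Z)) ?ys =
        K.list_sum (\<lambda>(a, b). eigval V (R \<star> b) \<otimes>\<^bsub>K\<^esub> eigval V (a \<star> Z)) (?xs @ ?ys)"
      using x y by (intro K.list_sum_append[symmetric]) (auto simp: case_prod_beta)
    finally show ?thesis .
  qed
  then show ?thesis using x y unfolding dual_basis_def by (auto simp: case_prod_beta)
qed

text \<open>Multiplicativity of \<open>eigval\<close> makes the pairing on an object isomorphic to
  \<open>V\<close> a product of two linear forms, that is, of rank one.\<close>

lemma dual_basis_mutual_inv:
  assumes V: "local_ob V" and i: "mutual_inv M V F G" shows "dual_basis V M [(F, G)]"
proof -
  note [simp] = isoD[OF i]
  have eq: "eigval V (R \<star> Z) = eigval V (R \<star> G) \<otimes>\<^bsub>K\<^esub> eigval V (F \<star> Z) \<oplus>\<^bsub>K\<^esub> \<zero>\<^bsub>K\<^esub>"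
    if [simp]: "arr R" "dm R = M" "cd R = V" "arr Z" "dm Z = V" "cd Z = M" for R Z
  proof -
    have "R \<star> Z = (R \<star> G) \<star> (F \<star> Z)" by (simp add: cp_reassoc[of G F])
    moreover have "end_arr V (R \<star> G)" "end_arr V (F \<star> Z)" by (auto simp: end_arr_def)
    ultimately show ?thesis using eigval_mult[OF V, of "F \<star> Z" "R \<star> G"] eigval(1)[OF V] by simp
  qed
  show ?thesis unfolding dual_basis_def
  proof (intro conjI allI impI)
    fix R Z assume "arr R" "dm R = M" "cd R = V" "arr Z" "dm Z = V" "cd Z = M"
    from eq[OF this] show "eigval V (R \<star> Z) =
        K.list_sum (\<lambda>(a, b). eigval V (R \<star> b) \<otimes>\<^bsub>K\<^esub> eigval V (a \<star> Z)) [(F, G)]" by simp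
  qed simp
qed

text \<open>An invertible composite through \<open>M\<close> would make \<open>M\<close> isomorphic
  to \<open>V\<close>. Hence the pairing vanishes and the empty list is a dual basis.\<close>

lemma dual_basis_noniso:
  assumes V: "local_ob V" and M: "local_ob M" and n: "\<nexists>F G. mutual_inv M V F G"
  shows "dual_basis V M []"
proof -
  have "eigval V (R \<star> Z) = \<zero>\<^bsub>K\<^esub>"
    if "arr R" "dm R = M" "cd R = V" "arr Z" "dm Z = V" "cd Z = M" for R Z
  proof (rule eigval_nonunit[OF V])
    have "\<nexists>H. mutual_inv V V (R \<star> Z) H"
      using local_factor_mutual_inv(2)[OF V M, of Z R] that n by blast
    then show "nonunit V (R \<star> Z)" using that by (simp add: nonunit_def end_arr_def)
  qed
  then show ?thesis unfolding dual_basis_def by simp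
qed

lemma dual_basis_zero:
  assumes V: "local_ob V" and Z: "is_zero_object C Z"
  shows "dual_basis V Z []"
proof -
  have "eigval V (R \<star> Y) = \<zero>\<^bsub>K\<^esub>"
    if [simp]: "arr R" "dm R = Z" "cd R = V" "arr Y" "dm Y = V" "cd Y = Z" for R Y
  proof (rule eigval_nonunit[OF V])
    have "R = zr Z V" using zero_objectD(2)[OF Z, of R] by simp
    then have z: "R \<star> Y = zr V V" using locD(1)[OF V] by simp
    have "\<nexists>H. mutual_inv V V (zr V V) H" using locD(2)[OF V] by (auto simp: mutual_inv_def)
    then show "nonunit V (R \<star> Y)" unfolding z using locD(1)[OF V] by (simp add: nonunit_def end_arr_def)
  qed
  then show ?thesis unfolding dual_basis_def by simp
qed

lemma ex_dual_basis:
  assumes V: "local_ob V" and "Y \<in> Ob C" shows "\<exists>xs. dual_basis V Y xs"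
proof -
  obtain Ms where Ms: "is_direct_sum C Ms Y" "\<forall>N \<in> set Ms. local_ring (End_ring C N)"
    using ks assms(2) unfolding krull_schmidt_def by blast
  show ?thesis using Ms(1)
  proof (induction rule: direct_sum_induct)
    case (zero Z)
    then show ?case using dual_basis_zero[OF V] by blast
  next
    case (biprod M B' B I J P Q)
    then have "local_ob M" using Ms(2) by (auto simp: local_ob_def biprod_def)
    then have "\<exists>xs. dual_basis V M xs" using dual_basis_mutual_inv[OF V] dual_basis_noniso[OF V] by blast
    then show ?case using biprod dual_basis_biprod[OF V] by blast
  qed
qed

text \<open>On the left the pairing at \<open>W\<close> is expanded by \<open>ys\<close>, on the
  right the pairing at \<open>Y\<close> by \<open>xs\<close>, and the same double sum results. With
  an identity in place of one morphism, this also shows that traces do not depend on the dual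
  basis.\<close>

lemma trace_wrt_comm:
  assumes V: "local_ob V" and xs: "dual_basis V Y xs" and ys: "dual_basis V W ys"
    and F: "arr F" "dm F = Y" "cd F = W" and G: "arr G" "dm G = W" "cd G = Y"
  shows "trace_wrt V xs (G \<star> F) = trace_wrt V ys (F \<star> G)"
proof -
  note [simp] = F G
  have x [simp]: "arr (fst x)" "dm (fst x) = Y" "cd (fst x) = V" "arr (snd x)" "dm (snd x) = V" "cd (snd x) = Y"
    if "x \<in> set xs" for x using xs that unfolding dual_basis_def by (auto simp: case_prod_beta)
  have y [simp]: "arr (fst x)" "dm (fst x) = W" "cd (fst x) = V" "arr (snd x)" "dm (snd x) = V" "cd (snd x) = W"
    if "x \<in> set ys" for x using ys that unfolding dual_basis_def by (auto simp: case_prod_beta)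
  have t [simp]: "eigval V (F \<star> G) \<in> carrier K" if "arr F" "arr G" "cd G = dm F" "cd F = V" "dm G = V" for F G
    using eigval(1)[OF V, of "F \<star> G"] that by (simp add: end_arr_def)
  have "trace_wrt V xs (G \<star> F) = K.list_sum (\<lambda>x. K.list_sum (\<lambda>y. eigval V (fst x \<star> G \<star> snd y) \<otimes>\<^bsub>K\<^esub> eigval V (fst y \<star> F \<star> snd x)) ys) xs"
    unfolding trace_wrt_def case_prod_beta
  proof (rule K.list_sum_cong)
    fix x assume "x \<in> set xs"
    note [simp] = x[OF this]
    have "eigval V ((fst x \<star> G) \<star> (F \<star> snd x)) =
        K.list_sum (\<lambda>(a, b). eigval V ((fst x \<star> G) \<star> b) \<otimes>\<^bsub>K\<^esub> eigval V (a \<star> (F \<star> snd x))) ys"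
      using ys unfolding dual_basis_def by (auto simp del: cp_assoc)
    also have "\<dots> = K.list_sum (\<lambda>y. eigval V (fst x \<star> G \<star> snd y) \<otimes>\<^bsub>K\<^esub> eigval V (fst y \<star> F \<star> snd x)) ys"
      by (rule K.list_sum_cong) (simp add: case_prod_beta)
    finally show "eigval V (fst x \<star> (G \<star> F) \<star> snd x) =
      K.list_sum (\<lambda>y. eigval V (fst x \<star> G \<star> snd y) \<otimes>\<^bsub>K\<^esub> eigval V (fst y \<star> F \<star> snd x)) ys" by simp
  qed
  also have "\<dots> = K.list_sum (\<lambda>y. K.list_sum (\<lambda>x. eigval V (fst x \<star> G \<star> snd y) \<otimes>\<^bsub>K\<^esub> eigval V (fst y \<star> F \<star> snd x)) xs) ys"
    by (rule K.list_sum_swap) simp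
  also have "\<dots> = trace_wrt V ys (F \<star> G)"
    unfolding trace_wrt_def case_prod_beta
  proof (rule K.list_sum_cong)
    fix y assume "y \<in> set ys"
    note [simp] = y[OF this]
    have "eigval V ((fst y \<star> F) \<star> (G \<star> snd y)) =
        K.list_sum (\<lambda>(a, b). eigval V ((fst y \<star> F) \<star> b) \<otimes>\<^bsub>K\<^esub> eigval V (a \<star> (G \<star> snd y))) xs"
      using xs unfolding dual_basis_def by (auto simp del: cp_assoc)
    also have "\<dots> = K.list_sum (\<lambda>x. eigval V (fst x \<star> G \<star> snd y) \<otimes>\<^bsub>K\<^esub> eigval V (fst y \<star> F \<star> snd x)) xs"
      by (rule K.list_sum_cong) (simp add: case_prod_beta K.m_comm)
    finally show "K.list_sum (\<lambda>x. eigval V (fst x \<star> G \<star> snd y) \<otimes>\<^bsub>K\<^esub> eigval V (fst y \<star> F \<star> snd x)) xs =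
      eigval V (fst y \<star> (F \<star> G) \<star> snd y)" by simp
  qed
  finally show ?thesis .
qed

lemma trace_wrt_trace:
  assumes V: "local_ob V" and xs: "dual_basis V Y xs" and F: "end_arr Y F"
  shows "trace_wrt V xs F = trace V F"
proof -
  have [simp]: "arr F" "dm F = Y" "cd F = Y" "Y \<in> Ob C" using F by (auto simp: end_arr_def)
  have "dual_basis V Y (SOME xs. dual_basis V Y xs)" using xs by (rule someI)
  from trace_wrt_comm[OF V xs this, of F "idn Y"] show ?thesis by (simp add: trace_def)
qed

lemma trace_comm:
  assumes V: "local_ob V" and F: "arr F" "arr G" "dm F = cd G" "cd F = dm G"
  shows "trace V (G \<star> F) = trace V (F \<star> G)"
proof -
  obtain xs ys where "dual_basis V (dm F) xs" "dual_basis V (cd F) ys"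
    using ex_dual_basis[OF V] F by (metis arr_Ob)
  note b = this
  have "trace_wrt V xs (G \<star> F) = trace V (G \<star> F)" by (rule trace_wrt_trace[OF V b(1)]) (simp add: end_arr_def F)
  moreover have "trace_wrt V ys (F \<star> G) = trace V (F \<star> G)" by (rule trace_wrt_trace[OF V b(2)]) (simp add: end_arr_def F)
  moreover have "trace_wrt V xs (G \<star> F) = trace_wrt V ys (F \<star> G)" by (rule trace_wrt_comm[OF V b]) (simp_all add: F)
  ultimately show ?thesis by simp
qed

lemma trace_closed [simp]:
  assumes V: "local_ob V" and F: "end_arr Y F"
  shows "trace V F \<in> carrier K"
proof -
  have [simp]: "arr F" "dm F = Y" "cd F = Y" "Y \<in> Ob C" using F by (auto simp: end_arr_def)
  obtain xs where xs: "dual_basis V Y xs" using ex_dual_basis[OF V, of Y] by auto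
  have "trace_wrt V xs F \<in> carrier K" unfolding trace_wrt_def
    using xs by (intro K.list_sum_closed) (auto simp: dual_basis_def end_arr_def intro!: eigval(1)[OF V])
  then show ?thesis using trace_wrt_trace[OF V xs F] by simp
qed

lemma trace_add:
  assumes V: "local_ob V" and F: "end_arr Y F" and G: "end_arr Y G"
  shows "trace V (F +\<^sub>a G) = trace V F \<oplus>\<^bsub>K\<^esub> trace V G"
proof -
  have [simp]: "arr F" "dm F = Y" "cd F = Y" "Y \<in> Ob C" "arr G" "dm G = Y" "cd G = Y"
    using F G by (auto simp: end_arr_def)
  obtain xs where xs: "dual_basis V Y xs" using ex_dual_basis[OF V, of Y] by auto
  have x: "arr (fst x)" "dm (fst x) = Y" "cd (fst x) = V" "arr (snd x)" "dm (snd x) = V" "cd (snd x) = Y"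
    if "x \<in> set xs" for x using xs that unfolding dual_basis_def by (auto simp: case_prod_beta)
  have "trace_wrt V xs (F +\<^sub>a G) = K.list_sum (\<lambda>x. eigval V (fst x \<star> F \<star> snd x) \<oplus>\<^bsub>K\<^esub> eigval V (fst x \<star> G \<star> snd x)) xs"
    unfolding trace_wrt_def case_prod_beta using x
    by (intro K.list_sum_cong) (simp add: eigval_add[OF V] end_arr_def)
  also have "\<dots> = trace_wrt V xs F \<oplus>\<^bsub>K\<^esub> trace_wrt V xs G"
    unfolding trace_wrt_def case_prod_beta using x
    by (intro K.list_sum_add) (auto simp: end_arr_def intro!: eigval(1)[OF V])
  finally show ?thesis using trace_wrt_trace[OF V xs] F G by (simp add: end_arr_def)
qed

lemma chi_closed [simp]: "local_ob V \<Longrightarrow> Y \<in> Ob C \<Longrightarrow> chi V Y \<in> carrier K"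
  unfolding chi_def by (rule trace_closed) (auto simp: end_arr_def)

text \<open>By cyclicity the idempotents \<open>I \<star> P\<close> and \<open>J \<star> Q\<close>
  have the same traces as the identities of \<open>M\<close> and \<open>N\<close>.\<close>

lemma chi_biprod:
  assumes V: "local_ob V" and b: "biprod M N B I J P Q"
  shows "chi V B = chi V M \<oplus>\<^bsub>K\<^esub> chi V N"
proof -
  note [simp] = bipD[OF b]
  have "chi V B = trace V (I \<star> P +\<^sub>a J \<star> Q)" by (simp add: chi_def)
  also have "\<dots> = trace V (I \<star> P) \<oplus>\<^bsub>K\<^esub> trace V (J \<star> Q)"
    by (rule trace_add[OF V]) (auto simp: end_arr_def)
  also have "trace V (I \<star> P) = chi V M" using trace_comm[OF V, of P I] by (simp add: chi_def)
  also have "trace V (J \<star> Q) = chi V N" using trace_comm[OF V, of Q J] by (simp add: chi_def)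
  finally show ?thesis .
qed

lemma chi_self:
  assumes V: "local_ob V" shows "chi V V = \<one>\<^bsub>K\<^esub>"
proof -
  have V': "V \<in> Ob C" using locD(1)[OF V] .
  have "trace_wrt V [(idn V, idn V)] (idn V) = \<one>\<^bsub>K\<^esub>" using V' eigval_idn[OF V] by (simp add: trace_wrt_def)
  then show ?thesis unfolding chi_def
    using trace_wrt_trace[OF V dual_basis_mutual_inv[OF V mutual_inv_refl[OF V']], of "idn V"] V' by (simp add: end_arr_def)
qed

lemma chi_noniso:
  assumes "local_ob V" "local_ob M" "\<nexists>F G. mutual_inv M V F G" shows "chi V M = \<zero>\<^bsub>K\<^esub>"
  using trace_wrt_trace[OF assms(1) dual_basis_noniso[OF assms], of "idn M"] locD(1)[OF assms(2)]
  by (simp add: chi_def trace_wrt_def end_arr_def)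

lemma chi_zero:
  assumes "local_ob V" "is_zero_object C Z" shows "chi V Z = \<zero>\<^bsub>K\<^esub>"
  using trace_wrt_trace[OF assms(1) dual_basis_zero[OF assms], of "idn Z"] zero_objectD(1)[OF assms(2)]
  by (simp add: chi_def trace_wrt_def end_arr_def)

end

context linear_category
begin

section \<open>Retracts of direct sums\<close>

text \<open>The ideal of morphisms generated by \<open>idn T\<close>. Generating it inductively
  avoids naming the sum of copies of \<open>T\<close> through which a morphism factors.\<close>

inductive factors :: "'o \<Rightarrow> ('o, 'm) arrow \<Rightarrow> bool" for T
  where zero: "M \<in> Ob C \<Longrightarrow> N \<in> Ob C \<Longrightarrow> factors T (zr M N)"
  | add: "factors T F \<Longrightarrow> factors T G \<Longrightarrow> dm F = dm G \<Longrightarrow> cd F = cd G \<Longrightarrow> factors T (F +\<^sub>a G)"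
  | comp: "arr F \<Longrightarrow> arr G \<Longrightarrow> cd F = T \<Longrightarrow> dm G = T \<Longrightarrow> factors T (G \<star> F)"

lemma factors_arr: "factors T F \<Longrightarrow> arr F"
  by (induction rule: factors.induct) auto

lemma factors_left: "factors T F \<Longrightarrow> arr H \<Longrightarrow> dm H = cd F \<Longrightarrow> factors T (H \<star> F)"
proof (induction rule: factors.induct)
  case (add F G)
  then show ?case using factors_arr factors.add[of T "H \<star> F" "H \<star> G"] by simp
next
  case (comp F G)
  then show ?case using factors.comp[of F "H \<star> G" T] by simp
qed (auto intro: factors.zero)

lemma factors_right: "factors T F \<Longrightarrow> arr H \<Longrightarrow> cd H = dm F \<Longrightarrow> factors T (F \<star> H)"
proof (induction rule: factors.induct)
  case (add F G)
  then show ?case using factors_arr factors.add[of T "F \<star> H" "G \<star> H"] by simp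
next
  case (comp F G)
  then show ?case using factors.comp[of "F \<star> H" G T] by simp
qed (auto intro: factors.zero)

text \<open>The retract closure of the sums of copies of \<open>T\<close>, expressed by a factorization of the identity so
  that closure under direct sums needs no splitting of idempotents.\<close>

definition retract_of :: "'o \<Rightarrow> 'o \<Rightarrow> bool"
  where "retract_of T M \<longleftrightarrow> M \<in> Ob C \<and> factors T (idn M)"

lemma retract_of_Ob: "retract_of T M \<Longrightarrow> M \<in> Ob C"
  by (simp add: retract_of_def)

lemma retract_of_self: "T \<in> Ob C \<Longrightarrow> retract_of T T"
  using factors.comp[of "idn T" "idn T" T] by (simp add: retract_of_def)

lemma retract_of_zero: "is_zero_object C Z \<Longrightarrow> retract_of T Z"
  using zero_object_idn factors.zero[of Z Z T] by (simp add: retract_of_def)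

lemma retract_of_biprod:
  assumes b: "biprod M N B I J P Q" and "retract_of T M" "retract_of T N"
  shows "retract_of T B"
proof -
  note [simp] = bipD[OF b]
  have "factors T (I \<star> idn M \<star> P +\<^sub>a J \<star> idn N \<star> Q)"
    using assms(2,3) unfolding retract_of_def by (intro factors.add factors_left factors_right) auto
  then show ?thesis by (simp add: retract_of_def)
qed

lemma retract_of_retract:
  assumes "retract_of T B" "arr F" "dm F = M" "cd F = B" "arr G" "dm G = B" "cd G = M" "G \<star> F = idn M"
  shows "retract_of T M"
proof -
  have "M \<in> Ob C" using assms by auto
  moreover have "factors T (G \<star> idn B \<star> F)"
    using assms unfolding retract_of_def by (intro factors_left factors_right) auto
  ultimately show ?thesis using assms by (simp add: retract_of_def)
qed

lemma retract_of_summand: "biprod M N B I J P Q \<Longrightarrow> retract_of T B \<Longrightarrow> retract_of T M"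
  by (rule retract_of_retract[of T B I M P]) (simp_all add: bipD)

lemma retract_of_mutual_inv: "mutual_inv M N F G \<Longrightarrow> retract_of T N \<Longrightarrow> retract_of T M"
  by (rule retract_of_retract[of T N F M G]) (simp_all add: isoD)

lemma nonunit_zr: "local_ob V \<Longrightarrow> nonunit V (zr V V)"
  using locD(1,2)[of V] by (auto simp: nonunit_def end_arr_def mutual_inv_def)

text \<open>Of the two complementary idempotents one is invertible in the local ring. Since their
  product is zero, the other one vanishes, and with it the identity of its summand.\<close>

lemma local_ob_indecomposable:
  assumes V: "local_ob V" shows "indecomposable C V"
  unfolding indecomposable_def
proof (intro conjI allI impI)
  note [simp] = locD(1)[OF V]
  show "V \<in> Ob C" by simp
  show "\<not> is_zero_object C V" using locD(2)[OF V] by (simp add: zero_object_idn)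
  have z: "is_zero_object C N" if b: "biprod M N V I J P Q" and i: "mutual_inv V V (I \<star> P) H" for M N I J P Q H
  proof -
    note [simp] = bipD[OF b] isoD(3-8)[OF i] biprod_reassoc[OF b]
    have "J \<star> Q = (H \<star> (I \<star> P)) \<star> (J \<star> Q)" by (subst isoD(9)[OF i]) simp
    also have "\<dots> = zr V V" by (simp del: isoD(9))
    finally have "Q \<star> (J \<star> Q) \<star> J = Q \<star> zr V V \<star> J" by simp
    then show ?thesis by (simp add: zero_object_idn)
  qed
  fix M N i j p q assume "is_biproduct C M N V i j p q"
  then obtain I J P Q where b: "biprod M N V I J P Q" by (auto simp: biprod_ar)
  note [simp] = bipD[OF b]
  have "\<not> (nonunit V (I \<star> P) \<and> nonunit V (J \<star> Q))"
    using locD(3)[OF V, of "I \<star> P" "J \<star> Q"] mutual_inv_refl[of V] by (auto simp: nonunit_def)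
  then consider H where "mutual_inv V V (I \<star> P) H" | H where "mutual_inv V V (J \<star> Q) H"
    by (auto simp: nonunit_def end_arr_def)
  then show "is_zero_object C M \<or> is_zero_object C N"
    using z[OF b] z[OF biprod_swap[OF b]] by cases blast+
qed

end

context additive_linear_category
begin

lemma add_closure_retract_of:
  assumes "T \<in> Ob C" "M \<in> add_closure C T" shows "retract_of T M"
proof -
  obtain n B where B: "is_direct_sum C (replicate n T) B" and "is_summand C M B"
    using assms(2) by (auto simp: add_closure_def)
  then obtain N I J P Q where b: "biprod M N B I J P Q" by (auto simp: is_summand_def biprod_ar)
  have "retract_of T B" using B
    by (induction rule: direct_sum_induct) (use retract_of_zero retract_of_biprod retract_of_self[OF assms(1)] in \<open>auto 0 3\<close>)
  then show ?thesis using retract_of_summand[OF b] by blast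
qed

lemma summand_add_closure:
  assumes b: "biprod M N T I J P Q" shows "M \<in> add_closure C T"
proof -
  obtain Z where Z: "is_zero_object C Z" using zero_object by blast
  have "dsum [] Z I P" for I P using Z by (simp add: dsum_Nil)
  from biprod_dsum[OF zero_biprod[OF Z mutual_inv_refl[of T]] this] bipD(3)[OF b]
  have "is_direct_sum C [T] T" by (auto intro: dsum_direct_sum)
  moreover have "is_summand C M T" unfolding is_summand_def using biprod_mp[OF b] by blast
  ultimately show ?thesis unfolding add_closure_def by (auto intro!: exI[of _ 1] exI[of _ T])
qed

lemma nonunit_direct_sum:
  assumes M: "local_ob M" and B: "is_direct_sum C Ms B"
    and n: "\<And>N F G. N \<in> set Ms \<Longrightarrow> arr F \<Longrightarrow> dm F = M \<Longrightarrow> cd F = N \<Longrightarrow>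
      arr G \<Longrightarrow> dm G = N \<Longrightarrow> cd G = M \<Longrightarrow> nonunit M (G \<star> F)"
    and F: "arr F" "dm F = M" "cd F = B" and G: "arr G" "dm G = B" "cd G = M"
  shows "nonunit M (G \<star> F)"
  using B F G
proof (induction arbitrary: F G rule: direct_sum_induct)
  case (zero Z)
  have "F = zr M Z" using zero_objectD(3)[OF zero(1), of F] zero by simp
  then have "G \<star> F = zr M M" using zero(5-7) locD(1)[OF M] by simp
  then show ?case using nonunit_zr[OF M] by simp
next
  case (biprod L B' B I J P Q)
  note [simp] = bipD[OF biprod(2)] biprod(4-9)
  have "nonunit M ((G \<star> I) \<star> (P \<star> F))" "nonunit M ((G \<star> J) \<star> (Q \<star> F))"
    by (rule n[OF biprod(1)] biprod(3); simp)+
  then have "nonunit M ((G \<star> I) \<star> (P \<star> F) +\<^sub>a (G \<star> J) \<star> (Q \<star> F))"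
    using locD(3)[OF M] by blast
  also have "(G \<star> I) \<star> (P \<star> F) +\<^sub>a (G \<star> J) \<star> (Q \<star> F) = G \<star> (I \<star> P +\<^sub>a J \<star> Q) \<star> F"
    by (simp del: bipD(20)[OF biprod(2)])
  also have "\<dots> = G \<star> F" by simp
  finally show ?case .
qed

text \<open>If no summand of \<open>T\<close> were isomorphic to \<open>M\<close>, every composite
  from \<open>M\<close> through a summand and back would be a nonunit, hence so would every sum of
  composites through \<open>T\<close>, in particular \<open>idn M\<close>. This is the only
  comparison of indecomposables with a decomposition that the counting uses.\<close>

lemma retract_of_local_mutual_inv:
  assumes M: "local_ob M" and r: "retract_of T M" and T: "is_direct_sum C Ns T" and Ns: "\<And>N. N \<in> set Ns \<Longrightarrow> local_ob N"
  shows "\<exists>N\<in>set Ns. \<exists>F G. mutual_inv M N F G"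
proof (rule ccontr)
  assume n: "\<not> ?thesis"
  have nu: "nonunit M (G \<star> F)" if "N \<in> set Ns" "arr F" "dm F = M" "cd F = N" "arr G" "dm G = N" "cd G = M" for N F G
  proof (rule ccontr)
    assume "\<not> nonunit M (G \<star> F)"
    then obtain H where "mutual_inv M M (G \<star> F) H"
      using \<open>arr F\<close> \<open>dm F = M\<close> \<open>cd F = N\<close> \<open>arr G\<close> \<open>dm G = N\<close> \<open>cd G = M\<close>
      by (auto simp: nonunit_def end_arr_def)
    then show False using local_factor_mutual_inv(1)[OF M Ns[OF that(1)] that(2-7)] n that(1) by blast
  qed
  have d: "nonunit M (G \<star> F)"
    if "arr F" "dm F = M" "cd F = T" "arr G" "dm G = T" "cd G = M" for F G
    by (rule nonunit_direct_sum[OF M T _ that]) (rule nu)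
  have "nonunit M F" if "factors T F" "dm F = M" "cd F = M" for F
    using that
  proof (induction rule: factors.induct)
    case (zero M' N)
    then show ?case using nonunit_zr[OF M] by simp
  next
    case (add F G)
    then show ?case using locD(3)[OF M] by simp
  next
    case (comp F G)
    then show ?case by (intro d) simp_all
  qed
  then have "nonunit M (idn M)" using r by (simp add: retract_of_def)
  then show False using mutual_inv_refl[OF locD(1)[OF M]] by (auto simp: nonunit_def)
qed

end

section \<open>Indecomposable objects and their representatives\<close>

context ks_category
begin

lemma ks_local_ob:
  assumes "M \<in> Ob C"
  obtains Ns where "is_direct_sum C Ns M" "\<And>N. N \<in> set Ns \<Longrightarrow> local_ob N"
proof -
  obtain Ms where "is_direct_sum C Ms M" "\<forall>N \<in> set Ms. local_ring (End_ring C N)"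
    using ks assms unfolding krull_schmidt_def by blast
  moreover from this have "set Ms \<subseteq> Ob C" by (simp add: is_direct_sum_def)
  ultimately show ?thesis using that[of Ms] by (auto simp: local_ob_def)
qed

text \<open>A decomposition into local objects is not empty, since \<open>V\<close> is nonzero;
  peeling off its first member leaves a zero complement, so the inclusion of that member is an
  isomorphism.\<close>

lemma indecomposable_local_ob:
  assumes V: "indecomposable C V" shows "\<exists>M F G. local_ob M \<and> mutual_inv M V F G"
proof -
  have "V \<in> Ob C" "\<not> is_zero_object C V" using V by (auto simp: indecomposable_def)
  then obtain Ns where Ns: "is_direct_sum C Ns V" "\<And>N. N \<in> set Ns \<Longrightarrow> local_ob N" using ks_local_ob by blast
  show ?thesis
  proof (cases Ns)
    case Nil
    then show ?thesis using Ns direct_sum_Nil \<open>\<not> is_zero_object C V\<close> by blast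
  next
    case (Cons M Ms)
    then have "is_direct_sum C (M # Ms) V" using Ns(1) by simp
    then obtain B' I J P Q where "is_direct_sum C Ms B'" and b: "biprod M B' V I J P Q"
      by (rule direct_sum_cons)
    have M: "local_ob M" using Ns Cons by simp
    then have "\<not> is_zero_object C M" using locD(2) by (simp add: zero_object_idn)
    then have z: "is_zero_object C B'" using V biprod_mp[OF b] unfolding indecomposable_def by blast
    note [simp] = bipD[OF b]
    have "J = zr B' V" using zero_objectD(2)[OF z, of J] by simp
    then have "J \<star> Q = zr V V" by simp
    then have "I \<star> P = idn V" using bipD(20)[OF b] by (simp del: bipD(20)[OF b])
    then have "mutual_inv M V I P" by (simp add: mutual_inv_def)
    then show ?thesis using M by blast
  qed
qed

text \<open>Each isomorphism class meets the finite list \<open>Ns\<close> of local summands of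
  \<open>T\<close>. Picking the representatives there gives finiteness of the set of classes and, at
  the same time, representatives with local endomorphism ring, at which traces are
  available.\<close>

lemma indec_representatives:
  assumes T: "T \<in> Ob C"
  obtains R where "finite (indec_classes C (add_closure C T))" "finite R"
    "card R = card (indec_classes C (add_closure C T))"
    "\<And>M. M \<in> R \<Longrightarrow> local_ob M \<and> retract_of T M"
    "\<And>M N F G. M \<in> R \<Longrightarrow> N \<in> R \<Longrightarrow> mutual_inv M N F G \<Longrightarrow> M = N"
    "\<And>M. local_ob M \<Longrightarrow> retract_of T M \<Longrightarrow> \<exists>N\<in>R. \<exists>F G. mutual_inv M N F G"
proof -
  obtain Ns where Ns: "is_direct_sum C Ns T" "\<And>N. N \<in> set Ns \<Longrightarrow> local_ob N" using ks_local_ob[OF T] by blast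
  let ?I = "{M \<in> add_closure C T. indecomposable C M}"
  let ?rel = "{(M, N). M \<in> add_closure C T \<and> indecomposable C M \<and> N \<in> add_closure C T \<and>
    indecomposable C N \<and> isomorphic C M N}"
  let ?Q = "indec_classes C (add_closure C T)"
  have Q: "?Q = ?I // ?rel" by (simp add: indec_classes_def)
  have Ob: "M \<in> Ob C" if "M \<in> ?I" for M using that by (simp add: indecomposable_def)
  have rel: "(M, N) \<in> ?rel \<longleftrightarrow> M \<in> ?I \<and> N \<in> ?I \<and> (\<exists>F G. mutual_inv M N F G)" for M N
    using isomorphic_iff[of M N] Ob by auto
  have eq: "equiv ?I ?rel"
  proof (intro equivI refl_onI symI transI)
    show "?rel \<subseteq> ?I \<times> ?I" by auto
    show "(M, M) \<in> ?rel" if "M \<in> ?I" for M using that mutual_inv_refl[OF Ob[OF that]] unfolding rel by blast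
    show "(N, M) \<in> ?rel" if "(M, N) \<in> ?rel" for M N using that mutual_inv_sym unfolding rel by blast
    show "(M, L) \<in> ?rel" if "(M, N) \<in> ?rel" "(N, L) \<in> ?rel" for M N L
      using that mutual_inv_trans unfolding rel by blast
  qed
  have NI: "N \<in> ?I" "retract_of T N" if N: "N \<in> set Ns" for N
  proof -
    obtain B I J P Q where b: "biprod N B T I J P Q" using direct_sum_summand[OF Ns(1) N] by blast
    then show "N \<in> ?I" using summand_add_closure local_ob_indecomposable[OF Ns(2)[OF N]] by blast
    show "retract_of T N" using retract_of_summand[OF b retract_of_self[OF T]] .
  qed
  have ex: "\<exists>N. N \<in> set Ns \<and> N \<in> c" if c: "c \<in> ?Q" for c
  proof -
    obtain M where M: "M \<in> ?I" "c = ?rel `` {M}" using c unfolding Q by (blast elim: quotientE)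
    obtain L F G where L: "local_ob L" "mutual_inv L M F G" using indecomposable_local_ob M by blast
    have "retract_of T L" using retract_of_mutual_inv[OF L(2)] add_closure_retract_of[OF T] M by blast
    then obtain N F' G' where N: "N \<in> set Ns" "mutual_inv L N F' G'" using retract_of_local_mutual_inv[OF L(1) _ Ns] by blast
    then have "(M, N) \<in> ?rel" using M NI(1)[OF N(1)] mutual_inv_trans[OF mutual_inv_sym[OF L(2)] N(2)] unfolding rel by blast
    then show ?thesis using N(1) M(2) by blast
  qed
  define r where "r c = (SOME N. N \<in> set Ns \<and> N \<in> c)" for c
  have r: "r c \<in> set Ns" "r c \<in> c" if "c \<in> ?Q" for c
    using someI_ex[OF ex[OF that]] by (auto simp: r_def)
  have same: "c = c'" if "c \<in> ?Q" "c' \<in> ?Q" "mutual_inv (r c) (r c') F G" for c c' F G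
  proof -
    have "(r c, r c') \<in> ?rel" using NI(1)[OF r(1)] that unfolding rel by blast
    then show ?thesis using quotient_eq_iff[OF eq] r(2) that unfolding Q by blast
  qed
  have inj: "inj_on r ?Q"
    using same mutual_inv_refl NI(1)[OF r(1)] Ob by (intro inj_onI) metis
  have fin: "finite ?Q"
    by (rule inj_on_finite[OF inj, of "set Ns"]) (use r in auto)
  show thesis
  proof (rule that[of "r ` ?Q"])
    show "finite ?Q" "finite (r ` ?Q)" using fin by auto
    show "card (r ` ?Q) = card ?Q" using inj by (rule card_image)
    show "local_ob M \<and> retract_of T M" if "M \<in> r ` ?Q" for M using that r NI Ns by blast
    show "M = N" if "M \<in> r ` ?Q" "N \<in> r ` ?Q" "mutual_inv M N F G" for M N F G using that same by blast
    show "\<exists>N\<in>r ` ?Q. \<exists>F G. mutual_inv M N F G" if M: "local_ob M" "retract_of T M" for M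
    proof -
      obtain N F G where N: "N \<in> set Ns" "mutual_inv M N F G" using retract_of_local_mutual_inv[OF M Ns] by blast
      let ?c = "?rel `` {N}"
      have c: "?c \<in> ?Q" unfolding Q using NI(1)[OF N(1)] by (rule quotientI)
      then have "(N, r ?c) \<in> ?rel" using r(2) by blast
      then obtain F' G' where "mutual_inv N (r ?c) F' G'" unfolding rel by blast
      then show ?thesis using c mutual_inv_trans[OF N(2)] by blast
    qed
  qed
qed

end

section \<open>Angles\<close>

lemma wrap_nth: "i \<le> length xs \<Longrightarrow> xs \<noteq> [] \<Longrightarrow> wrap f xs ! i = (if i < length xs then xs ! i else f (xs ! 0))"
  by (auto simp: wrap_def nth_append hd_conv_nth)

lemma wrap_map_nth:
  "i \<le> Suc (Suc d) \<Longrightarrow> wrap f (map g [0..<Suc (Suc d)]) ! i = (if i \<le> Suc d then g i else f (g 0))"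
  by (subst wrap_nth) (auto simp del: upt_Suc)

context angulated_category
begin

definition S_arr :: "('o, 'm) arrow \<Rightarrow> ('o, 'm) arrow"
  where "S_arr F = ar (fob S (dm F)) (fmor S (mp F)) (fob S (cd F))"

lemma S_functor: "is_functor C S"
  using automorphism by (simp add: is_additive_automorphism_def)

lemma S_Ob [simp]: "M \<in> Ob C \<Longrightarrow> fob S M \<in> Ob C"
  using S_functor by (simp add: is_functor_def)

lemma S_surj:
  assumes "N \<in> Ob C" shows "\<exists>M\<in>Ob C. fob S M = N"
proof -
  have "fob S ` Ob C = Ob C" using automorphism by (simp add: is_additive_automorphism_def bij_betw_def)
  then show ?thesis using assms by (metis imageE)
qed

lemma dm_S_arr [simp]: "dm (S_arr F) = fob S (dm F)" "cd (S_arr F) = fob S (cd F)" "mp (S_arr F) = fmor S (mp F)"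
  by (simp_all add: S_arr_def)

lemma fmor_bij: "M \<in> Ob C \<Longrightarrow> N \<in> Ob C \<Longrightarrow> bij_betw (fmor S) (mor C M N) (mor C (fob S M) (fob S N))"
  using automorphism by (simp add: is_additive_automorphism_def)

lemma arr_S_arr [simp]: "arr F \<Longrightarrow> arr (S_arr F)"
  using fmor_bij[of "dm F" "cd F"] S_Ob unfolding arr_def bij_betw_def by auto

lemma S_arr_inj:
  assumes "arr F" "arr G" "dm F = dm G" "cd F = cd G" "S_arr F = S_arr G" shows "F = G"
proof (rule arrow_eqI)
  have "mp F \<in> mor C (dm F) (cd F)" "mp G \<in> mor C (dm F) (cd F)"
    using assms by (simp_all add: arr_def del: arr_Ob)
  moreover have "fmor S (mp F) = fmor S (mp G)" using assms(5) by (simp add: S_arr_def)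
  ultimately show "mp F = mp G"
    using fmor_bij[of "dm F" "cd F"] assms(1) unfolding bij_betw_def inj_on_def by simp
qed (use assms in auto)

lemma S_arr_surj:
  assumes "arr F" "dm F = fob S M" "cd F = fob S N" "M \<in> Ob C" "N \<in> Ob C"
  shows "\<exists>G. arr G \<and> dm G = M \<and> cd G = N \<and> S_arr G = F"
proof -
  have "mp F \<in> mor C (fob S M) (fob S N)" using assms(1-3) by (simp add: arr_def del: arr_Ob)
  then obtain g where g: "g \<in> mor C M N" "fmor S g = mp F"
    using fmor_bij[OF assms(4,5)] unfolding bij_betw_def by (metis imageE)
  have "S_arr (ar M g N) = F" using g assms by (intro arrow_eqI) simp_all
  then show ?thesis using g assms by (intro exI[of _ "ar M g N"]) (simp add: arr_ar)
qed

lemma S_arr_cp [simp]: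
  assumes "arr F" "arr G" "cd F = dm G" shows "S_arr (G \<star> F) = S_arr G \<star> S_arr F"
proof -
  have "mp F \<in> mor C (dm F) (dm G)" "mp G \<in> mor C (dm G) (cd G)"
    using assms by (simp_all add: arr_def del: arr_Ob)
  then have "fmor S (mp G \<cdot> mp F) = fmor S (mp G) \<cdot> fmor S (mp F)"
    using S_functor assms arr_Ob unfolding is_functor_def by metis
  then show ?thesis by (simp add: S_arr_def cp_def)
qed

lemma S_arr_idn [simp]: "M \<in> Ob C \<Longrightarrow> S_arr (idn M) = idn (fob S M)"
  using S_functor by (simp add: is_functor_def S_arr_def idn_def)

lemma S_arr_pl [simp]:
  assumes "arr F" "arr G" "dm F = dm G" "cd F = cd G" shows "S_arr (F +\<^sub>a G) = S_arr F +\<^sub>a S_arr G"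
proof -
  have "mp F \<in> mor C (dm F) (cd F)" "mp G \<in> mor C (dm F) (cd F)"
    using assms by (simp_all add: arr_def del: arr_Ob)
  then have "fmor S (mp F \<oplus>\<^bsub>Hom C (dm F) (cd F)\<^esub> mp G) =
      fmor S (mp F) \<oplus>\<^bsub>Hom C (fob S (dm F)) (fob S (cd F))\<^esub> fmor S (mp G)"
    using automorphism assms(1) arr_Ob unfolding is_additive_automorphism_def by metis
  then show ?thesis by (simp add: S_arr_def pl_def)
qed

lemma S_arr_zr [simp]: 
  assumes "M \<in> Ob C" "N \<in> Ob C" shows "S_arr (zr M N) = zr (fob S M) (fob S N)"
proof (rule pl_cancel)
  show "S_arr (zr M N) +\<^sub>a S_arr (zr M N) = S_arr (zr M N) +\<^sub>a zr (fob S M) (fob S N)"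
    using assms S_arr_pl[of "zr M N" "zr M N"] by simp
qed (use assms in auto)

lemma S_arr_ng [simp]: "arr F \<Longrightarrow> S_arr (ng F) = ng (S_arr F)"
  by (rule ng_unique) (auto simp flip: S_arr_pl)

lemma S_arr_biprod:
  assumes b: "biprod M N B I J P Q"
  shows "biprod (fob S M) (fob S N) (fob S B) (S_arr I) (S_arr J) (S_arr P) (S_arr Q)"
proof -
  note [simp] = bipD[OF b]
  have "S_arr (I \<star> P +\<^sub>a J \<star> Q) = idn (fob S B)" by simp
  then have "S_arr I \<star> S_arr P +\<^sub>a S_arr J \<star> S_arr Q = idn (fob S B)" by (simp del: bipD(20)[OF b])
  moreover have "S_arr (P \<star> I) = idn (fob S M)" "S_arr (Q \<star> J) = idn (fob S N)"
    "S_arr (P \<star> J) = zr (fob S N) (fob S M)" "S_arr (Q \<star> I) = zr (fob S M) (fob S N)" by simp_all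
  ultimately show ?thesis unfolding biprod_def by (simp del: bipD(16-19)[OF b])
qed

text \<open>A sequence is encoded by its morphisms: \<open>G i\<close> for \<open>i \<le> d + 1\<close>; the values of \<open>G\<close> at
  larger indices are irrelevant.\<close>

definition is_seq :: "(nat \<Rightarrow> ('o, 'm) arrow) \<Rightarrow> bool"
  where "is_seq G \<longleftrightarrow> (\<forall>i\<le>Suc d. arr (G i)) \<and> (\<forall>i\<le>d. cd (G i) = dm (G (Suc i))) \<and>
    cd (G (Suc d)) = fob S (dm (G 0))"

definition seq_lists :: "(nat \<Rightarrow> ('o, 'm) arrow) \<Rightarrow> ('o, 'm) sequence"
  where "seq_lists G = (map (\<lambda>i. dm (G i)) [0..<Suc (Suc d)], map (\<lambda>i. mp (G i)) [0..<Suc (Suc d)])"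

definition angle :: "(nat \<Rightarrow> ('o, 'm) arrow) \<Rightarrow> bool"
  where "angle G \<longleftrightarrow> is_seq G \<and> seq_lists G \<in> A"

text \<open>The component at \<open>Suc (Suc d)\<close> is stored too, so that the square over the
  connecting morphism has the same form as all others.\<close>

definition seq_mor :: "(nat \<Rightarrow> ('o, 'm) arrow) \<Rightarrow> (nat \<Rightarrow> ('o, 'm) arrow) \<Rightarrow> (nat \<Rightarrow> ('o, 'm) arrow) \<Rightarrow> bool"
  where "seq_mor G H \<Phi> \<longleftrightarrow> (\<forall>i\<le>Suc d. arr (\<Phi> i) \<and> dm (\<Phi> i) = dm (G i) \<and> cd (\<Phi> i) = dm (H i)) \<and>
    \<Phi> (Suc (Suc d)) = S_arr (\<Phi> 0) \<and> (\<forall>i\<le>Suc d. \<Phi> (Suc i) \<star> G i = H i \<star> \<Phi> i)"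

lemma angle_is_seq: "angle G \<Longrightarrow> is_seq G"
  by (simp add: angle_def)

lemma seqnD:
  assumes "is_seq G"
  shows "i \<le> Suc d \<Longrightarrow> arr (G i)" "i \<le> d \<Longrightarrow> cd (G i) = dm (G (Suc i))" "cd (G (Suc d)) = fob S (dm (G 0))"
  using assms by (auto simp: is_seq_def)

lemma seq_lists_cong: "(\<And>i. i \<le> Suc d \<Longrightarrow> G i = H i) \<Longrightarrow> seq_lists G = seq_lists H"
  by (auto simp: seq_lists_def simp del: upt_Suc)

lemma is_seq_cong: "(\<And>i. i \<le> Suc d \<Longrightarrow> G i = H i) \<Longrightarrow> is_seq G = is_seq H"
  by (simp add: is_seq_def)

lemma angle_cong: "(\<And>i. i \<le> Suc d \<Longrightarrow> G i = H i) \<Longrightarrow> angle G = angle H"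
  using seq_lists_cong[of G H] is_seq_cong[of G H] by (simp add: angle_def)

lemma wrap_obj:
  assumes "is_seq G" "i \<le> Suc d"
  shows "wrap (fob S) (map (\<lambda>i. dm (G i)) [0..<Suc (Suc d)]) ! i = dm (G i)"
    "wrap (fob S) (map (\<lambda>i. dm (G i)) [0..<Suc (Suc d)]) ! Suc i = cd (G i)"
  using assms(2) wrap_map_nth[of i d "fob S" "\<lambda>i. dm (G i)"] wrap_map_nth[of "Suc i" d "fob S" "\<lambda>i. dm (G i)"]
    seqnD(2,3)[OF assms(1)]
  by (cases "i = Suc d"; simp del: upt_Suc)+

lemma seq_lists_is_sequence:
  assumes "is_seq G" shows "is_sequence C S d (seq_lists G)"
proof -
  have "map (\<lambda>i. mp (G i)) [0..<Suc (Suc d)] ! i \<in> mor C (wrap (fob S) (map (\<lambda>i. dm (G i)) [0..<Suc (Suc d)]) ! i)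
      (wrap (fob S) (map (\<lambda>i. dm (G i)) [0..<Suc (Suc d)]) ! Suc i)" if "i \<le> d + 1" for i
    using that seqnD(1)[OF assms, of i] wrap_obj[OF assms, of i]
    by (simp add: arr_def del: arr_Ob upt_Suc)
  moreover have "dm (G i) \<in> Ob C" if "i < d + 2" for i using seqnD(1)[OF assms, of i] that by auto
  ultimately show ?thesis unfolding is_sequence_def seq_lists_def by (auto simp del: upt_Suc)
qed

lemma is_seq_of_list:
  assumes "is_sequence C S d (cs, \<gamma>)"
  shows "\<exists>G. is_seq G \<and> seq_lists G = (cs, \<gamma>)"
proof -
  have l: "length cs = d + 2" "length \<gamma> = d + 2" "set cs \<subseteq> Ob C"
    and m: "\<And>i. i \<le> d + 1 \<Longrightarrow> \<gamma> ! i \<in> mor C (wrap (fob S) cs ! i) (wrap (fob S) cs ! Suc i)"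
    using assms by (auto simp: is_sequence_def)
  have w: "wrap (fob S) cs ! i = (if i < d + 2 then cs ! i else fob S (cs ! 0))" if "i \<le> d + 2" for i
    using l(1) that wrap_nth[of i cs "fob S"] by (cases cs) auto
  have o: "cs ! i \<in> Ob C" if "i < d + 2" for i using l that by auto
  define G where "G i = ar (wrap (fob S) cs ! i) (\<gamma> ! i) (wrap (fob S) cs ! Suc i)" for i
  have "arr (G i)" if "i \<le> Suc d" for i
  proof -
    have "wrap (fob S) cs ! i \<in> Ob C" "wrap (fob S) cs ! Suc i \<in> Ob C"
      using that o w by auto
    then show ?thesis using m[of i] that by (simp add: G_def arr_ar)
  qed
  then have "is_seq G" using w by (auto simp: is_seq_def G_def)
  moreover have "seq_lists G = (cs, \<gamma>)"
    using l w by (auto simp: seq_lists_def G_def simp del: upt_Suc intro!: nth_equalityI)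
  ultimately show ?thesis by blast
qed

lemma angle_of_list: "(cs, \<gamma>) \<in> A \<Longrightarrow> \<exists>G. angle G \<and> seq_lists G = (cs, \<gamma>)"
  using is_seq_of_list[OF angles, of cs \<gamma>] by (auto simp: angle_def)

lemma seq_mor_list:
  assumes G: "is_seq G" and H: "is_seq H" and P: "seq_mor G H \<Phi>"
  shows "is_sequence_mor C S d (seq_lists G) (seq_lists H) (map (\<lambda>i. mp (\<Phi> i)) [0..<Suc (Suc d)])"
  unfolding is_sequence_mor_def seq_lists_def prod.case
proof (intro conjI allI impI)
  fix i assume i: "i \<le> d + 1"
  show "map (\<lambda>i. mp (\<Phi> i)) [0..<Suc (Suc d)] ! i \<in> mor C (map (\<lambda>i. dm (G i)) [0..<Suc (Suc d)] ! i) (map (\<lambda>i. dm (H i)) [0..<Suc (Suc d)] ! i)"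
    using P i by (auto simp: seq_mor_def arr_def simp del: upt_Suc arr_Ob)
  have "wrap (fmor S) (map (\<lambda>i. mp (\<Phi> i)) [0..<Suc (Suc d)]) ! Suc i = mp (\<Phi> (Suc i))"
    using P i wrap_map_nth[of "Suc i" d "fmor S" "\<lambda>i. mp (\<Phi> i)"]
    by (cases "i = Suc d") (simp_all add: seq_mor_def del: upt_Suc)
  moreover have "\<Phi> (Suc i) \<star> G i = H i \<star> \<Phi> i" using P i by (simp add: seq_mor_def)
  ultimately show "wrap (fmor S) (map (\<lambda>i. mp (\<Phi> i)) [0..<Suc (Suc d)]) ! Suc i \<cdot> map (\<lambda>i. mp (G i)) [0..<Suc (Suc d)] ! i =
      map (\<lambda>i. mp (H i)) [0..<Suc (Suc d)] ! i \<cdot> map (\<lambda>i. mp (\<Phi> i)) [0..<Suc (Suc d)] ! i"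
    using i by (auto simp: cp_def simp del: upt_Suc)
qed simp

definition tag_mors :: "(nat \<Rightarrow> ('o, 'm) arrow) \<Rightarrow> (nat \<Rightarrow> ('o, 'm) arrow) \<Rightarrow> 'm list \<Rightarrow> nat \<Rightarrow> ('o, 'm) arrow"
  where "tag_mors G H \<phi> i = (if i \<le> Suc d then ar (dm (G i)) (\<phi> ! i) (dm (H i))
    else S_arr (ar (dm (G 0)) (\<phi> ! 0) (dm (H 0))))"

lemma mp_tag_mors:
  assumes "length \<phi> = d + 2" "i \<le> Suc (Suc d)" shows "wrap (fmor S) \<phi> ! i = mp (tag_mors G H \<phi> i)"
  using assms wrap_nth[of i \<phi> "fmor S"] by (cases \<phi>) (auto simp: tag_mors_def)

lemma seq_mor_tag_mors:
  assumes G: "is_seq G" and H: "is_seq H" and P: "is_sequence_mor C S d (seq_lists G) (seq_lists H) \<phi>"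
  shows "seq_mor G H (tag_mors G H \<phi>)"
proof -
  have l: "length \<phi> = d + 2" using P by (simp add: is_sequence_mor_def seq_lists_def)
  have m: "\<phi> ! i \<in> mor C (dm (G i)) (dm (H i))" if "i \<le> Suc d" for i
  proof -
    have "\<phi> ! i \<in> mor C (fst (seq_lists G) ! i) (fst (seq_lists H) ! i)"
      using P that unfolding is_sequence_mor_def by (auto simp: case_prod_beta)
    then show ?thesis using that by (simp add: seq_lists_def del: upt_Suc)
  qed
  have a: "arr (tag_mors G H \<phi> i)" if "i \<le> Suc (Suc d)" for i
    using that m[of i] m[of 0] seqnD(1)[OF G, of i] seqnD(1)[OF H, of i] seqnD(1)[OF G, of 0] seqnD(1)[OF H, of 0]
    by (auto simp: tag_mors_def arr_ar intro!: arr_S_arr)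
  have c: "tag_mors G H \<phi> (Suc i) \<star> G i = H i \<star> tag_mors G H \<phi> i" if i: "i \<le> Suc d" for i
  proof (rule arrow_eqI)
    have "wrap (fmor S) \<phi> ! Suc i \<cdot> snd (seq_lists G) ! i = snd (seq_lists H) ! i \<cdot> \<phi> ! i"
      using P i unfolding is_sequence_mor_def by (auto simp: case_prod_beta)
    then have "mp (tag_mors G H \<phi> (Suc i)) \<cdot> mp (G i) = mp (H i) \<cdot> mp (tag_mors G H \<phi> i)"
      using i mp_tag_mors[OF l, of "Suc i" G H] by (simp add: seq_lists_def tag_mors_def del: upt_Suc)
    then show "mp (tag_mors G H \<phi> (Suc i) \<star> G i) = mp (H i \<star> tag_mors G H \<phi> i)" by (simp add: cp_def)
    show "cd (tag_mors G H \<phi> (Suc i) \<star> G i) = cd (H i \<star> tag_mors G H \<phi> i)"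
      using i seqnD(2,3)[OF H] by (auto simp: tag_mors_def le_Suc_eq)
  qed (use i in \<open>simp add: tag_mors_def\<close>)
  show ?thesis unfolding seq_mor_def
  proof (intro conjI allI impI)
    show "tag_mors G H \<phi> (Suc (Suc d)) = S_arr (tag_mors G H \<phi> 0)" by (simp add: tag_mors_def)
    fix i assume i: "i \<le> Suc d"
    show "arr (tag_mors G H \<phi> i)" using a i by simp
    show "dm (tag_mors G H \<phi> i) = dm (G i)" "cd (tag_mors G H \<phi> i) = dm (H i)" using i by (simp_all add: tag_mors_def)
    show "tag_mors G H \<phi> (Suc i) \<star> G i = H i \<star> tag_mors G H \<phi> i" using c i .
  qed
qed

lemma angle_completion:
  assumes G: "angle G" and H: "angle H"
    and P0: "arr P0" "dm P0 = dm (G 0)" "cd P0 = dm (H 0)"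
    and P1: "arr P1" "dm P1 = cd (G 0)" "cd P1 = cd (H 0)"
    and e: "P1 \<star> G 0 = H 0 \<star> P0"
  shows "\<exists>\<Phi>. seq_mor G H \<Phi> \<and> \<Phi> 0 = P0 \<and> \<Phi> 1 = P1"
proof -
  have s: "is_seq G" "is_seq H" using G H by (auto simp: angle_def)
  obtain bs \<beta> cs \<gamma> where l: "seq_lists G = (bs, \<beta>)" "seq_lists H = (cs, \<gamma>)" by fastforce
  then have n: "bs ! 0 = dm (G 0)" "cs ! 0 = dm (H 0)" "bs ! 1 = cd (G 0)" "cs ! 1 = cd (H 0)"
    "\<beta> ! 0 = mp (G 0)" "\<gamma> ! 0 = mp (H 0)"
    using seqnD(2)[OF s(1), of 0] seqnD(2)[OF s(2), of 0] by (auto simp: seq_lists_def simp del: upt_Suc)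
  have "mp P0 \<in> mor C (bs ! 0) (cs ! 0)" "mp P1 \<in> mor C (bs ! 1) (cs ! 1)" "mp P1 \<cdot> \<beta> ! 0 = \<gamma> ! 0 \<cdot> mp P0"
    using P0 P1 e n by (auto simp: arr_def cp_def simp del: arr_Ob)
  then obtain \<phi> where p: "\<phi> ! 0 = mp P0" "\<phi> ! 1 = mp P1" "is_sequence_mor C S d (bs, \<beta>) (cs, \<gamma>) \<phi>"
    using completion[of bs \<beta> cs \<gamma> "mp P0" "mp P1"] G H l by (auto simp: angle_def)
  have "tag_mors G H \<phi> 0 = P0" "tag_mors G H \<phi> 1 = P1"
    using p P0 P1 seqnD(2)[OF s(1), of 0] seqnD(2)[OF s(2), of 0] by (auto simp: tag_mors_def intro!: arrow_eqI)
  then show ?thesis using seq_mor_tag_mors[OF s, of \<phi>] p(3) l by auto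
qed

text \<open>Continues a family to the index \<open>d + 2\<close>, the largest one that occurs in the
  matrices of a mapping cone.\<close>

definition ext_S :: "(nat \<Rightarrow> ('o, 'm) arrow) \<Rightarrow> nat \<Rightarrow> ('o, 'm) arrow"
  where "ext_S G i = (if i \<le> Suc d then G i else S_arr (G 0))"

lemma wrap_mp: "i \<le> Suc (Suc d) \<Longrightarrow> wrap (fmor S) (map (\<lambda>i. mp (G i)) [0..<Suc (Suc d)]) ! i = mp (ext_S G i)"
  by (auto simp: wrap_map_nth ext_S_def simp del: upt_Suc)

text \<open>The quantifiers over \<open>E\<close> and its biproduct structures stand inside the one
  over \<open>\<Phi>\<close>: a single morphism of sequences serves every realization of its
  cone.\<close>

lemma angle_octahedral:
  assumes G: "angle G" and H: "angle H"
    and P0: "arr P0" "dm P0 = dm (G 0)" "cd P0 = dm (H 0)"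
    and P1: "arr P1" "dm P1 = cd (G 0)" "cd P1 = cd (H 0)"
    and e: "P1 \<star> G 0 = H 0 \<star> P0"
  shows "\<exists>\<Phi>. seq_mor G H \<Phi> \<and> \<Phi> 0 = P0 \<and> \<Phi> 1 = P1 \<and>
    (\<forall>E I J P Q. is_seq E \<longrightarrow> (\<forall>i\<le>Suc d. biprod (cd (G i)) (dm (H i)) (dm (E i)) (I i) (J i) (P i) (Q i) \<and>
      ext_S P (Suc i) \<star> E i \<star> I i = ng (ext_S G (Suc i)) \<and>
      ext_S P (Suc i) \<star> E i \<star> J i = zr (dm (H i)) (cd (ext_S G (Suc i))) \<and>
      ext_S Q (Suc i) \<star> E i \<star> I i = \<Phi> (Suc i) \<and>
      ext_S Q (Suc i) \<star> E i \<star> J i = H i) \<longrightarrow> angle E)"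
proof -
  have s: "is_seq G" "is_seq H" using G H by (auto simp: angle_def)
  obtain bs \<beta> cs \<gamma> where l: "seq_lists G = (bs, \<beta>)" "seq_lists H = (cs, \<gamma>)" by fastforce
  then have n: "bs ! 0 = dm (G 0)" "cs ! 0 = dm (H 0)" "bs ! 1 = cd (G 0)" "cs ! 1 = cd (H 0)"
    "\<beta> ! 0 = mp (G 0)" "\<gamma> ! 0 = mp (H 0)"
    using seqnD(2)[OF s(1), of 0] seqnD(2)[OF s(2), of 0] by (auto simp: seq_lists_def simp del: upt_Suc)
  have "mp P0 \<in> mor C (bs ! 0) (cs ! 0)" "mp P1 \<in> mor C (bs ! 1) (cs ! 1)" "mp P1 \<cdot> \<beta> ! 0 = \<gamma> ! 0 \<cdot> mp P0"
    using P0 P1 e n by (auto simp: arr_def cp_def simp del: arr_Ob)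
  then obtain \<phi> where p: "\<phi> ! 0 = mp P0" "\<phi> ! 1 = mp P1" "is_sequence_mor C S d (bs, \<beta>) (cs, \<gamma>) \<phi>"
    and z: "\<And>z. is_mapping_cone C S d (bs, \<beta>) (cs, \<gamma>) \<phi> z \<Longrightarrow> z \<in> A"
    using octahedral[of bs \<beta> cs \<gamma> "mp P0" "mp P1"] G H l by (auto simp: angle_def)
  have lp: "length \<phi> = d + 2" using p(3) by (simp add: is_sequence_mor_def)
  let ?\<Phi> = "tag_mors G H \<phi>"
  have "?\<Phi> 0 = P0" "?\<Phi> 1 = P1"
    using p P0 P1 seqnD(2)[OF s(1), of 0] seqnD(2)[OF s(2), of 0] by (auto simp: tag_mors_def intro!: arrow_eqI)
  moreover have arrow_sum: "seq_mor G H ?\<Phi>" using seq_mor_tag_mors[OF s, of \<phi>] p(3) l by auto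
  moreover have "angle E" if E: "is_seq E" and c: "\<forall>i\<le>Suc d. biprod (cd (G i)) (dm (H i)) (dm (E i)) (I i) (J i) (P i) (Q i) \<and>
      ext_S P (Suc i) \<star> E i \<star> I i = ng (ext_S G (Suc i)) \<and>
      ext_S P (Suc i) \<star> E i \<star> J i = zr (dm (H i)) (cd (ext_S G (Suc i))) \<and>
      ext_S Q (Suc i) \<star> E i \<star> I i = ?\<Phi> (Suc i) \<and>
      ext_S Q (Suc i) \<star> E i \<star> J i = H i" for E I J P Q
  proof -
    obtain es \<epsilon> where le: "seq_lists E = (es, \<epsilon>)" by fastforce
    let ?m = "\<lambda>F. map (\<lambda>i. mp (F i)) [0..<Suc (Suc d)]"
    have lists: "bs = map (\<lambda>i. dm (G i)) [0..<Suc (Suc d)]" "\<beta> = ?m G" "cs = map (\<lambda>i. dm (H i)) [0..<Suc (Suc d)]"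
      "\<gamma> = ?m H" "es = map (\<lambda>i. dm (E i)) [0..<Suc (Suc d)]" "\<epsilon> = ?m E"
      using l le by (auto simp: seq_lists_def simp del: upt_Suc)
    have seq: "is_sequence C S d (es, \<epsilon>)" using seq_lists_is_sequence[OF E] le by simp
    have "is_mapping_cone C S d (bs, \<beta>) (cs, \<gamma>) \<phi> (es, \<epsilon>)"
      unfolding is_mapping_cone_def prod.case
    proof (rule conjI, rule seq, rule exI[of _ "?m I"], rule exI[of _ "?m J"], rule exI[of _ "?m P"],
        rule exI[of _ "?m Q"], intro conjI allI impI)
      fix i assume i: "i \<le> d + 1"
      note ci = c[rule_format, of i]
      have wG: "wrap (fob S) bs ! Suc i = cd (G i)" using wrap_obj(2)[OF s(1), of i] i lists by simp
      have nth: "cs ! i = dm (H i)" "es ! i = dm (E i)" "\<epsilon> ! i = mp (E i)" "\<gamma> ! i = mp (H i)"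
        "?m I ! i = mp (I i)" "?m J ! i = mp (J i)" "?m P ! i = mp (P i)" "?m Q ! i = mp (Q i)"
        using i lists by (simp_all del: upt_Suc)
      show "is_biproduct C (wrap (fob S) bs ! Suc i) (cs ! i) (es ! i) (?m I ! i) (?m J ! i) (?m P ! i) (?m Q ! i)"
        unfolding nth wG using ci i by (intro biprod_mp) simp
      have b: "biprod (cd (G i)) (dm (H i)) (dm (E i)) (I i) (J i) (P i) (Q i)" using ci i by simp
      have cdG: "cd (ext_S G (Suc i)) = (if i = d + 1 then fob S (bs ! 1) else wrap (fob S) bs ! Suc (Suc i))"
        using i n wrap_obj(2)[OF s(1), of "Suc i"] lists by (auto simp: ext_S_def)
      have dmG: "dm (ext_S G (Suc i)) = cd (G i)" using i seqnD(2,3)[OF s(1)] by (auto simp: ext_S_def le_Suc_eq)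
      note w = wrap_mp[of "Suc i"]
      have si: "Suc i \<le> Suc (Suc d)" using i by simp
      have as: "mp F \<cdot> mp (E i) \<cdot> mp X' = mp (F \<star> E i \<star> X')"
        if "arr F" "dm F = cd (E i)" "arr X'" "cd X' = dm (E i)" for F X'
      proof -
        have "mp ((F \<star> E i) \<star> X') = mp F \<cdot> mp (E i) \<cdot> mp X'" by (simp add: cp_def del: cp_assoc)
        then show ?thesis using that seqnD(1)[OF E, of i] i by simp
      qed
      have PQ: "arr (P j)" "dm (P j) = dm (E j)" "arr (Q j)" "dm (Q j) = dm (E j)" if "j \<le> Suc d" for j
      proof -
        have "biprod (cd (G j)) (dm (H j)) (dm (E j)) (I j) (J j) (P j) (Q j)" using c that by simp
        from bipD[OF this] show "arr (P j)" "dm (P j) = dm (E j)" "arr (Q j)" "dm (Q j) = dm (E j)" by simp_all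
      qed
      have "cd (E i) = dm (E (Suc i))" if "i \<noteq> Suc d" using seqnD(2)[OF E, of i] i that by simp
      then have aP: "arr (ext_S P (Suc i))" "dm (ext_S P (Suc i)) = cd (E i)" "arr (ext_S Q (Suc i))" "dm (ext_S Q (Suc i)) = cd (E i)"
        using i PQ[of "Suc i"] PQ[of 0] seqnD(3)[OF E] by (cases "i = Suc d"; simp add: ext_S_def)+
      note eqs = w[OF si] nth wG as[OF aP(1,2) bipD(4,9)[OF b]] as[OF aP(1,2) bipD(5,11)[OF b]]
        as[OF aP(3,4) bipD(4,9)[OF b]] as[OF aP(3,4) bipD(5,11)[OF b]]
      show "wrap (fmor S) (?m P) ! Suc i \<cdot> \<epsilon> ! i \<cdot> ?m I ! i = \<ominus>\<^bsub>Hom C (wrap (fob S) bs ! Suc i)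
          (if i = d + 1 then fob S (bs ! 1) else wrap (fob S) bs ! Suc (Suc i))\<^esub> (wrap (fmor S) \<beta> ! Suc i)"
        unfolding cdG[symmetric] eqs lists(2) using ci i by (simp add: ng_def dmG)
      show "wrap (fmor S) (?m P) ! Suc i \<cdot> \<epsilon> ! i \<cdot> ?m J ! i = \<zero>\<^bsub>Hom C (cs ! i)
          (if i = d + 1 then fob S (bs ! 1) else wrap (fob S) bs ! Suc (Suc i))\<^esub>"
        unfolding cdG[symmetric] eqs using ci i by (simp add: zr_def)
      show "wrap (fmor S) (?m Q) ! Suc i \<cdot> \<epsilon> ! i \<cdot> ?m I ! i = wrap (fmor S) \<phi> ! Suc i"
        unfolding eqs mp_tag_mors[OF lp si, of G H] using ci i by simp
      show "wrap (fmor S) (?m Q) ! Suc i \<cdot> \<epsilon> ! i \<cdot> ?m J ! i = \<gamma> ! i"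
        unfolding eqs using ci i by simp
    qed simp_all
    then show "angle E" using z E le by (simp add: angle_def)
  qed
  ultimately show ?thesis by (intro exI[of _ ?\<Phi>]) blast
qed

lemma angle_sum:
  assumes s: "is_seq G" "is_seq H" "is_seq E"
    and m: "seq_mor G E I" "seq_mor H E J" "seq_mor E G P" "seq_mor E H Q"
    and b: "\<And>i. i \<le> Suc d \<Longrightarrow> biprod (dm (G i)) (dm (H i)) (dm (E i)) (I i) (J i) (P i) (Q i)"
  shows "angle G \<and> angle H \<longleftrightarrow> angle E"
proof -
  let ?m = "\<lambda>F. map (\<lambda>i. mp (F i)) [0..<Suc (Suc d)]"
  have "is_biproduct C (fst (seq_lists G) ! j) (fst (seq_lists H) ! j) (fst (seq_lists E) ! j) (?m I ! j) (?m J ! j) (?m P ! j) (?m Q ! j)"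
    if "j \<le> d + 1" for j
    using biprod_mp[OF b[of j]] that by (simp add: seq_lists_def del: upt_Suc)
  then have "is_sequence_sum C S d (seq_lists G) (seq_lists H) (seq_lists E)"
    unfolding is_sequence_sum_def
    using seq_mor_list[OF s(1,3) m(1)] seq_mor_list[OF s(2,3) m(2)] seq_mor_list[OF s(3,1) m(3)] seq_mor_list[OF s(3,2) m(4)]
    by blast
  from sums_summands[OF seq_lists_is_sequence[OF s(1)] seq_lists_is_sequence[OF s(2)] seq_lists_is_sequence[OF s(3)] this]
  show ?thesis using s by (simp add: angle_def)
qed

definition left_rot :: "(nat \<Rightarrow> ('o, 'm) arrow) \<Rightarrow> nat \<Rightarrow> ('o, 'm) arrow"
  where "left_rot G i = (if i \<le> d then G (Suc i) else if even d then S_arr (G 0) else ng (S_arr (G 0)))"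

lemma is_seq_left_rot: "is_seq G \<Longrightarrow> is_seq (left_rot G)"
proof -
  assume "is_seq G"
  note s = seqnD[OF this]
  have "arr (left_rot G i)" if "i \<le> Suc d" for i
    using that s(1)[of "Suc i"] s(1)[of 0] by (auto simp: left_rot_def)
  moreover have "cd (left_rot G i) = dm (left_rot G (Suc i))" if "i \<le> d" for i
    using that s(2)[of "Suc i"] s(3) by (cases "i = d") (auto simp: left_rot_def)
  moreover have "cd (left_rot G (Suc d)) = fob S (dm (left_rot G 0))"
    using s(2)[of 0] by (simp add: left_rot_def)
  ultimately show "is_seq (left_rot G)" by (simp add: is_seq_def)
qed

lemma seq_lists_left_rot:
  assumes "is_seq G" shows "seq_lists (left_rot G) = left_rotation C S d (seq_lists G)"
proof -
  note s = seqnD[OF assms]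
  have n: "Suc (Suc d) = length (map (\<lambda>i. dm (G i)) [0..<Suc (Suc d)])" by simp
  have 1: "map (\<lambda>i. dm (left_rot G i)) [0..<Suc (Suc d)] = tl (wrap (fob S) (map (\<lambda>i. dm (G i)) [0..<Suc (Suc d)]))"
  proof (rule nth_equalityI)
    fix i assume "i < length (map (\<lambda>i. dm (left_rot G i)) [0..<Suc (Suc d)])"
    then have i: "i \<le> Suc d" by simp
    have "tl (wrap (fob S) (map (\<lambda>i. dm (G i)) [0..<Suc (Suc d)])) ! i = cd (G i)"
      using i wrap_obj(2)[OF assms i] by (subst nth_tl) (simp_all add: wrap_def)
    moreover have "dm (left_rot G i) = cd (G i)" using i s by (auto simp: left_rot_def le_Suc_eq)
    ultimately show "map (\<lambda>i. dm (left_rot G i)) [0..<Suc (Suc d)] ! i = tl (wrap (fob S) (map (\<lambda>i. dm (G i)) [0..<Suc (Suc d)])) ! i"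
      using i by (simp del: upt_Suc)
  qed (simp add: wrap_def)
  have 2: "map (\<lambda>i. mp (left_rot G i)) [0..<Suc (Suc d)] = tl (map (\<lambda>i. mp (G i)) [0..<Suc (Suc d)]) @ [mp (left_rot G (Suc d))]"
    by (rule nth_equalityI) (auto simp: nth_append nth_tl left_rot_def simp del: upt_Suc)
  have 3: "mp (left_rot G (Suc d)) = (if even d then fmor S (map (\<lambda>i. mp (G i)) [0..<Suc (Suc d)] ! 0)
       else \<ominus>\<^bsub>Hom C (fob S (map (\<lambda>i. dm (G i)) [0..<Suc (Suc d)] ! 0)) (fob S (map (\<lambda>i. dm (G i)) [0..<Suc (Suc d)] ! 1))\<^esub>
        fmor S (map (\<lambda>i. mp (G i)) [0..<Suc (Suc d)] ! 0))"
    using s(2)[of 0] by (simp add: left_rot_def ng_def del: upt_Suc)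
  show ?thesis unfolding seq_lists_def left_rotation_def prod.case 1 2 3 ..
qed

lemma angle_left_rot: "is_seq G \<Longrightarrow> angle (left_rot G) \<longleftrightarrow> angle G"
  using rotation[OF seq_lists_is_sequence[of G]] seq_lists_left_rot[of G] is_seq_left_rot[of G] by (simp add: angle_def)

text \<open>\<open>S\<close> is bijective on Hom-sets, so the last morphism of \<open>H\<close>,
  with the sign that rotation demands, is the image of a morphism that can be put in front. The
  rotation axiom is then read backwards.\<close>

lemma angle_unrot:
  assumes H: "angle H" and M: "M \<in> Ob C" "fob S M = dm (H (Suc d))"
  shows "\<exists>G. angle G \<and> dm (G 0) = M \<and> (\<forall>i\<le>d. G (Suc i) = H i)"
proof -
  note s = seqnD[OF angle_is_seq[OF H]]
  let ?L = "if even d then H (Suc d) else ng (H (Suc d))"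
  have "arr ?L" "dm ?L = fob S M" "cd ?L = fob S (dm (H 0))" "dm (H 0) \<in> Ob C"
    using s(1)[of "Suc d"] s(1)[of 0] s(3) M by auto
  then obtain F where F: "arr F" "dm F = M" "cd F = dm (H 0)" "S_arr F = ?L"
    using S_arr_surj[of ?L M "dm (H 0)"] M by blast
  define G where "G i = (case i of 0 \<Rightarrow> F | Suc i \<Rightarrow> H i)" for i
  have "is_seq G" unfolding is_seq_def
    using s F M by (auto simp: G_def split: nat.split) 
  moreover have "angle (left_rot G)"
  proof -
    have "left_rot G i = H i" if "i \<le> Suc d" for i
      using that F s(1)[of "Suc d"] by (auto simp: left_rot_def G_def le_Suc_eq)
    then show ?thesis using H angle_cong[of "left_rot G" H] by simp
  qed
  ultimately have "angle G" using angle_left_rot by blast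
  then show ?thesis using F by (auto simp: G_def)
qed

definition trivial_seq :: "'o \<Rightarrow> 'o \<Rightarrow> nat \<Rightarrow> ('o, 'm) arrow"
  where "trivial_seq Z M i = (if i = 0 then idn M else if i = 1 then zr M Z
    else if i \<le> d then zr Z Z else zr Z (fob S M))"

lemma angle_trivial_seq:
  assumes M: "M \<in> Ob C" and Z: "is_zero_object C Z" shows "angle (trivial_seq Z M)"
proof -
  have Z': "Z \<in> Ob C" using zero_objectD(1)[OF Z] .
  have "is_seq (trivial_seq Z M)"
    unfolding is_seq_def using M Z' d_pos by (auto simp: trivial_seq_def)
  moreover have "seq_lists (trivial_seq Z M) = trivial_sequence C S d Z M"
    unfolding seq_lists_def trivial_sequence_def prod.inject
  proof (intro conjI nth_equalityI)
    fix i assume "i < length (map (\<lambda>i. dm (trivial_seq Z M i)) [0..<Suc (Suc d)])"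
    then have i: "i < d + 2" by simp
    then consider "i = 0" | "i = 1" | k where "i = Suc (Suc k)" "k < d" by (cases i; cases "i - 1") auto
    then show "map (\<lambda>i. dm (trivial_seq Z M i)) [0..<Suc (Suc d)] ! i = (M # M # replicate d Z) ! i"
      using i by cases (auto simp: trivial_seq_def simp del: upt_Suc)
  next
    fix i assume "i < length (map (\<lambda>i. mp (trivial_seq Z M i)) [0..<Suc (Suc d)])"
    then have i: "i < d + 2" by simp
    then consider "i = 0" | "i = 1" | k where "i = Suc (Suc k)" "k < d" by (cases i; cases "i - 1") auto
    then show "map (\<lambda>i. mp (trivial_seq Z M i)) [0..<Suc (Suc d)] ! i = (ident C M # \<zero>\<^bsub>Hom C M Z\<^esub> #
        replicate (d - 1) \<zero>\<^bsub>Hom C Z Z\<^esub> @ [\<zero>\<^bsub>Hom C Z (fob S M)\<^esub>]) ! i"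
      using i d_pos by cases (auto simp: trivial_seq_def idn_def zr_def nth_append simp del: upt_Suc)
  qed (use d_pos in auto)
  ultimately show ?thesis using trivial_angle[OF M Z] by (simp add: angle_def)
qed

section \<open>Exactness properties of angles\<close>

text \<open>The pair of the identity and \<open>G 0\<close> extends to a morphism from the trivial
  angle to \<open>G\<close>. Its component at index 2 starts at a zero object, so the square in
  degree 1 says that \<open>G 1\<close> kills \<open>G 0\<close>. Higher degrees follow by
  rotation.\<close>

lemma comp_zero:
  assumes "angle G" "i \<le> d" shows "G (Suc i) \<star> G i = zr (dm (G i)) (cd (G (Suc i)))"
  using assms
proof (induction i arbitrary: G)
  case 0
  note s = seqnD[OF angle_is_seq[OF 0(1)]]
  obtain Z where Z: "is_zero_object C Z" using zero_object by blast
  have [simp]: "arr (G 0)" "arr (G (Suc 0))" "cd (G 0) = dm (G (Suc 0))" using s(1,2)[of 0] s(1)[of 1] by auto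
  obtain \<Phi> where P: "seq_mor (trivial_seq Z (dm (G 0))) G \<Phi>" "\<Phi> 0 = idn (dm (G 0))" "\<Phi> 1 = G 0"
    using angle_completion[OF angle_trivial_seq[OF _ Z] 0(1), of "dm (G 0)" "idn (dm (G 0))" "G 0"]
    by (auto simp: trivial_seq_def)
  have "\<Phi> 2 \<star> trivial_seq Z (dm (G 0)) 1 = G 1 \<star> \<Phi> 1"
    using P(1) d_pos unfolding seq_mor_def by (metis One_nat_def Suc_1 le_SucI Suc_leI zero_le)
  moreover have "arr (\<Phi> 2)" "dm (\<Phi> 2) = Z" "cd (\<Phi> 2) = cd (G 1)"
    using P(1) d_pos s(2)[of 1] unfolding seq_mor_def by (auto simp: trivial_seq_def numeral_2_eq_2)
  ultimately show ?case using P(3) zero_objectD(1)[OF Z] by (simp add: trivial_seq_def)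
next
  case (Suc i)
  have "angle (left_rot G)" using Suc.prems angle_left_rot angle_is_seq by blast
  from Suc.IH[OF this] show ?case using Suc.prems by (simp add: left_rot_def)
qed

lemma comp_zero_last:
  assumes "angle G" shows "S_arr (G 0) \<star> G (Suc d) = zr (dm (G (Suc d))) (fob S (cd (G 0)))"
proof -
  note s = seqnD[OF angle_is_seq[OF assms]]
  have [simp]: "arr (G 0)" "arr (G (Suc d))" "cd (G (Suc d)) = fob S (dm (G 0))" using s by auto
  have "angle (left_rot G)" using assms angle_left_rot angle_is_seq by blast
  from comp_zero[OF this, of d] show ?thesis
    using ng_ng[of "S_arr (G 0) \<star> G (Suc d)"] by (cases "even d") (simp_all add: left_rot_def)
qed

text \<open>A morphism \<open>F\<close> that kills \<open>G 0\<close> is completed to a morphism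
  from \<open>G\<close> to the trivial angle on \<open>cd F\<close> rotated one step backwards, with
  components 0 and \<open>F\<close> at the start; the component at index 2 is the
  factorization.\<close>

lemma weak_cokernel:
  assumes "angle G" "i \<le> d" "arr F" "dm F = cd (G i)" "F \<star> G i = zr (dm (G i)) (cd F)"
  shows "\<exists>H. arr H \<and> dm H = cd (G (Suc i)) \<and> cd H = cd F \<and> F = H \<star> G (Suc i)"
  using assms
proof (induction i arbitrary: G)
  case 0
  note s = seqnD[OF angle_is_seq[OF 0(1)]]
  obtain Z where Z: "is_zero_object C Z" using zero_object by blast
  have Z': "Z \<in> Ob C" using zero_objectD(1)[OF Z] .
  \<comment> \<open>The backward rotation of the trivial angle starts at an object that
    \<open>S\<close> sends to the zero object \<open>Z\<close>.\<close>
  obtain M where M: "M \<in> Ob C" "fob S M = Z" using S_surj[OF Z'] by blast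
  have [simp]: "arr (G 0)" "arr (G (Suc 0))" "cd (G 0) = dm (G (Suc 0))" using s(1,2)[of 0] s(1)[of 1] by auto
  have t: "angle (trivial_seq Z (cd F))" using angle_trivial_seq[OF _ Z] 0(3) by simp
  have "fob S M = dm (trivial_seq Z (cd F) (Suc d))" using M d_pos by (simp add: trivial_seq_def)
  then obtain R where R: "angle R" "dm (R 0) = M" "\<And>i. i \<le> d \<Longrightarrow> R (Suc i) = trivial_seq Z (cd F) i"
    using angle_unrot[OF t M(1)] by blast
  note r = seqnD[OF angle_is_seq[OF R(1)]]
  have R1: "R (Suc 0) = idn (cd F)" "R (Suc (Suc 0)) = zr (cd F) (cd (R (Suc (Suc 0))))" 
    using R(3)[of 0] R(3)[of 1] d_pos by (auto simp: trivial_seq_def)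
  have r0: "arr (R 0)" "cd (R 0) = cd F" using r(1)[of 0] r(2)[of 0] R1 by auto
  have "\<exists>\<Phi>. seq_mor G R \<Phi> \<and> \<Phi> 0 = zr (dm (G 0)) (dm (R 0)) \<and> \<Phi> 1 = F"
    by (rule angle_completion[OF 0(1) R(1)]) (use 0 r0 M R(2) in auto)
  then obtain \<Phi> where P: "seq_mor G R \<Phi>" "\<Phi> 1 = F" by blast
  have "\<Phi> 2 \<star> G 1 = R 1 \<star> \<Phi> 1"
    using P(1) d_pos unfolding seq_mor_def by (metis One_nat_def Suc_1 le_SucI Suc_leI zero_le)
  moreover have "arr (\<Phi> 2)" "dm (\<Phi> 2) = cd (G 1)" "cd (\<Phi> 2) = cd F"
  proof -
    have "arr (\<Phi> 2)" "dm (\<Phi> 2) = dm (G 2)" "cd (\<Phi> 2) = dm (R 2)"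
      using P(1) d_pos unfolding seq_mor_def by auto
    moreover have "dm (R 2) = cd F" using R1(2) by (metis dm_cd(7) numeral_2_eq_2)
    ultimately show "arr (\<Phi> 2)" "dm (\<Phi> 2) = cd (G 1)" "cd (\<Phi> 2) = cd F"
      using s(2)[of 1] d_pos by (auto simp: numeral_2_eq_2)
  qed
  ultimately show ?case using P(2) R1(1) 0(3) by (intro exI[of _ "\<Phi> 2"]) simp
next
  case (Suc i)
  have "angle (left_rot G)" using Suc.prems angle_left_rot angle_is_seq by blast
  from Suc.IH[OF this] show ?case using Suc.prems by (simp add: left_rot_def)
qed

text \<open>One more rotation of \<open>weak_cokernel\<close>; for odd \<open>d\<close> the sign of
  the rotated morphism is absorbed into \<open>H\<close>.\<close>

lemma weak_cokernel_last:
  assumes G: "angle G" and F: "arr F" "dm F = fob S (dm (G 0))" "F \<star> G (Suc d) = zr (dm (G (Suc d))) (cd F)"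
  shows "\<exists>H. arr H \<and> dm H = fob S (cd (G 0)) \<and> cd H = cd F \<and> F = H \<star> S_arr (G 0)"
proof -
  note s = seqnD[OF angle_is_seq[OF G]]
  have [simp]: "arr (G 0)" "arr (G (Suc d))" "cd (G (Suc d)) = fob S (dm (G 0))" using s by auto
  have ar: "angle (left_rot G)" using G angle_left_rot angle_is_seq by blast
  have r: "left_rot G d = G (Suc d)" and cr: "cd (left_rot G (Suc d)) = fob S (cd (G 0))"
    by (simp_all add: left_rot_def)
  have "dm F = cd (G (Suc d))" using F by simp
  from weak_cokernel[OF ar order_refl F(1), unfolded r cr, OF this F(3)]
  obtain H where H: "arr H" "dm H = fob S (cd (G 0))" "cd H = cd F" "F = H \<star> left_rot G (Suc d)"
    by blast
  show ?thesis
  proof (cases "even d")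
    case True
    then show ?thesis using H by (auto simp: left_rot_def)
  next
    case False
    then have "F = ng H \<star> S_arr (G 0)" using H by (simp add: left_rot_def)
    then show ?thesis using H by (intro exI[of _ "ng H"]) simp
  qed
qed

text \<open>The obstruction to extending \<open>F\<close> along \<open>G 0\<close> is
  \<open>S_arr F \<star> G (Suc d)\<close>. When it vanishes, \<open>S_arr F\<close> factors through
  \<open>S_arr (G 0)\<close>, and the factorization comes from the original Hom-sets because
  \<open>S\<close> is fully faithful.\<close>

lemma extend_along:
  assumes G: "angle G" and F: "arr F" "dm F = dm (G 0)"
    and z: "\<And>R. arr R \<Longrightarrow> dm R = dm (G (Suc d)) \<Longrightarrow> cd R = fob S (cd F) \<Longrightarrow> R = zr (dm R) (cd R)"
  shows "\<exists>H. arr H \<and> dm H = cd (G 0) \<and> cd H = cd F \<and> F = H \<star> G 0"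
proof -
  note s = seqnD[OF angle_is_seq[OF G]]
  have [simp]: "arr (G 0)" "arr (G (Suc d))" "cd (G (Suc d)) = fob S (dm (G 0))" using s by auto
  have "S_arr F \<star> G (Suc d) = zr (dm (G (Suc d))) (cd (S_arr F))"
    using z[of "S_arr F \<star> G (Suc d)"] F by simp
  then obtain H where H: "arr H" "dm H = fob S (cd (G 0))" "cd H = fob S (cd F)" "S_arr F = H \<star> S_arr (G 0)"
    using weak_cokernel_last[OF G, of "S_arr F"] F by auto
  then obtain H' where H': "arr H'" "dm H' = cd (G 0)" "cd H' = cd F" "S_arr H' = H"
    using S_arr_surj[of H "cd (G 0)" "cd F"] F by auto
  have "F = H' \<star> G 0" by (rule S_arr_inj) (use H H' F in auto)
  then show ?thesis using H' by blast
qed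


section \<open>Mapping cones and cancellation\<close>

definition rigid :: "'o \<Rightarrow> bool"
  where "rigid T \<longleftrightarrow> T \<in> Ob C \<and> (\<forall>F. arr F \<longrightarrow> dm F = T \<longrightarrow> cd F = fob S T \<longrightarrow> F = zr T (fob S T))"

lemma factors_rigid_left:
  assumes T: "rigid T"
  shows "factors T H \<Longrightarrow> arr F \<Longrightarrow> dm F = T \<Longrightarrow> cd F = fob S (dm H) \<Longrightarrow> S_arr H \<star> F = zr T (fob S (cd H))"
proof (induction arbitrary: F rule: factors.induct)
  case (add H H')
  then show ?case using factors_arr T by (simp add: rigid_def)
next
  case (comp H G)
  have "S_arr H \<star> F = zr T (fob S T)" using T comp unfolding rigid_def by (simp del: zr_cp)
  then have "S_arr G \<star> S_arr H \<star> F = S_arr G \<star> zr T (fob S T)" by simp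
  then show ?case using comp T by (simp add: rigid_def)
qed simp

text \<open>The vanishing passes from \<open>T\<close> to retracts one variable at a time: to the
  target by factoring \<open>idn N\<close>, and then to the source by factoring
  \<open>idn M\<close>.\<close>

lemma rigid_retract_of:
  assumes T: "rigid T" and M: "retract_of T M" and N: "retract_of T N" and F: "arr F" "dm F = M" "cd F = fob S N"
  shows "F = zr M (fob S N)"
proof -
  have 1: "G = zr T (fob S N)" if "arr G" "dm G = T" "cd G = fob S N" for G
    using factors_rigid_left[OF T, of "idn N" G] N that by (simp add: retract_of_def)
  have "F \<star> H = zr (dm H) (fob S N)" if "factors T H" "cd H = M" for H
    using that
  proof (induction rule: factors.induct)
    case (zero M' N')
    then show ?case using F by simp
  next
    case (add H H')
    note a = factors_arr[OF add(1)] factors_arr[OF add(2)]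
    show ?case using arr_Ob(1)[OF a(2)] S_Ob[OF retract_of_Ob[OF N]] F add a by simp
  next
    case (comp H G)
    have "F \<star> G = zr T (fob S N)" using comp F by (intro 1) auto
    then have "(F \<star> G) \<star> H = zr (dm H) (fob S N)" using comp retract_of_Ob[OF N] by simp
    then show ?case using comp F by simp
  qed
  from this[of "idn M"] show ?thesis using M F by (simp add: retract_of_def)
qed

text \<open>The axiom only certifies sequences already recognized as cones. Here one is built from
  chosen biproducts, and its morphisms are given as explicit sums of matrix entries for later
  computation.\<close>

lemma angle_cone:
  assumes G: "angle G" and H: "angle H"
    and P0: "arr P0" "dm P0 = dm (G 0)" "cd P0 = dm (H 0)"
    and P1: "arr P1" "dm P1 = cd (G 0)" "cd P1 = cd (H 0)"
    and e: "P1 \<star> G 0 = H 0 \<star> P0"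
  shows "\<exists>\<Phi> E I J P Q. seq_mor G H \<Phi> \<and> \<Phi> 0 = P0 \<and> \<Phi> 1 = P1 \<and> angle E \<and>
    (\<forall>i\<le>Suc d. biprod (cd (G i)) (dm (H i)) (dm (E i)) (I i) (J i) (P i) (Q i)) \<and>
    (\<forall>i\<le>Suc d. E i = ext_S I (Suc i) \<star> ng (ext_S G (Suc i)) \<star> P i +\<^sub>a
      (ext_S J (Suc i) \<star> \<Phi> (Suc i) \<star> P i +\<^sub>a ext_S J (Suc i) \<star> H i \<star> Q i))"
proof -
  note s = seqnD[OF angle_is_seq[OF G]] and t = seqnD[OF angle_is_seq[OF H]]
  obtain \<Phi> where \<Phi>: "seq_mor G H \<Phi>" "\<Phi> 0 = P0" "\<Phi> 1 = P1" and
    cone: "\<And>E I J P Q. is_seq E \<Longrightarrow> (\<forall>i\<le>Suc d. biprod (cd (G i)) (dm (H i)) (dm (E i)) (I i) (J i) (P i) (Q i) \<and>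
      ext_S P (Suc i) \<star> E i \<star> I i = ng (ext_S G (Suc i)) \<and>
      ext_S P (Suc i) \<star> E i \<star> J i = zr (dm (H i)) (cd (ext_S G (Suc i))) \<and>
      ext_S Q (Suc i) \<star> E i \<star> I i = \<Phi> (Suc i) \<and>
      ext_S Q (Suc i) \<star> E i \<star> J i = H i) \<Longrightarrow> angle E"
    using angle_octahedral[OF assms] by blast
  have "\<forall>i. \<exists>x. i \<le> Suc d \<longrightarrow> (case x of (B, I, J, P, Q) \<Rightarrow> biprod (cd (G i)) (dm (H i)) B I J P Q)"
    using ex_biprod s(1) t(1) by (auto simp: split_def)
  then obtain x where x: "\<And>i. i \<le> Suc d \<Longrightarrow> (case x i of (B, I, J, P, Q) \<Rightarrow> biprod (cd (G i)) (dm (H i)) B I J P Q)"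
    by metis
  define B I J P Q where "B i = fst (x i)" and "I i = fst (snd (x i))" and "J i = fst (snd (snd (x i)))"
    and "P i = fst (snd (snd (snd (x i))))" and "Q i = snd (snd (snd (snd (x i))))" for i
  have b: "biprod (cd (G i)) (dm (H i)) (B i) (I i) (J i) (P i) (Q i)" if "i \<le> Suc d" for i
    using x[OF that] by (simp add: B_def I_def J_def P_def Q_def split_def)
  define E where "E i = ext_S I (Suc i) \<star> ng (ext_S G (Suc i)) \<star> P i +\<^sub>a
      (ext_S J (Suc i) \<star> \<Phi> (Suc i) \<star> P i +\<^sub>a ext_S J (Suc i) \<star> H i \<star> Q i)" for i
  define B' where "B' i = (if i \<le> Suc d then B i else fob S (B 0))" for i
  have b': "biprod (cd (ext_S G (Suc i))) (cd (H i)) (B' (Suc i)) (ext_S I (Suc i)) (ext_S J (Suc i)) (ext_S P (Suc i)) (ext_S Q (Suc i))"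
    if "i \<le> Suc d" for i
    using b[of "Suc i"] S_arr_biprod[OF b[of 0]] that t(2,3) by (cases "i = Suc d") (auto simp: ext_S_def B'_def)
  have f: "arr (\<Phi> (Suc i))" "dm (\<Phi> (Suc i)) = cd (G i)" "cd (\<Phi> (Suc i)) = cd (H i)"
    "arr (ext_S G (Suc i))" "dm (ext_S G (Suc i)) = cd (G i)" if "i \<le> Suc d" for i
    using \<Phi>(1) s(1)[of "Suc i"] s(1)[of 0] s(2)[of i] s(3) t(2)[of i] t(3) that
    by (cases "i = Suc d"; simp add: ext_S_def seq_mor_def)+
  have dE: "dm (E i) = B i" "cd (E i) = B' (Suc i)" "arr (E i)" if i: "i \<le> Suc d" for i
    using bipD[OF b[OF i]] bipD[OF b'[OF i]] f[OF i] t(1)[OF i] unfolding E_def by simp_all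
  have E: "is_seq E" using dE by (auto simp: is_seq_def B'_def)
  have "angle E"
  proof (rule cone[OF E], intro allI impI conjI)
    fix i assume i: "i \<le> Suc d"
    note [simp] = bipD[OF b[OF i]] bipD[OF b'[OF i]] f[OF i] t(1)[OF i] biprod_reassoc[OF b[OF i]] biprod_reassoc[OF b'[OF i]]
    show "biprod (cd (G i)) (dm (H i)) (dm (E i)) (I i) (J i) (P i) (Q i)" using b[OF i] dE(1)[OF i] by simp
    show "ext_S P (Suc i) \<star> E i \<star> I i = ng (ext_S G (Suc i))" by (simp add: E_def)
    show "ext_S P (Suc i) \<star> E i \<star> J i = zr (dm (H i)) (cd (ext_S G (Suc i)))" by (simp add: E_def)
    show "ext_S Q (Suc i) \<star> E i \<star> I i = \<Phi> (Suc i)" by (simp add: E_def)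
    show "ext_S Q (Suc i) \<star> E i \<star> J i = H i" by (simp add: E_def)
  qed
  moreover have "biprod (cd (G i)) (dm (H i)) (dm (E i)) (I i) (J i) (P i) (Q i)" if "i \<le> Suc d" for i
    using b[OF that] dE(1)[OF that] by simp
  moreover have "\<forall>i\<le>Suc d. E i = ext_S I (Suc i) \<star> ng (ext_S G (Suc i)) \<star> P i +\<^sub>a
      (ext_S J (Suc i) \<star> \<Phi> (Suc i) \<star> P i +\<^sub>a ext_S J (Suc i) \<star> H i \<star> Q i)"
    by (intro allI impI) (rule E_def)
  ultimately show ?thesis using \<Phi> by blast
qed

text \<open>An angle whose connecting morphism restricts to an isomorphism \<open>S L \<rightarrow> S L\<close> splits off a
  rotated trivial angle \<open>L \<rightarrow> 0 \<rightarrow> \<dots> \<rightarrow> 0 \<rightarrow> S L\<close>.\<close>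

lemma angle_cancel:
  assumes E: "angle E" and b0: "biprod M L (dm (E 0)) m j n p"
    and b1: "biprod N (fob S L) (dm (E (Suc d))) m' i n' q"
    and j: "S_arr j = E (Suc d) \<star> i" and q: "q = S_arr p \<star> E (Suc d)"
  shows "\<exists>F. angle F \<and> dm (F 0) = M \<and> (\<forall>k. 1 \<le> k \<longrightarrow> k \<le> d \<longrightarrow> dm (F k) = dm (E k)) \<and> dm (F (Suc d)) = N"
proof -
  note s = seqnD[OF angle_is_seq[OF E]]
  note [simp] = bipD(1-19)[OF b0] bipD(1-19)[OF b1] biprod_reassoc[OF b0] biprod_reassoc[OF b1]
  obtain Z where Z: "is_zero_object C Z" using zero_object by blast
  note [simp] = zero_objectD(1)[OF Z]
  have e0: "arr (E 0)" "cd (E 0) = dm (E (Suc 0))" and e1: "arr (E (Suc d))" "cd (E (Suc d)) = fob S (dm (E 0))"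
    and ed: "arr (E d)" "cd (E d) = dm (E (Suc d))"
    using s(1)[of 0] s(1)[of "Suc d"] s(1)[of d] s(2)[of 0] s(2)[of d] s(3) by auto
  have "dm (E (Suc 0)) \<in> Ob C" using s(1)[of 1] by simp
  note [simp] = e0 e1 ed this
  have qEd: "q \<star> E d = zr (dm (E d)) (fob S L)"
    using comp_zero[OF E, of d] by (simp add: q)
  \<comment> \<open>After applying \<open>S\<close>, the hypothesis on \<open>j\<close> turns this
    into a consecutive composite in the angle; \<open>S\<close> is injective on morphisms.\<close>
  have E0j: "E 0 \<star> j = zr L (cd (E 0))"
  proof (rule S_arr_inj)
    have "S_arr (E 0) \<star> S_arr j = (S_arr (E 0) \<star> E (Suc d)) \<star> i" by (simp add: j)
    then show "S_arr (E 0 \<star> j) = S_arr (zr L (cd (E 0)))" using comp_zero_last[OF E] by simp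
  qed simp_all
  \<comment> \<open>The complement keeps the middle terms of \<open>E\<close>; the morphisms at the
    two ends are compressed to \<open>M\<close> and \<open>N\<close>.\<close>
  define F where "F k = (if k = 0 then E 0 \<star> m else if k < d then E k else if k = d then n' \<star> E d
    else S_arr n \<star> E (Suc d) \<star> m')" for k
  define R where "R k = (if k = 0 then zr L Z else if k < d then zr Z Z else if k = d then zr Z (fob S L)
    else idn (fob S L))" for k
  define ix where "ix k = (if k = 0 then m else if k \<le> d then idn (dm (E k)) else if k = Suc d then m' else S_arr m)" for k
  define px where "px k = (if k = 0 then n else if k \<le> d then idn (dm (E k)) else if k = Suc d then n' else S_arr n)" for k
  define iy where "iy k = (if k = 0 then j else if k \<le> d then zr Z (dm (E k)) else if k = Suc d then i else S_arr j)" for k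
  define py where "py k = (if k = 0 then p else if k \<le> d then zr (dm (E k)) Z else if k = Suc d then q else S_arr p)" for k
  have arrE: "arr (E k)" "cd (E k) = dm (E (Suc k))" "dm (E (Suc k)) \<in> Ob C" if "k \<le> d" for k
    using s that arr_Ob(2)[of "E k"] by auto
  have dF: "dm (F 0) = M" "dm (F k) = dm (E k)" "dm (F (Suc d)) = N" if "1 \<le> k" "k \<le> d" for k
    using that d_pos by (auto simp: F_def)
  have F: "is_seq F"
    unfolding is_seq_def
  proof (intro conjI allI impI)
    fix k show "arr (F k)" if "k \<le> Suc d" using that arrE[of k] by (auto simp: F_def)
    show "cd (F k) = dm (F (Suc k))" if "k \<le> d" using that arrE[of k] d_pos by (auto simp: F_def)
    show "cd (F (Suc d)) = fob S (dm (F 0))" by (simp add: F_def)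
  qed
  have R: "is_seq R" unfolding is_seq_def using d_pos by (auto simp: R_def)
  have mi: "m' \<star> n' +\<^sub>a i \<star> q = idn (dm (E (Suc d)))" and mj: "m \<star> n +\<^sub>a j \<star> p = idn (dm (E 0))"
    using bipD(20)[OF b1] bipD(20)[OF b0] by auto
  have mEd: "m' \<star> n' \<star> E d = E d"
  proof -
    have "(m' \<star> n' +\<^sub>a i \<star> q) \<star> E d = E d" unfolding mi by simp
    then show ?thesis by (simp add: qEd)
  qed
  \<comment> \<open>Replacing \<open>m \<star> n\<close> by the identity of \<open>dm (E 0)\<close>
    costs a term that contains \<open>S_arr p \<star> E (Suc d) \<star> m'\<close>, which is
    \<open>q \<star> m' = 0\<close>.\<close>
  have SmE: "S_arr m \<star> S_arr n \<star> E (Suc d) \<star> m' = E (Suc d) \<star> m'"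
  proof -
    have "S_arr (m \<star> n +\<^sub>a j \<star> p) \<star> E (Suc d) \<star> m' = E (Suc d) \<star> m'" unfolding mj by simp
    moreover have "S_arr p \<star> E (Suc d) \<star> m' = q \<star> m'" by (simp add: q)
    ultimately show ?thesis by simp
  qed
  have Enm: "S_arr n \<star> E (Suc d) \<star> m' \<star> n' = S_arr n \<star> E (Suc d)"
  proof -
    have "S_arr n \<star> E (Suc d) \<star> (m' \<star> n' +\<^sub>a i \<star> q) = S_arr n \<star> E (Suc d)" unfolding mi by simp
    moreover have "S_arr n \<star> E (Suc d) \<star> i \<star> q = (S_arr n \<star> S_arr j) \<star> q" by (simp add: j)
    moreover have "S_arr n \<star> S_arr j = zr (fob S L) (fob S M)" using bipD(18)[OF S_arr_biprod[OF b0]] .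
    ultimately show ?thesis by simp
  qed
  have E0mn: "E 0 \<star> m \<star> n = E 0"
  proof -
    have "E 0 \<star> (m \<star> n +\<^sub>a j \<star> p) = E 0" unfolding mj by simp
    moreover have "E 0 \<star> j \<star> p = (E 0 \<star> j) \<star> p" by simp
    ultimately show ?thesis by (simp add: E0j)
  qed
  have cases: "k = 0 \<or> (1 \<le> k \<and> k < d) \<or> (1 \<le> k \<and> k = d) \<or> k = Suc d" if "k \<le> Suc d" for k :: nat
    using that by linarith
  have 1: "seq_mor F E ix"
    unfolding seq_mor_def
  proof (intro conjI allI impI)
    show "ix (Suc (Suc d)) = S_arr (ix 0)" by (simp add: ix_def)
    fix k assume k: "k \<le> Suc d"
    show "arr (ix k)" "dm (ix k) = dm (F k)" "cd (ix k) = dm (E k)"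
      using k arrE[of k] d_pos by (auto simp: ix_def F_def le_Suc_eq)
    show "ix (Suc k) \<star> F k = E k \<star> ix k"
      using cases[OF k] arrE[of k] d_pos by (auto simp: ix_def F_def mEd SmE)
  qed
  have 2: "seq_mor R E iy"
    unfolding seq_mor_def
  proof (intro conjI allI impI)
    show "iy (Suc (Suc d)) = S_arr (iy 0)" by (simp add: iy_def)
    fix k assume k: "k \<le> Suc d"
    show "arr (iy k)" "dm (iy k) = dm (R k)" "cd (iy k) = dm (E k)"
      using k arrE[of k] d_pos by (auto simp: iy_def R_def le_Suc_eq)
    show "iy (Suc k) \<star> R k = E k \<star> iy k"
      using cases[OF k] arrE[of k] d_pos by (auto simp: iy_def R_def E0j j)
  qed
  have 3: "seq_mor E F px"
    unfolding seq_mor_def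
  proof (intro conjI allI impI)
    show "px (Suc (Suc d)) = S_arr (px 0)" by (simp add: px_def)
    fix k assume k: "k \<le> Suc d"
    show "arr (px k)" "dm (px k) = dm (E k)" "cd (px k) = dm (F k)"
      using k arrE[of k] d_pos by (auto simp: px_def F_def le_Suc_eq)
    show "px (Suc k) \<star> E k = F k \<star> px k"
      using cases[OF k] arrE[of k] d_pos by (auto simp: px_def F_def Enm E0mn)
  qed
  have 4: "seq_mor E R py"
    unfolding seq_mor_def
  proof (intro conjI allI impI)
    show "py (Suc (Suc d)) = S_arr (py 0)" by (simp add: py_def)
    fix k assume k: "k \<le> Suc d"
    show "arr (py k)" "dm (py k) = dm (E k)" "cd (py k) = dm (R k)"
      using k arrE[of k] d_pos by (auto simp: py_def R_def le_Suc_eq)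
    show "py (Suc k) \<star> E k = R k \<star> py k"
      using cases[OF k] arrE[of k] d_pos by (auto simp: py_def R_def qEd simp flip: q)
  qed
  have "biprod (dm (F k)) (dm (R k)) (dm (E k)) (ix k) (iy k) (px k) (py k)" if k: "k \<le> Suc d" for k
  proof -
    have "biprod (dm (E k)) Z (dm (E k)) (idn (dm (E k))) (zr Z (dm (E k))) (idn (dm (E k))) (zr (dm (E k)) Z)"
      using zero_biprod[OF Z mutual_inv_refl[of "dm (E k)"]] s(1)[OF k] by simp
    note z = this
    consider "k = 0" | "1 \<le> k" "k \<le> d" | "k = Suc d" using k by linarith
    then show ?thesis
    proof cases
      case 1
      then show ?thesis using b0 by (simp add: F_def R_def ix_def iy_def px_def py_def)
    next
      case 2
      have "dm (R k) = Z" using 2 by (simp add: R_def)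
      moreover have "ix k = idn (dm (E k))" "iy k = zr Z (dm (E k))" "px k = idn (dm (E k))" "py k = zr (dm (E k)) Z"
        using 2 by (simp_all add: ix_def iy_def px_def py_def)
      ultimately show ?thesis using z unfolding dF(2)[OF 2] by (simp only:)
    next
      case 3
      then show ?thesis using b1 by (simp add: F_def R_def ix_def iy_def px_def py_def)
    qed
  qed
  \<comment> \<open>The direction from the sum to its summands: \<open>R\<close> enters only as a
    sequence complementary to \<open>F\<close> in the angle \<open>E\<close>.\<close>
  from angle_sum[OF F R angle_is_seq[OF E] 1 2 3 4 this] E have "angle F" by simp
  moreover have "dm (F 0) = M" "dm (F (Suc d)) = N" using dF(1,3)[of 1] d_pos by simp_all
  ultimately show ?thesis using dF(2) by (intro exI[of _ F] conjI allI impI)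
qed

text \<open>Trades the leading term L of \<open>G\<close> for its coresolution \<open>W\<close>. In
  the cone over the identity of L, this object appears in degree 0 and its image under
  \<open>S\<close> in degree \<open>d + 1\<close>, and the entry of the connecting morphism between
  these copies is the identity. Cancelling them leaves the terms listed, where \<open>G\<close> is
  shifted by one against \<open>W\<close>.\<close>

lemma angle_replace:
  assumes G: "angle G" and W: "angle W" and W0: "dm (W 0) = dm (G 0)"
    and z: "\<And>R. arr R \<Longrightarrow> dm R = dm (G (Suc d)) \<Longrightarrow> cd R = fob S (cd (W 0)) \<Longrightarrow> R = zr (dm R) (cd R)"
  shows "\<exists>F. angle F \<and> dm (F 0) = dm (G 1) \<and> dm (F (Suc d)) = dm (W (Suc d)) \<and>
    (\<forall>k. 1 \<le> k \<longrightarrow> k \<le> d \<longrightarrow> (\<exists>I J P Q. biprod (dm (G (Suc k))) (dm (W k)) (dm (F k)) I J P Q))"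
proof -
  note s = seqnD[OF angle_is_seq[OF G]] and t = seqnD[OF angle_is_seq[OF W]]
  let ?L = "dm (G 0)"
  have g: "arr (G 0)" "cd (G 0) = dm (G 1)" "arr (W 0)" "cd (W 0) = dm (W 1)" "dm (W 0) = ?L"
    "arr (G (Suc d))" "cd (G (Suc d)) = fob S ?L" "arr (W (Suc d))" "cd (W (Suc d)) = fob S ?L"
    using s(1)[of 0] s(2)[of 0] t(1)[of 0] t(2)[of 0] s(1)[of "Suc d"] s(3) t(1)[of "Suc d"] t(3) W0 by auto
  \<comment> \<open>The obstruction to extending \<open>W 0\<close> along \<open>G 0\<close> is a
    morphism from the last term of \<open>G\<close> to the image under \<open>S\<close> of the
    target of \<open>W 0\<close>, hence zero by \<open>z\<close>.\<close>
  obtain P1 where P1: "arr P1" "dm P1 = cd (G 0)" "cd P1 = cd (W 0)" "W 0 = P1 \<star> G 0"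
    using extend_along[OF G g(3) W0 z] by blast
  have LO: "?L \<in> Ob C" using g by simp
  have i: "arr (idn ?L)" "dm (idn ?L) = ?L" "cd (idn ?L) = dm (W 0)" using LO W0 by simp_all
  have e: "P1 \<star> G 0 = W 0 \<star> idn ?L" using P1(4) g by simp
  obtain \<Phi> E I J P Q where \<Phi>: "seq_mor G W \<Phi>" "\<Phi> 0 = idn ?L" "\<Phi> 1 = P1" and E: "angle E" and
    bb: "\<forall>i\<le>Suc d. biprod (cd (G i)) (dm (W i)) (dm (E i)) (I i) (J i) (P i) (Q i)" and
    eq: "\<forall>i\<le>Suc d. E i = ext_S I (Suc i) \<star> ng (ext_S G (Suc i)) \<star> P i +\<^sub>a
      (ext_S J (Suc i) \<star> \<Phi> (Suc i) \<star> P i +\<^sub>a ext_S J (Suc i) \<star> W i \<star> Q i)"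
    using angle_cone[OF G W i P1(1,2,3) e] by blast
  note b = bb[rule_format]
  have b0: "biprod (dm (G 1)) ?L (dm (E 0)) (I 0) (J 0) (P 0) (Q 0)" using b[of 0] g by simp
  have b1: "biprod (fob S ?L) (dm (W (Suc d))) (dm (E (Suc d))) (I (Suc d)) (J (Suc d)) (P (Suc d)) (Q (Suc d))"
    using b[of "Suc d"] g by simp
  note [simp] = bipD(1-19)[OF b0] bipD(1-19)[OF b1] biprod_reassoc[OF b0] biprod_reassoc[OF b1] g(1-3,5-9)
    bipD(1-19)[OF S_arr_biprod[OF b0]] biprod_reassoc[OF S_arr_biprod[OF b0]]
  have Elast: "E (Suc d) = S_arr (I 0) \<star> ng (S_arr (G 0)) \<star> P (Suc d) +\<^sub>a
      (S_arr (J 0) \<star> P (Suc d) +\<^sub>a S_arr (J 0) \<star> W (Suc d) \<star> Q (Suc d))"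
    using eq[rule_format, of "Suc d"] \<Phi>(1,2) LO by (simp add: ext_S_def seq_mor_def)
  have gc: "dm (G 0) = ?L" "cd (G 0) = dm (G 1)" using g by simp_all
  \<comment> \<open>Beside the identity entry the connecting morphism has the entries
    \<open>- S_arr (G 0)\<close> and \<open>W (Suc d)\<close>. Shearing the biproducts in degrees 0
    and \<open>d + 1\<close> clears both, as \<open>j\<close> and \<open>q\<close> record in the
    form required for cancellation.\<close>
  have s0: "biprod (dm (G 1)) ?L (dm (E 0)) (I 0) (J 0 +\<^sub>a ng (I 0 \<star> G 0)) (P 0 +\<^sub>a G 0 \<star> Q 0) (Q 0)"
    by (rule biprod_shear[OF b0]) (use g in auto)
  have s1: "biprod (fob S ?L) (dm (W (Suc d))) (dm (E (Suc d))) (I (Suc d)) (J (Suc d) +\<^sub>a ng (I (Suc d) \<star> W (Suc d)))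
      (P (Suc d) +\<^sub>a W (Suc d) \<star> Q (Suc d)) (Q (Suc d))"
    by (rule biprod_shear[OF b1]) (use g in auto)
  have j: "S_arr (J 0 +\<^sub>a ng (I 0 \<star> G 0)) = E (Suc d) \<star> I (Suc d)"
    unfolding Elast using gc by (simp add: pl_comm)
  have q: "P (Suc d) +\<^sub>a W (Suc d) \<star> Q (Suc d) = S_arr (Q 0) \<star> E (Suc d)"
    unfolding Elast using gc by simp
  obtain F where "angle F" "dm (F 0) = dm (G 1)" "\<forall>k. 1 \<le> k \<longrightarrow> k \<le> d \<longrightarrow> dm (F k) = dm (E k)"
    "dm (F (Suc d)) = dm (W (Suc d))"
    using angle_cancel[OF E s0 biprod_swap[OF s1] j q] by blast
  moreover have "\<exists>I J P Q. biprod (dm (G (Suc k))) (dm (W k)) (dm (E k)) I J P Q" if "k \<le> d" for k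
    using b[of k] s(2)[OF that] that by auto
  ultimately show ?thesis by (intro exI[of _ F]) auto
qed

text \<open>The biproducts are prescribed from outside, so that the sum of two coresolutions can
  start at a given biproduct of the two objects.\<close>

lemma angle_direct_sum:
  assumes G: "angle G" and H: "angle H" 
    and b: "\<And>i. i \<le> Suc d \<Longrightarrow> biprod (dm (G i)) (dm (H i)) (B i) (I i) (J i) (P i) (Q i)"
  shows "\<exists>E. angle E \<and> (\<forall>i\<le>Suc d. dm (E i) = B i)"
proof -
  note s = seqnD[OF angle_is_seq[OF G]] and t = seqnD[OF angle_is_seq[OF H]]
  define I' J' P' Q' where "I' i = (if i \<le> Suc d then I i else S_arr (I 0))"
    and "J' i = (if i \<le> Suc d then J i else S_arr (J 0))" and "P' i = (if i \<le> Suc d then P i else S_arr (P 0))"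
    and "Q' i = (if i \<le> Suc d then Q i else S_arr (Q 0))" for i
  define B' where "B' i = (if i \<le> Suc d then B i else fob S (B 0))" for i
  have b': "biprod (cd (G i)) (cd (H i)) (B' (Suc i)) (I' (Suc i)) (J' (Suc i)) (P' (Suc i)) (Q' (Suc i))"
    if "i \<le> Suc d" for i
    using b[of "Suc i"] S_arr_biprod[OF b[of 0]] that s(2,3) t(2,3)
    by (cases "i = Suc d") (auto simp: I'_def J'_def P'_def Q'_def B'_def)
  define E where "E i = I' (Suc i) \<star> G i \<star> P i +\<^sub>a J' (Suc i) \<star> H i \<star> Q i" for i
  have dE: "dm (E i) = B i" "cd (E i) = B' (Suc i)" "arr (E i)" if i: "i \<le> Suc d" for i
    using bipD[OF b[OF i]] bipD[OF b'[OF i]] s(1)[OF i] t(1)[OF i] unfolding E_def by simp_all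
  have E: "is_seq E" using dE by (auto simp: is_seq_def B'_def)
  have ms: "arr (I' i) \<and> arr (J' i) \<and> arr (P' i) \<and> arr (Q' i) \<and>
      dm (I' i) = dm (G i) \<and> dm (J' i) = dm (H i) \<and> dm (P' i) = dm (E i) \<and> dm (Q' i) = dm (E i) \<and>
      cd (I' i) = dm (E i) \<and> cd (J' i) = dm (E i) \<and> cd (P' i) = dm (G i) \<and> cd (Q' i) = dm (H i) \<and>
      I' (Suc i) \<star> G i = E i \<star> I' i \<and> J' (Suc i) \<star> H i = E i \<star> J' i \<and>
      P' (Suc i) \<star> E i = G i \<star> P' i \<and> Q' (Suc i) \<star> E i = H i \<star> Q' i" if i: "i \<le> Suc d" for i
  proof -
    have e [simp]: "I' i = I i" "J' i = J i" "P' i = P i" "Q' i = Q i"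
      using i by (simp_all add: I'_def J'_def P'_def Q'_def)
    note [simp] = bipD[OF b[OF i]] bipD[OF b'[OF i]] s(1)[OF i] t(1)[OF i] dE(1)[OF i]
      biprod_reassoc[OF b[OF i]] biprod_reassoc[OF b'[OF i]]
    show ?thesis by (simp add: E_def)
  qed
  have l: "I' (Suc (Suc d)) = S_arr (I' 0)" "J' (Suc (Suc d)) = S_arr (J' 0)" "P' (Suc (Suc d)) = S_arr (P' 0)"
      "Q' (Suc (Suc d)) = S_arr (Q' 0)" by (simp_all add: I'_def J'_def P'_def Q'_def)
  have m: "seq_mor G E I'" "seq_mor H E J'" "seq_mor E G P'" "seq_mor E H Q'"
    unfolding seq_mor_def using ms l by blast+
  have "angle E"
    using angle_sum[OF angle_is_seq[OF G] angle_is_seq[OF H] E m] b dE(1) G H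
    by (auto simp: I'_def J'_def P'_def Q'_def)
  then show ?thesis using dE by blast
qed

end

section \<open>Coindices\<close>

context ring
begin

text \<open>Nested subtraction from the front: dropping the leading term, which is what an exchange
  does to an angle, is a single unfolding with a change of sign.\<close>

primrec alt_sum :: "(nat \<Rightarrow> 'a) \<Rightarrow> nat \<Rightarrow> 'a"
  where "alt_sum v 0 = \<zero>" | "alt_sum v (Suc n) = v 0 \<ominus> alt_sum (\<lambda>i. v (Suc i)) n"

lemma alt_sum_closed [simp]: "(\<And>i. i < n \<Longrightarrow> v i \<in> carrier R) \<Longrightarrow> alt_sum v n \<in> carrier R"
  by (induction n arbitrary: v) auto

lemma alt_sum_cong: "(\<And>i. i < n \<Longrightarrow> v i = w i) \<Longrightarrow> alt_sum v n = alt_sum w n"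
proof (induction n arbitrary: v w)
  case (Suc n)
  from Suc.IH[of "\<lambda>i. v (Suc i)" "\<lambda>i. w (Suc i)"] show ?case using Suc.prems by simp
qed simp

lemma alt_sum_add:
  assumes "\<And>i. i < n \<Longrightarrow> v i \<in> carrier R" "\<And>i. i < n \<Longrightarrow> w i \<in> carrier R"
  shows "alt_sum (\<lambda>i. v i \<oplus> w i) n = alt_sum v n \<oplus> alt_sum w n"
  using assms
proof (induction n arbitrary: v w)
  case (Suc n)
  have "v 0 \<in> carrier R" "w 0 \<in> carrier R" "alt_sum (\<lambda>i. v (Suc i)) n \<in> carrier R" "alt_sum (\<lambda>i. w (Suc i)) n \<in> carrier R"
    using Suc.prems by auto
  moreover have "alt_sum (\<lambda>i. v (Suc i) \<oplus> w (Suc i)) n = alt_sum (\<lambda>i. v (Suc i)) n \<oplus> alt_sum (\<lambda>i. w (Suc i)) n"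
    using Suc by simp
  ultimately show ?case by (simp add: minus_eq minus_add a_ac)
qed simp

lemma alt_sum_zero: "(\<And>i. i < n \<Longrightarrow> v i = \<zero>) \<Longrightarrow> alt_sum v n = \<zero>"
proof (induction n arbitrary: v)
  case (Suc n)
  from Suc.IH[of "\<lambda>i. v (Suc i)"] show ?case using Suc.prems by simp
qed simp

lemma alt_sum_last_zero:
  assumes "\<And>i. i < n \<Longrightarrow> v i \<in> carrier R" "v n = \<zero>" shows "alt_sum v (Suc n) = alt_sum v n"
  using assms
proof (induction n arbitrary: v)
  case (Suc n)
  from Suc.IH[of "\<lambda>i. v (Suc i)"] show ?case using Suc.prems by simp
qed simp

lemma alt_sum_telescope:
  assumes "\<And>i. i \<le> n \<Longrightarrow> b i \<in> carrier R" "\<And>i. i < n \<Longrightarrow> v i = b i \<oplus> b (Suc i)" "b n = \<zero>"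
  shows "alt_sum v n = b 0"
  using assms
proof (induction n arbitrary: v b)
  case (Suc n)
  have "alt_sum (\<lambda>i. v (Suc i)) n = b (Suc 0)"
    using Suc.IH[of "\<lambda>i. b (Suc i)" "\<lambda>i. v (Suc i)"] Suc.prems by simp
  then show ?case using Suc.prems(1)[of 0] Suc.prems(1)[of 1] Suc.prems(2)[of 0]
    by (simp add: minus_eq a_assoc r_neg)
qed simp

end

locale angulated_ks = angulated_category K C S d A + ks_category K C
  for K :: "'k ring" and C :: "('k, 'o, 'm) lincat" (structure) and S :: "('o, 'm) endo"
    and d :: nat and A :: "('o, 'm) sequence set"
begin

text \<open>Such an angle has a contracting homotopy: the identity of each term is a sum of two composites,
  and the cyclic invariance of the trace makes the alternating sum telescope.\<close>

lemma alt_sum_chi_rigid: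
  assumes T: "rigid T" and G: "angle G" and r: "\<And>i. i \<le> Suc d \<Longrightarrow> retract_of T (dm (G i))" and V: "local_ob V"
  shows "K.alt_sum (\<lambda>i. chi V (dm (G i))) (Suc (Suc d)) = \<zero>\<^bsub>K\<^esub>"
proof -
  note s = seqnD[OF angle_is_seq[OF G]]
  have Ob: "dm (G i) \<in> Ob C" if "i \<le> Suc d" for i using s(1)[OF that] by simp
  \<comment> \<open>The homotopy component \<open>\<sigma>\<close> is a generalized inverse of
    \<open>G j\<close>: the equation \<open>G j \<star> \<sigma> \<star> G j = G j\<close> makes the
    complement of \<open>G j \<star> \<sigma>\<close> vanish on \<open>G j\<close>, so that a weak
    cokernel supplies the next component. The guards \<open>j \<le> d\<close> let the choice run
    over all natural numbers.\<close>
  let ?P = "\<lambda>j \<sigma>. j \<le> d \<longrightarrow> arr \<sigma> \<and> dm \<sigma> = cd (G j) \<and> cd \<sigma> = dm (G j) \<and> G j \<star> \<sigma> \<star> G j = G j \<and>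
    (j = 0 \<longrightarrow> \<sigma> \<star> G j = idn (dm (G j)))"
  let ?Q = "\<lambda>j \<sigma> \<sigma>'. Suc j \<le> d \<longrightarrow> idn (cd (G j)) = G j \<star> \<sigma> +\<^sub>a \<sigma>' \<star> G (Suc j)"
  have kill: "(idn (cd (G j)) +\<^sub>a ng (G j \<star> \<sigma>)) \<star> G j = zr (dm (G j)) (cd (G j))"
    if "j \<le> d" "?P j \<sigma>" for j \<sigma>
  proof -
    note [simp] = s(1)[of j]
    show ?thesis using that by simp
  qed
  have "\<exists>f. \<forall>j. ?P j (f j) \<and> ?Q j (f j) (f (Suc j))"
  proof (rule dependent_nat_choice[where P = ?P and Q = ?Q])
    have "\<exists>H. arr H \<and> dm H = cd (G 0) \<and> cd H = cd (idn (dm (G 0))) \<and> idn (dm (G 0)) = H \<star> G 0"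
    proof (rule extend_along[OF G])
      fix R assume "arr R" "dm R = dm (G (Suc d))" "cd R = fob S (cd (idn (dm (G 0))))"
      then show "R = zr (dm R) (cd R)" using rigid_retract_of[OF T r[of "Suc d"] r[of 0], of R] by simp
    qed (use Ob[of 0] in simp_all)
    then obtain H where H: "arr H" "dm H = cd (G 0)" "cd H = dm (G 0)" "idn (dm (G 0)) = H \<star> G 0" by auto
    have "?P 0 H" using H(1-3) H(4)[symmetric] s(1)[of 0] by simp
    then show "\<exists>x. ?P 0 x" by blast
  next
    fix \<sigma> j assume P: "?P j \<sigma>"
    show "\<exists>\<sigma>'. ?P (Suc j) \<sigma>' \<and> ?Q j \<sigma> \<sigma>'"
    proof (cases "Suc j \<le> d")
      case True
      then have [simp]: "arr (G j)" "arr (G (Suc j))" "cd (G j) = dm (G (Suc j))" "arr \<sigma>" "dm \<sigma> = cd (G j)" "cd \<sigma> = dm (G j)"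
        using P s(1)[of j] s(1)[of "Suc j"] s(2)[of j] by auto
      let ?F = "idn (cd (G j)) +\<^sub>a ng (G j \<star> \<sigma>)"
      obtain H where H: "arr H" "dm H = cd (G (Suc j))" "cd H = cd (G j)" "?F = H \<star> G (Suc j)"
        using weak_cokernel[OF G, of j ?F] kill[OF _ P] True by auto
      have "G j \<star> \<sigma> +\<^sub>a H \<star> G (Suc j) = idn (cd (G j))"
        unfolding H(4)[symmetric] by (simp add: pl_comm[of _ "ng _"] pl_lcomm)
      moreover have "G (Suc j) \<star> H \<star> G (Suc j) = G (Suc j)"
      proof -
        have "(G (Suc j) \<star> G j) \<star> \<sigma> = zr (dm (G (Suc j))) (cd (G (Suc j)))"
          using comp_zero[OF G, of j] True by simp
        then have "G (Suc j) \<star> ?F = G (Suc j)" by simp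
        then show ?thesis unfolding H(4) .
      qed
      ultimately show ?thesis using H by (intro exI[of _ H]) simp
    qed simp
  qed
  then obtain f where P: "\<And>j. ?P j (f j)" and Q: "\<And>j. ?Q j (f j) (f (Suc j))" by blast
  \<comment> \<open>\<open>G j \<star> f j\<close> is an idempotent of
    \<open>dm (G (Suc j))\<close>, and its trace is the part shared by the multiplicities of the
    terms \<open>j\<close> and \<open>Suc j\<close>. The index is shifted by one to leave room for
    the zeros at both ends.\<close>
  define b where "b i = (if i = 0 \<or> i = Suc (Suc d) then \<zero>\<^bsub>K\<^esub> else trace V (G (i - 1) \<star> f (i - 1)))" for i
  have f: "arr (f j)" "dm (f j) = cd (G j)" "cd (f j) = dm (G j)" "arr (G j)" "cd (G j) = dm (G (Suc j))"
    if "j \<le> d" for j using P[of j] s(1,2)[of j] that by auto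
  have tc: "trace V (G j \<star> f j) \<in> carrier K" if "j \<le> d" for j
    by (rule trace_closed[OF V, of "cd (G j)"]) (use f[OF that] in \<open>simp add: end_arr_def\<close>)
  have "K.alt_sum (\<lambda>i. chi V (dm (G i))) (Suc (Suc d)) = b 0"
  proof (rule K.alt_sum_telescope)
    show "b i \<in> carrier K" if "i \<le> Suc (Suc d)" for i using that tc[of "i - 1"] by (auto simp: b_def)
    show "b (Suc (Suc d)) = \<zero>\<^bsub>K\<^esub>" by (simp add: b_def)
    fix i assume "i < Suc (Suc d)"
    then consider "i = 0" | j where "i = Suc j" "Suc j \<le> d" | "i = Suc d" by (cases i) (auto simp: less_Suc_eq)
    then show "chi V (dm (G i)) = b i \<oplus>\<^bsub>K\<^esub> b (Suc i)"
    proof cases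
      case 1
      have "chi V (dm (G 0)) = trace V (f 0 \<star> G 0)" using P[of 0] by (simp add: chi_def)
      also have "\<dots> = trace V (G 0 \<star> f 0)" by (rule trace_comm[OF V]) (use f[of 0] in simp_all)
      finally show ?thesis using 1 tc[of 0] by (simp add: b_def)
    next
      case (2 j)
      note [simp] = f(1-4)[of j] f(1-4)[of "Suc j"]
      have fj: "j \<le> d" using 2 by simp
      have "chi V (dm (G i)) = trace V (G j \<star> f j +\<^sub>a f (Suc j) \<star> G (Suc j))"
        using Q[of j] f(5)[of j] 2 by (simp add: chi_def)
      also have "\<dots> = trace V (G j \<star> f j) \<oplus>\<^bsub>K\<^esub> trace V (f (Suc j) \<star> G (Suc j))"
        by (rule trace_add[OF V, of "cd (G j)"]) (use 2 fj f(5)[of j] in \<open>simp_all add: end_arr_def\<close>)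
      also have "trace V (f (Suc j) \<star> G (Suc j)) = trace V (G (Suc j) \<star> f (Suc j))"
        by (rule trace_comm[OF V]) (use 2 in simp_all)
      finally show ?thesis using 2 by (simp add: b_def)
    next
      case 3
      note [simp] = f[of d] s(1)[of "Suc d"]
      have "\<exists>H. arr H \<and> dm H = cd (G (Suc d)) \<and> cd H = cd (idn (cd (G d)) +\<^sub>a ng (G d \<star> f d)) \<and>
          idn (cd (G d)) +\<^sub>a ng (G d \<star> f d) = H \<star> G (Suc d)"
        by (rule weak_cokernel[OF G, of d]) (use kill[OF _ P, of d] in simp_all)
      then obtain H where H: "arr H" "dm H = cd (G (Suc d))" "idn (cd (G d)) +\<^sub>a ng (G d \<star> f d) = H \<star> G (Suc d)" by blast
      \<comment> \<open>Both ends of the connecting morphism are covered by rigidity. Hence the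
        complement of the last idempotent factors through zero, and the telescope ends here.\<close>
      have "G (Suc d) = zr (dm (G (Suc d))) (cd (G (Suc d)))"
        using rigid_retract_of[OF T r[of "Suc d"] r[of 0], of "G (Suc d)"] s(3) by simp
      then have "H \<star> G (Suc d) = zr (dm (G (Suc d))) (cd H)" using H cp_zr[of H "cd (G (Suc d))" "dm (G (Suc d))"] by simp
      then have z: "idn (cd (G d)) +\<^sub>a ng (G d \<star> f d) = zr (cd (G d)) (cd (G d))"
        using H(3) by (metis dm_cd f(5) order_refl)
      have "G d \<star> f d +\<^sub>a (idn (cd (G d)) +\<^sub>a ng (G d \<star> f d)) = idn (cd (G d))"
        by (simp add: pl_comm[of _ "ng _"])
      then have "idn (cd (G d)) = G d \<star> f d" unfolding z by simp
      then have "chi V (dm (G (Suc d))) = trace V (G d \<star> f d)" using f(5)[of d] by (simp add: chi_def)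
      then show ?thesis using 3 tc[of d] by (simp add: b_def)
    qed
  qed
  then show ?thesis by (simp add: b_def)
qed

definition coindex :: "'o \<Rightarrow> 'o \<Rightarrow> ('o \<Rightarrow> 'k) \<Rightarrow> bool"
  where "coindex T M v \<longleftrightarrow> (\<exists>W. angle W \<and> dm (W 0) = M \<and> (\<forall>i\<le>d. retract_of T (dm (W (Suc i)))) \<and>
    (\<forall>V. local_ob V \<longrightarrow> v V = K.alt_sum (\<lambda>i. chi V (dm (W (Suc i)))) (Suc d)))"

lemma coindex_closed:
  assumes "coindex T M v" "local_ob V" shows "v V \<in> carrier K"
proof -
  obtain W where W: "angle W" "\<forall>i\<le>d. retract_of T (dm (W (Suc i)))" "v V = K.alt_sum (\<lambda>i. chi V (dm (W (Suc i)))) (Suc d)"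
    using assms unfolding coindex_def by blast
  have "dm (W (Suc i)) \<in> Ob C" if "i < Suc d" for i using W(2) retract_of_Ob[of T] that by simp
  then show ?thesis unfolding W(3) using assms(2) by (intro K.alt_sum_closed chi_closed)
qed

text \<open>The trivial angle is a coresolution of \<open>M\<close> by \<open>M\<close> itself and
  zero objects.\<close>

lemma coindex_retract_of:
  assumes M: "retract_of T M" shows "coindex T M (\<lambda>V. chi V M)"
proof -
  obtain Z where Z: "is_zero_object C Z" using zero_object by blast
  have "retract_of T (dm (trivial_seq Z M (Suc i)))" if "i \<le> d" for i
    using that M retract_of_zero[OF Z] by (auto simp: trivial_seq_def)
  moreover have "chi V M = K.alt_sum (\<lambda>i. chi V (dm (trivial_seq Z M (Suc i)))) (Suc d)" if V: "local_ob V" for V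
  proof -
    have "K.alt_sum (\<lambda>i. chi V (dm (trivial_seq Z M (Suc (Suc i))))) d = \<zero>\<^bsub>K\<^esub>"
      using chi_zero[OF V Z] by (intro K.alt_sum_zero) (simp add: trivial_seq_def)
    then show ?thesis using chi_closed[OF V retract_of_Ob[OF M]] by (simp add: trivial_seq_def K.minus_eq)
  qed
  moreover have "dm (trivial_seq Z M 0) = M" by (simp add: trivial_seq_def)
  ultimately show ?thesis unfolding coindex_def using angle_trivial_seq[OF retract_of_Ob[OF M] Z] by blast
qed

lemma coindex_biprod:
  assumes M: "coindex T M v" and N: "coindex T N w" and b: "biprod M N B I J P Q"
  shows "coindex T B (\<lambda>V. v V \<oplus>\<^bsub>K\<^esub> w V)"
proof -
  obtain G where G: "angle G" "dm (G 0) = M" "\<forall>i\<le>d. retract_of T (dm (G (Suc i)))"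
    "\<And>V. local_ob V \<Longrightarrow> v V = K.alt_sum (\<lambda>i. chi V (dm (G (Suc i)))) (Suc d)"
    using M unfolding coindex_def by blast
  obtain H where H: "angle H" "dm (H 0) = N" "\<forall>i\<le>d. retract_of T (dm (H (Suc i)))"
    "\<And>V. local_ob V \<Longrightarrow> w V = K.alt_sum (\<lambda>i. chi V (dm (H (Suc i)))) (Suc d)"
    using N unfolding coindex_def by blast
  note s = seqnD[OF angle_is_seq[OF G(1)]] and t = seqnD[OF angle_is_seq[OF H(1)]]
  \<comment> \<open>In degree 0 the given biproduct must be taken, because the resulting angle has
    to start at \<open>B\<close>; in the other degrees any choice will do.\<close>
  have "\<exists>x. i \<le> Suc d \<longrightarrow> (case x of (B', I, J, P, Q) \<Rightarrow>
      biprod (dm (G i)) (dm (H i)) B' I J P Q \<and> (i = 0 \<longrightarrow> B' = B))" for i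
  proof (cases "i = 0")
    case True
    then show ?thesis using b G(2) H(2) by (intro exI[of _ "(B, I, J, P, Q)"]) simp
  next
    case False
    have "\<exists>B I J P Q. biprod (dm (G i)) (dm (H i)) B I J P Q" if "i \<le> Suc d"
      using ex_biprod s(1)[OF that] t(1)[OF that] by simp
    then show ?thesis using False by auto
  qed
  then have "\<forall>i. \<exists>x. i \<le> Suc d \<longrightarrow> (case x of (B', I, J, P, Q) \<Rightarrow>
      biprod (dm (G i)) (dm (H i)) B' I J P Q \<and> (i = 0 \<longrightarrow> B' = B))" by (rule allI)
  from choice[OF this] obtain x where x: "\<And>i. i \<le> Suc d \<Longrightarrow> (case x i of (B', I, J, P, Q) \<Rightarrow>
      biprod (dm (G i)) (dm (H i)) B' I J P Q \<and> (i = 0 \<longrightarrow> B' = B))"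
    by blast
  define B' where "B' i = fst (x i)" for i
  have b': "biprod (dm (G i)) (dm (H i)) (B' i) (fst (snd (x i))) (fst (snd (snd (x i))))
      (fst (snd (snd (snd (x i))))) (snd (snd (snd (snd (x i)))))" if "i \<le> Suc d" for i
    using x[OF that] by (simp add: B'_def split_def)
  have B0: "B' 0 = B" using x[of 0] by (simp add: B'_def split_def)
  obtain E where E: "angle E" "\<And>i. i \<le> Suc d \<Longrightarrow> dm (E i) = B' i"
    using angle_direct_sum[OF G(1) H(1) b'] by blast
  have "retract_of T (dm (E (Suc i)))" if "i \<le> d" for i
    using retract_of_biprod[OF b'[of "Suc i"], of T] G(3) H(3) E(2)[of "Suc i"] that by simp
  moreover have "v V \<oplus>\<^bsub>K\<^esub> w V = K.alt_sum (\<lambda>i. chi V (dm (E (Suc i)))) (Suc d)" if V: "local_ob V" for V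
  proof -
    have c: "chi V (dm (G (Suc i))) \<in> carrier K" "chi V (dm (H (Suc i))) \<in> carrier K" if "i < Suc d" for i
      using that chi_closed[OF V] s(1)[of "Suc i"] t(1)[of "Suc i"] by auto
    have "K.alt_sum (\<lambda>i. chi V (dm (E (Suc i)))) (Suc d) =
        K.alt_sum (\<lambda>i. chi V (dm (G (Suc i))) \<oplus>\<^bsub>K\<^esub> chi V (dm (H (Suc i)))) (Suc d)"
    proof (rule K.alt_sum_cong)
      fix i assume "i < Suc d"
      then show "chi V (dm (E (Suc i))) = chi V (dm (G (Suc i))) \<oplus>\<^bsub>K\<^esub> chi V (dm (H (Suc i)))"
        using E(2)[of "Suc i"] chi_biprod[OF V b'[of "Suc i"]] by simp
    qed
    also have "\<dots> = v V \<oplus>\<^bsub>K\<^esub> w V" unfolding G(4)[OF V] H(4)[OF V] using c by (intro K.alt_sum_add)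
    finally show ?thesis ..
  qed
  ultimately show ?thesis unfolding coindex_def using E(1) E(2)[of 0] B0 by auto
qed

text \<open>Induction on the number of terms outside the retract closure of \<open>T\<close>: the leading term of the
  angle is traded for its coresolution, which turns the alternating sum into its negative.\<close>

lemma alt_sum_coindex:
  assumes T: "rigid T" and V: "local_ob V"
  shows "k \<le> Suc d \<Longrightarrow> angle G \<Longrightarrow> (\<And>i. i < k \<Longrightarrow> coindex T (dm (G i)) (v i)) \<Longrightarrow>
    (\<And>i. k \<le> i \<Longrightarrow> i \<le> Suc d \<Longrightarrow> retract_of T (dm (G i)) \<and> (\<forall>V. local_ob V \<longrightarrow> v i V = chi V (dm (G i)))) \<Longrightarrow>
    K.alt_sum (\<lambda>i. v i V) (Suc (Suc d)) = \<zero>\<^bsub>K\<^esub>"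
proof (induction k arbitrary: G v)
  case 0
  have "K.alt_sum (\<lambda>i. v i V) (Suc (Suc d)) = K.alt_sum (\<lambda>i. chi V (dm (G i))) (Suc (Suc d))"
    using 0(4) V by (intro K.alt_sum_cong) simp
  then show ?case using alt_sum_chi_rigid[OF T 0(2) _ V] 0(4) by simp
next
  case (Suc k)
  note s = seqnD[OF angle_is_seq[OF Suc.prems(2)]]
  obtain W where W: "angle W" "dm (W 0) = dm (G 0)" "\<forall>i\<le>d. retract_of T (dm (W (Suc i)))"
    "v 0 V = K.alt_sum (\<lambda>i. chi V (dm (W (Suc i)))) (Suc d)"
    using Suc.prems(3)[of 0] V unfolding coindex_def by blast
  note t = seqnD[OF angle_is_seq[OF W(1)]]
  \<comment> \<open>Because \<open>Suc k \<le> Suc d\<close>, the last term of \<open>G\<close> is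
    among those already in the retract closure, so the obstruction in \<open>angle_replace\<close>
    vanishes.\<close>
  have rlast: "retract_of T (dm (G (Suc d)))" using Suc.prems(1,4) by simp
  have rW: "retract_of T (dm (W i))" if "1 \<le> i" "i \<le> Suc d" for i using W(3) that by (cases i) auto
  obtain F where F: "angle F" "dm (F 0) = dm (G 1)" "dm (F (Suc d)) = dm (W (Suc d))"
    "\<And>k. 1 \<le> k \<Longrightarrow> k \<le> d \<Longrightarrow> \<exists>I J P Q. biprod (dm (G (Suc k))) (dm (W k)) (dm (F k)) I J P Q"
  proof -
    have "R = zr (dm R) (cd R)" if "arr R" "dm R = dm (G (Suc d))" "cd R = fob S (cd (W 0))" for R
      using rigid_retract_of[OF T rlast rW[of 1], of R] that t(2)[of 0] by simp
    then show thesis using angle_replace[OF Suc.prems(2) W(1,2)] that by blast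
  qed
  \<comment> \<open>Term \<open>i\<close> of \<open>F\<close> combines term \<open>Suc i\<close> of
    \<open>G\<close> with term \<open>i\<close> of \<open>W\<close>. At the two ends one of them is
    missing: these are the copies cancelled in the exchange.\<close>
  define v' where "v' i = (if i = 0 then v 1 else if i \<le> d then (\<lambda>V. v (Suc i) V \<oplus>\<^bsub>K\<^esub> chi V (dm (W i)))
    else (\<lambda>V. chi V (dm (W i))))" for i
  have IH: "K.alt_sum (\<lambda>i. v' i V) (Suc (Suc d)) = \<zero>\<^bsub>K\<^esub>"
  proof (rule Suc.IH[OF _ F(1)])
    show "k \<le> Suc d" using Suc.prems(1) by simp
    fix i
    {
      assume i: "i < k"
      then have c: "coindex T (dm (G (Suc i))) (v (Suc i))" using Suc.prems(3) by simp
      show "coindex T (dm (F i)) (v' i)"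
      proof (cases "i = 0")
        case True
        then show ?thesis using c F(2) by (simp add: v'_def)
      next
        case False
        then obtain I J P Q where b: "biprod (dm (G (Suc i))) (dm (W i)) (dm (F i)) I J P Q"
          using F(4)[of i] i Suc.prems(1) by auto
        have "coindex T (dm (F i)) (\<lambda>V. v (Suc i) V \<oplus>\<^bsub>K\<^esub> chi V (dm (W i)))"
          using coindex_biprod[OF c coindex_retract_of[OF rW[of i]] b] False i Suc.prems(1) by simp
        then show ?thesis using False i Suc.prems(1) by (simp add: v'_def)
      qed
    next
      assume i: "k \<le> i" "i \<le> Suc d"
      consider "i = 0" | "1 \<le> i" "i \<le> d" | "i = Suc d" using i by linarith
      then show "retract_of T (dm (F i)) \<and> (\<forall>V. local_ob V \<longrightarrow> v' i V = chi V (dm (F i)))"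
      proof cases
        case 1
        then show ?thesis using Suc.prems(4)[of 1] i F(2) by (simp add: v'_def)
      next
        case 2
        then obtain I J P Q where b: "biprod (dm (G (Suc i))) (dm (W i)) (dm (F i)) I J P Q"
          using F(4)[of i] by auto
        have g: "retract_of T (dm (G (Suc i)))" "\<And>V. local_ob V \<Longrightarrow> v (Suc i) V = chi V (dm (G (Suc i)))"
          using Suc.prems(4)[of "Suc i"] i 2 by auto
        have "retract_of T (dm (F i))" using retract_of_biprod[OF b g(1) rW] 2 by simp
        moreover have "v' i V = chi V (dm (F i))" if "local_ob V" for V
          using chi_biprod[OF that b] g(2)[OF that] 2 by (simp add: v'_def)
        ultimately show ?thesis by blast
      next
        case 3
        then show ?thesis using rW[of i] F(3) by (simp add: v'_def)
      qed
    }
  qed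
  have vc: "v i V \<in> carrier K" if "i \<le> Suc d" for i
    using coindex_closed[OF Suc.prems(3) V, of i] Suc.prems(4)[of i] chi_closed[OF V, of "dm (G i)"] V s(1)[OF that] that
    by (cases "i < Suc k") auto
  have wc: "chi V (dm (W i)) \<in> carrier K" if "i \<le> Suc d" for i
    using chi_closed[OF V, of "dm (W i)"] t(1)[OF that] by simp
  \<comment> \<open>The values \<open>v'\<close> are split into the shifted values of
    \<open>G\<close>, padded by zero at the end, and those of \<open>W\<close>, padded by zero at
    the start, so that both sequences have the same length.\<close>
  define a where "a i = (if i \<le> d then v (Suc i) V else \<zero>\<^bsub>K\<^esub>)" for i
  define w where "w i = (if i = 0 then \<zero>\<^bsub>K\<^esub> else chi V (dm (W i)))" for i
  have ac: "a i \<in> carrier K" if "i < Suc (Suc d)" for i using vc[of "Suc i"] by (simp add: a_def)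
  have wc': "w i \<in> carrier K" if "i < Suc (Suc d)" for i using wc[of i] that by (simp add: w_def)
  have "K.alt_sum (\<lambda>i. v' i V) (Suc (Suc d)) = K.alt_sum (\<lambda>i. a i \<oplus>\<^bsub>K\<^esub> w i) (Suc (Suc d))"
  proof (rule K.alt_sum_cong)
    fix i assume "i < Suc (Suc d)"
    then show "v' i V = a i \<oplus>\<^bsub>K\<^esub> w i"
      using vc[of 1] wc[of i] by (auto simp: v'_def a_def w_def)
  qed
  also have "\<dots> = K.alt_sum a (Suc (Suc d)) \<oplus>\<^bsub>K\<^esub> K.alt_sum w (Suc (Suc d))"
    using ac wc' by (intro K.alt_sum_add)
  also have "K.alt_sum a (Suc (Suc d)) = K.alt_sum a (Suc d)"
  proof (rule K.alt_sum_last_zero)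
    show "a i \<in> carrier K" if "i < Suc d" for i using ac that by simp
  qed (simp add: a_def)
  also have "K.alt_sum a (Suc d) = K.alt_sum (\<lambda>i. v (Suc i) V) (Suc d)"
    by (intro K.alt_sum_cong) (simp add: a_def)
  \<comment> \<open>The zero at the start of \<open>w\<close> delays the alternating sum of the
    coresolution by one place, which accounts for the sign.\<close>
  also have "K.alt_sum w (Suc (Suc d)) = \<ominus>\<^bsub>K\<^esub> v 0 V"
  proof -
    have "K.alt_sum (\<lambda>i. w (Suc i)) (Suc d) = v 0 V" unfolding W(4) by (simp add: w_def)
    then show ?thesis using vc[of 0] K.alt_sum.simps(2)[of w "Suc d"] by (simp add: w_def K.minus_eq)
  qed
  finally have e: "K.alt_sum (\<lambda>i. v (Suc i) V) (Suc d) \<oplus>\<^bsub>K\<^esub> \<ominus>\<^bsub>K\<^esub> v 0 V = \<zero>\<^bsub>K\<^esub>" using IH by simp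
  have sc: "K.alt_sum (\<lambda>i. v (Suc i) V) (Suc d) \<in> carrier K" using vc by (intro K.alt_sum_closed) simp
  have "K.alt_sum (\<lambda>i. v (Suc i) V) (Suc d) = v 0 V"
    using e sc vc[of 0] by (metis K.minus_eq K.r_right_minus_eq zero_le)
  moreover have "K.alt_sum (\<lambda>i. v i V) (Suc (Suc d)) = v 0 V \<ominus>\<^bsub>K\<^esub> K.alt_sum (\<lambda>i. v (Suc i) V) (Suc d)"
    by (rule K.alt_sum.simps(2))
  ultimately show ?case using vc[of 0] by simp
qed


section \<open>Resolutions and coindices from a cluster tilting object\<close>

lemma OT_rigid:
  assumes T: "OT_cluster_tilting C S A T" shows "rigid T"
proof -
  have TO: "T \<in> Ob C" using T by (simp add: OT_cluster_tilting_def)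
  obtain Z where "is_zero_object C Z" using zero_object by blast
  from summand_add_closure[OF zero_biprod[OF this mutual_inv_refl[OF TO]]]
  have "mor C T (fob S T) = {\<zero>\<^bsub>Hom C T (fob S T)\<^esub>}"
    using T by (simp add: OT_cluster_tilting_def)
  then have "F = zr T (fob S T)" if "arr F" "dm F = T" "cd F = fob S T" for F
    using that by (intro arrow_eqI) (auto simp: arr_def zr_def simp del: arr_Ob)
  then show ?thesis using TO by (simp add: rigid_def)
qed

lemma OT_resolution:
  assumes T: "OT_cluster_tilting C S A T" and M: "M \<in> Ob C"
  shows "\<exists>G. angle G \<and> (\<forall>i\<le>d. retract_of T (dm (G i))) \<and> dm (G (Suc d)) = M"
proof -
  obtain ts \<gamma> where t: "set ts \<subseteq> add_closure C T" "(ts @ [M], \<gamma>) \<in> A"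
    using assms by (auto simp: OT_cluster_tilting_def)
  obtain G where G: "angle G" "seq_lists G = (ts @ [M], \<gamma>)" using angle_of_list[OF t(2)] by blast
  have l: "ts @ [M] = map (\<lambda>i. dm (G i)) [0..<Suc (Suc d)]" using G(2) by (simp add: seq_lists_def)
  then have len: "length ts = Suc d" using arg_cong[OF l, of length] by simp
  have n: "dm (G i) = (ts @ [M]) ! i" if "i < Suc (Suc d)" for i
    unfolding l using that by (simp del: upt_Suc)
  have TO: "T \<in> Ob C" using T by (simp add: OT_cluster_tilting_def)
  have "retract_of T (dm (G i))" if i: "i \<le> d" for i
  proof -
    have "ts ! i \<in> add_closure C T" using t(1) len i by auto
    then show ?thesis using i n[of i] len add_closure_retract_of[OF TO] by (simp add: nth_append)
  qed
  moreover have "dm (G (Suc d)) = M" using n[of "Suc d"] len by (simp add: nth_append)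
  ultimately show ?thesis using G(1) by blast
qed

lemma ex_coindex:
  assumes T: "OT_cluster_tilting C S A T" and M: "M \<in> Ob C"
  shows "\<exists>v. coindex T M v"
proof -
  obtain H where H: "angle H" "\<forall>i\<le>d. retract_of T (dm (H i))" "dm (H (Suc d)) = fob S M"
    using OT_resolution[OF T, of "fob S M"] M by auto
  obtain W where W: "angle W" "dm (W 0) = M" "\<forall>i\<le>d. W (Suc i) = H i"
    using angle_unrot[OF H(1) M] H(3) by auto
  have "coindex T M (\<lambda>V. K.alt_sum (\<lambda>i. chi V (dm (W (Suc i)))) (Suc d))"
    unfolding coindex_def using W H(2) by (intro exI[of _ W]) simp
  then show ?thesis by blast
qed

section \<open>Linear combinations of coindices\<close>

text \<open>The vectors are the functions \<open>c M\<close> of the object \<open>V\<close>, one for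
  each \<open>M\<close> in \<open>R\<close>; \<open>a\<close> holds their coefficients.\<close>

definition lincomb :: "'o set \<Rightarrow> ('o \<Rightarrow> 'o \<Rightarrow> 'k) \<Rightarrow> ('o \<Rightarrow> 'k) \<Rightarrow> ('o \<Rightarrow> 'k)"
  where "lincomb R c a V = finsum K (\<lambda>M. a M \<otimes>\<^bsub>K\<^esub> c M V) R"

lemma lincomb_closed:
  assumes "a \<in> R \<rightarrow> carrier K" "\<And>M. M \<in> R \<Longrightarrow> c M V \<in> carrier K"
  shows "lincomb R c a V \<in> carrier K"
  unfolding lincomb_def using assms by (intro K.finsum_closed) auto

lemma lincomb_add:
  assumes "a \<in> R \<rightarrow> carrier K" "b \<in> R \<rightarrow> carrier K" "\<And>M. M \<in> R \<Longrightarrow> c M V \<in> carrier K"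
  shows "lincomb R c (\<lambda>M. a M \<oplus>\<^bsub>K\<^esub> b M) V = lincomb R c a V \<oplus>\<^bsub>K\<^esub> lincomb R c b V"
proof -
  have "lincomb R c (\<lambda>M. a M \<oplus>\<^bsub>K\<^esub> b M) V = finsum K (\<lambda>M. a M \<otimes>\<^bsub>K\<^esub> c M V \<oplus>\<^bsub>K\<^esub> b M \<otimes>\<^bsub>K\<^esub> c M V) R"
    unfolding lincomb_def using assms by (intro K.finsum_cong') (auto simp: K.l_distr Pi_iff)
  also have "\<dots> = lincomb R c a V \<oplus>\<^bsub>K\<^esub> lincomb R c b V"
    unfolding lincomb_def using assms by (intro K.finsum_addf) auto
  finally show ?thesis .
qed

lemma lincomb_smult:
  assumes "finite R" "l \<in> carrier K" "a \<in> R \<rightarrow> carrier K" "\<And>M. M \<in> R \<Longrightarrow> c M V \<in> carrier K"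
  shows "lincomb R c (\<lambda>M. l \<otimes>\<^bsub>K\<^esub> a M) V = l \<otimes>\<^bsub>K\<^esub> lincomb R c a V"
proof -
  have "lincomb R c (\<lambda>M. l \<otimes>\<^bsub>K\<^esub> a M) V = finsum K (\<lambda>M. l \<otimes>\<^bsub>K\<^esub> (a M \<otimes>\<^bsub>K\<^esub> c M V)) R"
    unfolding lincomb_def using assms by (intro K.finsum_cong') (auto simp: K.m_assoc Pi_iff)
  also have "\<dots> = l \<otimes>\<^bsub>K\<^esub> lincomb R c a V"
    unfolding lincomb_def using assms by (intro K.finsum_rdistr[symmetric]) auto
  finally show ?thesis .
qed

lemma lincomb_zero: "(\<And>M. M \<in> R \<Longrightarrow> c M V \<in> carrier K) \<Longrightarrow> lincomb R c (\<lambda>M. \<zero>\<^bsub>K\<^esub>) V = \<zero>\<^bsub>K\<^esub>"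
proof -
  assume "\<And>M. M \<in> R \<Longrightarrow> c M V \<in> carrier K"
  then have "lincomb R c (\<lambda>M. \<zero>\<^bsub>K\<^esub>) V = finsum K (\<lambda>M. \<zero>\<^bsub>K\<^esub>) R"
    unfolding lincomb_def by (intro K.finsum_cong') auto
  then show ?thesis by simp
qed

lemma lincomb_delta:
  assumes "finite R" "N \<in> R" "\<And>M. M \<in> R \<Longrightarrow> c M V \<in> carrier K"
  shows "lincomb R c (\<lambda>M. if M = N then \<one>\<^bsub>K\<^esub> else \<zero>\<^bsub>K\<^esub>) V = c N V"
proof -
  have "lincomb R c (\<lambda>M. if M = N then \<one>\<^bsub>K\<^esub> else \<zero>\<^bsub>K\<^esub>) V = finsum K (\<lambda>M. if N = M then c M V else \<zero>\<^bsub>K\<^esub>) R"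
    unfolding lincomb_def using assms by (intro K.finsum_cong') auto
  also have "\<dots> = c N V" using assms by (intro K.finsum_singleton) auto
  finally show ?thesis .
qed

lemma lincomb_finsum:
  assumes "finite J" "finite R" "\<And>j. j \<in> J \<Longrightarrow> l j \<in> carrier K" "\<And>j. j \<in> J \<Longrightarrow> a j \<in> R \<rightarrow> carrier K"
    "\<And>M. M \<in> R \<Longrightarrow> c M V \<in> carrier K"
  shows "finsum K (\<lambda>j. l j \<otimes>\<^bsub>K\<^esub> lincomb R c (a j) V) J = lincomb R c (\<lambda>M. finsum K (\<lambda>j. l j \<otimes>\<^bsub>K\<^esub> a j M) J) V"
  using assms(1,3,4)
proof (induction J rule: finite_induct)
  case empty
  then show ?case using lincomb_zero[of R c V] assms(5) by simp
next
  case (insert j J)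
  have "finsum K (\<lambda>j. l j \<otimes>\<^bsub>K\<^esub> lincomb R c (a j) V) (insert j J) =
      l j \<otimes>\<^bsub>K\<^esub> lincomb R c (a j) V \<oplus>\<^bsub>K\<^esub> finsum K (\<lambda>j. l j \<otimes>\<^bsub>K\<^esub> lincomb R c (a j) V) J"
    using insert lincomb_closed[of _ R c V] assms(5) by (intro K.finsum_insert) auto
  also have "\<dots> = lincomb R c (\<lambda>M. l j \<otimes>\<^bsub>K\<^esub> a j M) V \<oplus>\<^bsub>K\<^esub> lincomb R c (\<lambda>M. finsum K (\<lambda>j. l j \<otimes>\<^bsub>K\<^esub> a j M) J) V"
    using insert lincomb_smult[OF assms(2), of "l j" "a j" c V] assms(5) by simp
  also have "\<dots> = lincomb R c (\<lambda>M. l j \<otimes>\<^bsub>K\<^esub> a j M \<oplus>\<^bsub>K\<^esub> finsum K (\<lambda>j. l j \<otimes>\<^bsub>K\<^esub> a j M) J) V"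
    by (intro lincomb_add[symmetric] assms(5)) (use insert in \<open>auto intro!: K.finsum_closed simp: Pi_iff\<close>)
  also have "\<dots> = lincomb R c (\<lambda>M. finsum K (\<lambda>j. l j \<otimes>\<^bsub>K\<^esub> a j M) (insert j J)) V"
    unfolding lincomb_def
  proof (intro K.finsum_cong' refl)
    have m: "l i \<otimes>\<^bsub>K\<^esub> a i M \<in> carrier K" if "M \<in> R" "i \<in> insert j J" for i M
      using insert.prems(1)[OF that(2)] insert.prems(2)[OF that(2)] that(1) by auto
    have ins: "finsum K (\<lambda>j. l j \<otimes>\<^bsub>K\<^esub> a j M) (insert j J) =
        l j \<otimes>\<^bsub>K\<^esub> a j M \<oplus>\<^bsub>K\<^esub> finsum K (\<lambda>j. l j \<otimes>\<^bsub>K\<^esub> a j M) J" if "M \<in> R" for M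
      using insert.hyps m[OF that] by (intro K.finsum_insert) auto
    show "(\<lambda>M. finsum K (\<lambda>j. l j \<otimes>\<^bsub>K\<^esub> a j M) (insert j J) \<otimes>\<^bsub>K\<^esub> c M V) \<in> R \<rightarrow> carrier K"
      using m assms(5) by (auto intro!: K.finsum_closed K.m_closed)
    fix M assume "M \<in> R"
    from ins[OF this] show "(l j \<otimes>\<^bsub>K\<^esub> a j M \<oplus>\<^bsub>K\<^esub> finsum K (\<lambda>j. l j \<otimes>\<^bsub>K\<^esub> a j M) J) \<otimes>\<^bsub>K\<^esub> c M V =
        finsum K (\<lambda>j. l j \<otimes>\<^bsub>K\<^esub> a j M) (insert j J) \<otimes>\<^bsub>K\<^esub> c M V" by simp
  qed
  finally show ?case .
qed

text \<open>The coefficients must not depend on \<open>V\<close>; equality is asked only at objects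
  with local endomorphism ring.\<close>

definition spanned :: "'o set \<Rightarrow> ('o \<Rightarrow> 'o \<Rightarrow> 'k) \<Rightarrow> ('o \<Rightarrow> 'k) \<Rightarrow> bool"
  where "spanned R c v \<longleftrightarrow> (\<exists>a\<in>R \<rightarrow> carrier K. \<forall>V. local_ob V \<longrightarrow> v V = lincomb R c a V)"

lemma spanned_minus:
  assumes R: "finite R" and c: "\<And>M V. M \<in> R \<Longrightarrow> local_ob V \<Longrightarrow> c M V \<in> carrier K"
    and v: "spanned R c v" and w: "spanned R c w" and u: "\<And>V. local_ob V \<Longrightarrow> u V = v V \<ominus>\<^bsub>K\<^esub> w V"
  shows "spanned R c u"
proof -
  obtain a b where a: "a \<in> R \<rightarrow> carrier K" "\<And>V. local_ob V \<Longrightarrow> v V = lincomb R c a V"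
    and b: "b \<in> R \<rightarrow> carrier K" "\<And>V. local_ob V \<Longrightarrow> w V = lincomb R c b V"
    using v w unfolding spanned_def by blast
  let ?b = "\<lambda>M. \<ominus>\<^bsub>K\<^esub> \<one>\<^bsub>K\<^esub> \<otimes>\<^bsub>K\<^esub> b M"
  have b': "?b \<in> R \<rightarrow> carrier K" using b(1) by auto
  have "u V = lincomb R c (\<lambda>M. a M \<oplus>\<^bsub>K\<^esub> ?b M) V" if V: "local_ob V" for V
    using lincomb_add[OF a(1) b', of c V] lincomb_smult[OF R _ b(1), of "\<ominus>\<^bsub>K\<^esub> \<one>\<^bsub>K\<^esub>" c V] c[OF _ V]
      lincomb_closed[OF b(1), of c V] a(2)[OF V] b(2)[OF V] u[OF V]
    by (simp add: K.minus_eq K.l_minus)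
  moreover have "(\<lambda>M. a M \<oplus>\<^bsub>K\<^esub> ?b M) \<in> R \<rightarrow> carrier K" using a(1) b' by auto
  ultimately show ?thesis unfolding spanned_def by blast
qed

lemma spanned_cong: "spanned R c v \<Longrightarrow> (\<And>V. local_ob V \<Longrightarrow> v V = w V) \<Longrightarrow> spanned R c w"
  unfolding spanned_def by (metis (no_types, lifting))

lemma spanned_closed:
  assumes c: "\<And>M V. M \<in> R \<Longrightarrow> local_ob V \<Longrightarrow> c M V \<in> carrier K" and "spanned R c v" "local_ob V"
  shows "v V \<in> carrier K"
  using assms lincomb_closed unfolding spanned_def by metis

text \<open>Each unfolding of the alternating sum expresses its tail as a difference of two spanned
  functions; repeating this isolates the last term up to sign.\<close>

lemma spanned_last:
  assumes R: "finite R" and c: "\<And>M V. M \<in> R \<Longrightarrow> local_ob V \<Longrightarrow> c M V \<in> carrier K"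
  shows "(\<And>i. i < n \<Longrightarrow> spanned R c (v i)) \<Longrightarrow> (\<And>V. local_ob V \<Longrightarrow> v n V \<in> carrier K) \<Longrightarrow>
    spanned R c (\<lambda>V. K.alt_sum (\<lambda>i. v i V) (Suc n)) \<Longrightarrow> spanned R c (v n)"
proof (induction n arbitrary: v)
  case 0
  show ?case by (rule spanned_cong[OF 0(3)]) (use 0(2) in \<open>simp add: K.minus_eq\<close>)
next
  case (Suc n)
  let ?s = "\<lambda>V. K.alt_sum (\<lambda>i. v (Suc i) V) (Suc n)"
  have "spanned R c ?s"
  proof (rule spanned_minus[OF R c Suc.prems(1)[of 0] Suc.prems(3)])
    fix V assume V: "local_ob V"
    have vc: "v i V \<in> carrier K" if "i \<le> Suc n" for i
      using that spanned_closed[OF c Suc.prems(1) V] Suc.prems(2)[OF V] by (cases "i = Suc n") auto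
    then have "?s V \<in> carrier K" "v 0 V \<in> carrier K" by (auto intro!: K.alt_sum_closed simp del: K.alt_sum.simps)
    then show "?s V = v 0 V \<ominus>\<^bsub>K\<^esub> K.alt_sum (\<lambda>i. v i V) (Suc (Suc n))"
      unfolding K.alt_sum.simps(2)[of "\<lambda>i. v i V" "Suc n"]
      by (simp add: K.minus_eq K.minus_add K.a_assoc[symmetric] K.r_neg del: K.alt_sum.simps)
  qed auto
  then show ?case using Suc.IH[of "\<lambda>i. v (Suc i)"] Suc.prems by auto
qed

section \<open>Comparison of the two counts\<close>

text \<open>The roles are asymmetric: \<open>R\<close> has to represent all indecomposables of the
  closure of \<open>T\<close>, while \<open>Q\<close> has to consist of pairwise non-isomorphic ones
  for \<open>U\<close>. If \<open>Q\<close> were larger, the coefficient vectors expressing its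
  classes through the coindices of \<open>R\<close> would be linearly dependent, whereas the classes
  themselves are independent. The coindices of \<open>R\<close> may themselves be dependent.\<close>

lemma card_le:
  assumes T: "OT_cluster_tilting C S A T" and U: "OT_cluster_tilting C S A U"
    and R: "finite R" "\<And>M. M \<in> R \<Longrightarrow> local_ob M"
    "\<And>M. local_ob M \<Longrightarrow> retract_of T M \<Longrightarrow> \<exists>N\<in>R. \<exists>F G. mutual_inv M N F G"
    and Q: "finite Q" "\<And>M. M \<in> Q \<Longrightarrow> local_ob M \<and> retract_of U M"
    "\<And>M N F G. M \<in> Q \<Longrightarrow> N \<in> Q \<Longrightarrow> mutual_inv M N F G \<Longrightarrow> M = N"
  shows "card Q \<le> card R"
proof (rule ccontr)
  assume "\<not> card Q \<le> card R"
  then have lt: "card R < card Q" by simp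
  note rU = OT_rigid[OF U]
  have "\<forall>M. \<exists>v. M \<in> R \<longrightarrow> coindex U M v" using ex_coindex[OF U] locD(1)[OF R(2)] by blast
  from choice[OF this] obtain c where c: "\<And>M. M \<in> R \<Longrightarrow> coindex U M (c M)" by blast
  have cc: "c M V \<in> carrier K" if "M \<in> R" "local_ob V" for M V using coindex_closed[OF c] that by blast
  \<comment> \<open>Coindices must not be chosen afresh here: they are assembled from the fixed
    \<open>c\<close> along a decomposition into local objects, which keeps them in its span.\<close>
  have t: "\<exists>v. coindex U M v \<and> spanned R c v" if M: "retract_of T M" for M
  proof -
    obtain Ns where Ns: "is_direct_sum C Ns M" "\<And>N. N \<in> set Ns \<Longrightarrow> local_ob N" using ks_local_ob[OF retract_of_Ob[OF M]] by blast
    have "retract_of T B \<Longrightarrow> \<exists>v. coindex U B v \<and> spanned R c v" if "is_direct_sum C Ns B" for B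
      using that
    proof (induction rule: direct_sum_induct)
      case (zero Z)
      have "spanned R c (\<lambda>V. chi V Z)" unfolding spanned_def
        by (rule bexI[of _ "\<lambda>M. \<zero>\<^bsub>K\<^esub>"]) (use chi_zero[OF _ zero(1)] lincomb_zero[of R c] cc in auto)
      then show ?case using coindex_retract_of[OF retract_of_zero[OF zero(1)]] by blast
    next
      case (biprod L B' B I J P Q')
      have L: "local_ob L" "retract_of T L" using Ns(2)[OF biprod(1)] retract_of_summand[OF biprod(2) biprod(4)] by auto
      obtain w where w: "coindex U B' w" "spanned R c w"
        using biprod(3) retract_of_summand[OF biprod_swap[OF biprod(2)] biprod(4)] by blast
      obtain N F G where N: "N \<in> R" "mutual_inv L N F G" using R(3)[OF L] by blast
      obtain Z where Z: "is_zero_object C Z" using zero_object by blast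
      \<comment> \<open>The isomorphism between \<open>L\<close> and its representative
        \<open>N\<close> is used as a biproduct with a zero object, whose own coindex contributes
        nothing.\<close>
      have "coindex U L (\<lambda>V. c N V \<oplus>\<^bsub>K\<^esub> chi V Z)"
        using coindex_biprod[OF c[OF N(1)] coindex_retract_of[OF retract_of_zero[OF Z]] zero_biprod[OF Z mutual_inv_sym[OF N(2)]]] .
      from coindex_biprod[OF this w(1) biprod(2)]
      have "coindex U B (\<lambda>V. c N V \<oplus>\<^bsub>K\<^esub> chi V Z \<oplus>\<^bsub>K\<^esub> w V)" .
      moreover have "spanned R c (\<lambda>V. c N V \<oplus>\<^bsub>K\<^esub> chi V Z \<oplus>\<^bsub>K\<^esub> w V)"
      proof -
        obtain a where a: "a \<in> R \<rightarrow> carrier K" "\<And>V. local_ob V \<Longrightarrow> w V = lincomb R c a V"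
          using w(2) unfolding spanned_def by blast
        let ?d = "\<lambda>M. if M = N then \<one>\<^bsub>K\<^esub> else \<zero>\<^bsub>K\<^esub>"
        have d: "?d \<in> R \<rightarrow> carrier K" by auto
        have "c N V \<oplus>\<^bsub>K\<^esub> chi V Z \<oplus>\<^bsub>K\<^esub> w V = lincomb R c (\<lambda>M. ?d M \<oplus>\<^bsub>K\<^esub> a M) V" if V: "local_ob V" for V
          using lincomb_add[OF d a(1), of c V] lincomb_delta[OF R(1) N(1), of c V] cc[OF _ V] chi_zero[OF V Z] a(2)[OF V] N(1)
          by simp
        moreover have "(\<lambda>M. ?d M \<oplus>\<^bsub>K\<^esub> a M) \<in> R \<rightarrow> carrier K" using a(1) by auto
        ultimately show ?thesis unfolding spanned_def by blast
      qed
      ultimately show ?case by blast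
    qed
    then show ?thesis using Ns(1) M by blast
  qed
  have s: "spanned R c (\<lambda>V. chi V M)" if M: "M \<in> Q" for M
  proof -
    have M': "local_ob M" "retract_of U M" using Q(2)[OF M] by auto
    obtain G where G: "angle G" "\<forall>i\<le>d. retract_of T (dm (G i))" "dm (G (Suc d)) = M"
      using OT_resolution[OF T locD(1)[OF M'(1)]] by blast
    have "\<forall>i. \<exists>v. i \<le> d \<longrightarrow> coindex U (dm (G i)) v \<and> spanned R c v" using t G(2) by blast
    from choice[OF this] obtain v0 where v0: "\<And>i. i \<le> d \<Longrightarrow> coindex U (dm (G i)) (v0 i) \<and> spanned R c (v0 i)" by blast
    \<comment> \<open>The last term lies in the closure of \<open>U\<close> and therefore enters
      with its own class, the one to be solved for.\<close>
    define v where "v i = (if i \<le> d then v0 i else (\<lambda>V. chi V M))" for i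
    have z: "K.alt_sum (\<lambda>i. v i V) (Suc (Suc d)) = \<zero>\<^bsub>K\<^esub>" if V: "local_ob V" for V
    proof (rule alt_sum_coindex[OF rU V _ G(1), of "Suc d"])
      fix i assume "Suc d \<le> i" "i \<le> Suc d"
      then have "i = Suc d" by simp
      then show "retract_of U (dm (G i)) \<and> (\<forall>V. local_ob V \<longrightarrow> v i V = chi V (dm (G i)))" using G(3) M' by (simp add: v_def)
    qed (use v0 in \<open>auto simp: v_def\<close>)
    have "spanned R c (v (Suc d))"
    proof (rule spanned_last[OF R(1) cc])
      show "spanned R c (v i)" if "i < Suc d" for i using v0[of i] that by (simp add: v_def)
      show "v (Suc d) V \<in> carrier K" if "local_ob V" for V using that locD(1)[OF M'(1)] by (simp add: v_def)
      show "spanned R c (\<lambda>V. K.alt_sum (\<lambda>i. v i V) (Suc (Suc d)))"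
        unfolding spanned_def by (rule bexI[of _ "\<lambda>M. \<zero>\<^bsub>K\<^esub>"]) (use z lincomb_zero[of R c] cc in auto)
    qed
    then show ?thesis by (simp add: v_def)
  qed
  have "\<forall>M. \<exists>a. M \<in> Q \<longrightarrow> a \<in> R \<rightarrow> carrier K \<and> (\<forall>V. local_ob V \<longrightarrow> chi V M = lincomb R c a V)"
    using s unfolding spanned_def by blast
  from choice[OF this] obtain a where a: "\<And>M. M \<in> Q \<Longrightarrow> a M \<in> R \<rightarrow> carrier K"
    "\<And>M V. M \<in> Q \<Longrightarrow> local_ob V \<Longrightarrow> chi V M = lincomb R c (a M) V" by blast
  obtain l where l: "\<forall>j\<in>Q. l j \<in> carrier K" "\<exists>j\<in>Q. l j \<noteq> \<zero>\<^bsub>K\<^esub>"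
    "\<forall>k\<in>R. finsum K (\<lambda>j. l j \<otimes>\<^bsub>K\<^esub> a j k) Q = \<zero>\<^bsub>K\<^esub>"
    using K.underdetermined_system[OF R(1) Q(1) lt, of a] a(1) by (auto simp: Pi_iff)
  have "l V = \<zero>\<^bsub>K\<^esub>" if V: "V \<in> Q" for V
  proof -
    have lV: "local_ob V" using Q(2)[OF V] by simp
    \<comment> \<open>On \<open>Q\<close> the values of \<open>chi\<close> form the identity matrix,
      so evaluating the relation at \<open>V\<close> isolates the coefficient
      \<open>l V\<close>.\<close>
    have ch: "chi V M = (if V = M then \<one>\<^bsub>K\<^esub> else \<zero>\<^bsub>K\<^esub>)" if "M \<in> Q" for M
      using chi_self[OF lV] chi_noniso[OF lV, of M] Q(2)[OF that] Q(3)[OF that V] by auto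
    have "l V = finsum K (\<lambda>M. if V = M then l M else \<zero>\<^bsub>K\<^esub>) Q"
      using l(1) V Q(1) by (intro K.finsum_singleton[symmetric]) auto
    also have "\<dots> = finsum K (\<lambda>M. l M \<otimes>\<^bsub>K\<^esub> lincomb R c (a M) V) Q"
      using l(1) a ch lV cc lincomb_closed[OF a(1), of _ c V] by (intro K.finsum_cong') (auto simp flip: a(2))
    also have "\<dots> = lincomb R c (\<lambda>M. finsum K (\<lambda>j. l j \<otimes>\<^bsub>K\<^esub> a j M) Q) V"
      using l(1) a(1) cc lV by (intro lincomb_finsum Q(1) R(1)) auto
    also have "\<dots> = lincomb R c (\<lambda>M. \<zero>\<^bsub>K\<^esub>) V"
      unfolding lincomb_def using l(3) cc[OF _ lV] by (intro K.finsum_cong') auto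
    also have "\<dots> = \<zero>\<^bsub>K\<^esub>" using cc lV by (intro lincomb_zero)
    finally show ?thesis .
  qed
  then show False using l(2) by blast
qed

lemma card_indec_classes:
  assumes T: "OT_cluster_tilting C S A T" and U: "OT_cluster_tilting C S A U"
  shows "finite (indec_classes C (add_closure C T)) \<and>
    card (indec_classes C (add_closure C U)) \<le> card (indec_classes C (add_closure C T))"
proof -
  have TU: "T \<in> Ob C" "U \<in> Ob C" using T U by (simp_all add: OT_cluster_tilting_def)
  obtain R where R: "finite (indec_classes C (add_closure C T))" "finite R"
    "card R = card (indec_classes C (add_closure C T))"
    "\<And>M. M \<in> R \<Longrightarrow> local_ob M \<and> retract_of T M"
    "\<And>M N F G. M \<in> R \<Longrightarrow> N \<in> R \<Longrightarrow> mutual_inv M N F G \<Longrightarrow> M = N"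
    "\<And>M. local_ob M \<Longrightarrow> retract_of T M \<Longrightarrow> \<exists>N\<in>R. \<exists>F G. mutual_inv M N F G"
    by (rule indec_representatives[OF TU(1)]) blast
  obtain Q where Q: "finite (indec_classes C (add_closure C U))" "finite Q"
    "card Q = card (indec_classes C (add_closure C U))"
    "\<And>M. M \<in> Q \<Longrightarrow> local_ob M \<and> retract_of U M"
    "\<And>M N F G. M \<in> Q \<Longrightarrow> N \<in> Q \<Longrightarrow> mutual_inv M N F G \<Longrightarrow> M = N"
    "\<And>M. local_ob M \<Longrightarrow> retract_of U M \<Longrightarrow> \<exists>N\<in>Q. \<exists>F G. mutual_inv M N F G"
    by (rule indec_representatives[OF TU(2)]) blast
  have "card Q \<le> card R"
    by (rule card_le[OF T U R(2) _ R(6) Q(2) Q(4) Q(5)]) (use R(4) in auto)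
  then show ?thesis using R(1,3) Q(3) by simp
qed

end

theorem theoremB:
  fixes K :: "'k ring" and C :: "('k, 'o, 'm) lincat"
    and S :: "('o, 'm) endo" and d :: nat and A :: "('o, 'm) sequence set"
    and T U :: 'o
  assumes "algebraically_closed K"
    and "angulated_category K C S d A"
    and "hom_finite K C"
    and "krull_schmidt C"
    and "calabi_yau_2d K C S"
    and "OT_cluster_tilting C S A T" and "basic_object C T"
    and "OT_cluster_tilting C S A U" and "basic_object C U"
  shows "finite (indec_classes C (add_closure C T)) \<and>
    finite (indec_classes C (add_closure C U)) \<and>
    card (indec_classes C (add_closure C T)) = card (indec_classes C (add_closure C U))"
proof -
  interpret angulated_ks K C S d A
    by (intro angulated_ks.intro ks_category.intro ks_category_axioms.intro
        angulated_category.axioms(1)[OF assms(2)] assms)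
  show ?thesis using card_indec_classes[OF assms(6,8)] card_indec_classes[OF assms(8,6)] by simp
qed

end
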